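(* Let $U$ be an affine open subset of $X$, let $g$ be a non-zero function in $A=\mathcal A(U)$, let $U_g$ be $U$ without the locus of zeros of $g$, and let $A_g=\mathcal A(U_g)$ be the localization of $A$ at $g$. Then for every $\eta\in\mathcal V(U)$ the following relation holds in $\widehat{\mathcal J}(U_g)$ and in $\widehat{\mathcal{AV}}(U_g)$: $$1\#\frac1g\eta=\sum_{k=0}^\infty\sum_{s=0}^k(-1)^s\binom ks\frac1{g^{s+1}}\#g^s\eta=\sum_{k=0}^\infty\Big(\frac1{g^{k+1}}\otimes1\Big)\delta(g)^k\,\eta .$$
   Context: $K$ is an algebraically closed field of characteristic $0$; $X$ is a smooth irreducible quasi-projective variety over $K$; $\mathcal A$, $\mathcal V$ are the sheaves of regular functions and of vector fields on $X$. For an affine open $W\subset X$ with $B=\mathcal A(W)$: $\Delta$ is the kernel of multiplication $B\otimes_KB\to B$; $\delta(f)=f\otimes1-1\otimes f\in\Delta$ for $f\in B$. The space $B\#\mathcal V(W)=B\otimes_K\mathcal V(W)=(B\otimes_KB)\otimes_B\mathcal V(W)$ (tensor over the second factor) is a Lie algebra with bracket $[a_1\#\eta_1,a_2\#\eta_2]=a_1\eta_1(a_2)\#\eta_2-a_2\eta_2(a_1)\#\eta_1+a_1a_2\#[\eta_1,\eta_2]$; for $u=\sum_i a_i\otimes b_i\in B\otimes_KB$ one writes $u\,\eta=\sum_i a_i\#b_i\eta$. Put $J_k(W)=\Delta^{k+1}\otimes_B\mathcal V(W)$ and $\widehat{\mathcal J}(W)=\varprojlim_k (B\#\mathcal V(W))/J_k(W)$;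 infinite sums converge in this inverse limit topology. $\widehat{\mathcal J}(W)$ is a left $B$-module and acts on $B$ by derivations via the anchor map extending $a\#\eta\mapsto a\eta$. $\widehat{\mathcal{AV}}(W)=D(B,\widehat{\mathcal J}(W))$ is the quotient of the smash product $B\#\mathcal U(\widehat{\mathcal J}(W))$ (relation $s\cdot a=a\cdot s+s(a)$) by the ideal generated by $a\cdot s-as$, $a\in B$, $s\in\widehat{\mathcal J}(W)$; elements of $\widehat{\mathcal J}(W)$ are regarded in $\widehat{\mathcal{AV}}(W)$ via the natural map. *)

theory Defs
  imports
    "HOL-Analysis.Analysis"
    "HOL-Algebra.Module"
    "HOL-Algebra.QuotRing"
    "HOL-Algebra.Ideal_Product"
    "HOL-Library.Poly_Mapping"
    "HOL-Computational_Algebra.Polynomial"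
begin

section \<open>Polynomials and projective space\<close>

type_synonym ('v, 'k) mpoly = "('v \<Rightarrow>\<^sub>0 nat) \<Rightarrow>\<^sub>0 'k"

definition mp_eval :: "('v, 'k::comm_ring_1) mpoly \<Rightarrow> ('v \<Rightarrow> 'k) \<Rightarrow> 'k" where
  "mp_eval F x = (\<Sum>m\<in>Poly_Mapping.keys F. Poly_Mapping.lookup F m *
     (\<Prod>i\<in>Poly_Mapping.keys m. x i ^ Poly_Mapping.lookup m i))"

text \<open>The value at \<open>x\<close> of the formal partial derivative of \<open>F\<close> with respect to the variable \<open>i\<close>.\<close>

definition mp_pderiv_eval :: "'v \<Rightarrow> ('v, 'k::comm_ring_1) mpoly \<Rightarrow> ('v \<Rightarrow> 'k) \<Rightarrow> 'k" where
  "mp_pderiv_eval i F x = (\<Sum>m\<in>Poly_Mapping.keys F. Poly_Mapping.lookup F m *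
     of_nat (Poly_Mapping.lookup m i) * x i ^ (Poly_Mapping.lookup m i - 1) *
     (\<Prod>j\<in>Poly_Mapping.keys m - {i}. x j ^ Poly_Mapping.lookup m j))"

definition homogeneous :: "nat \<Rightarrow> ('v, 'k::zero) mpoly \<Rightarrow> bool" where
  "homogeneous d F \<longleftrightarrow> (\<forall>m\<in>Poly_Mapping.keys F.
     (\<Sum>i\<in>Poly_Mapping.keys m. Poly_Mapping.lookup m i) = d)"

definition proj_rel :: "('k::field)^'n \<Rightarrow> 'k^'n \<Rightarrow> bool" where
  "proj_rel u v \<longleftrightarrow> u \<noteq> 0 \<and> v \<noteq> 0 \<and> (\<exists>c. c \<noteq> 0 \<and> u = c *s v)"

text \<open>
  The projective space of dimension \<open>CARD('n) - 1\<close>. Below, homogeneous coordinates of a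
  point are those of the chosen representative \<open>rep_proj P\<close>; only statements that do not
  depend on this choice are made with them.
\<close>

quotient_type (overloaded) ('k, 'n) proj = "('k::field)^('n::finite)" / partial: proj_rel
proof (rule part_equivpI)
  have "proj_rel (vec 1 :: 'k^'n) (vec 1)"
    unfolding proj_rel_def by (auto simp: vec_eq_iff intro!: exI[of _ 1])
  then show "\<exists>x :: 'k^'n. proj_rel x x" ..
  show "symp (proj_rel :: 'k^'n \<Rightarrow> _)"
  proof (rule sympI)
    fix u v :: "'k^'n" assume "proj_rel u v"
    then obtain c where "u \<noteq> 0" "v \<noteq> 0" "c \<noteq> 0" "u = c *s v"
      unfolding proj_rel_def by blast
    then show "proj_rel v u"
      unfolding proj_rel_def by (auto intro!: exI[of _ "inverse c"] simp: vec_eq_iff)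
  qed
  show "transp (proj_rel :: 'k^'n \<Rightarrow> _)"
  proof (rule transpI)
    fix u v w :: "'k^'n" assume "proj_rel u v" "proj_rel v w"
    then obtain c d where "u \<noteq> 0" "w \<noteq> 0" "c \<noteq> 0" "d \<noteq> 0" "u = c *s v" "v = d *s w"
      unfolding proj_rel_def by blast
    then show "proj_rel u w"
      unfolding proj_rel_def by (auto intro!: exI[of _ "c * d"] simp: vec_eq_iff)
  qed
qed

definition proj_eval :: "('n, 'k::field) mpoly \<Rightarrow> ('k, 'n::finite) proj \<Rightarrow> 'k" where
  "proj_eval F P = mp_eval F (vec_nth (rep_proj P))"

definition zariski :: "('k::field, 'n::finite) proj topology" where
  "zariski = topology_generated_by
     {{P. proj_eval F P \<noteq> 0} | (F :: ('n, 'k) mpoly). \<exists>d. homogeneous d F}"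


section \<open>Quasi-projective varieties and regular functions\<close>

definition irreducible_space :: "'a topology \<Rightarrow> bool" where
  "irreducible_space T \<longleftrightarrow> topspace T \<noteq> {} \<and>
     (\<forall>C D. closedin T C \<longrightarrow> closedin T D \<longrightarrow> C \<union> D = topspace T \<longrightarrow>
        C = topspace T \<or> D = topspace T)"

definition krull_dim :: "'a topology \<Rightarrow> enat" where
  "krull_dim T = Sup {enat n | n. \<exists>Z.
     (\<forall>i\<le>n. closedin T (Z i) \<and> irreducible_space (subtopology T (Z i))) \<and>
     (\<forall>i<n. Z i \<subset> Z (Suc i))}"

definition zariski_on :: "('k::field, 'n::finite) proj set \<Rightarrow> ('k, 'n) proj topology" where
  "zariski_on X = subtopology zariski X"

definition quasi_projective :: "('k::field, 'n::finite) proj set \<Rightarrow> bool" where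
  "quasi_projective X \<longleftrightarrow> (\<exists>C N. closedin zariski C \<and> openin zariski N \<and> X = C \<inter> N)"

text \<open>
  The tangent space at (a representative of) \<open>P\<close> of the affine cone over the closure of \<open>X\<close>.
  Its dimension exceeds that of the tangent space of \<open>X\<close> at \<open>P\<close> by one, so that
  smoothness below is the Jacobian criterion at every point.
\<close>

definition cone_tangent_space ::
    "('k::field, 'n::finite) proj set \<Rightarrow> ('k, 'n) proj \<Rightarrow> ('k^'n) set" where
  "cone_tangent_space X P = {w. \<forall>d (F :: ('n, 'k) mpoly). homogeneous d F \<longrightarrow>
     (\<forall>Q\<in>X. proj_eval F Q = 0) \<longrightarrow>
     (\<Sum>i\<in>UNIV. mp_pderiv_eval i F (vec_nth (rep_proj P)) * w $ i) = 0}"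

definition smooth_variety :: "('k::field, 'n::finite) proj set \<Rightarrow> bool" where
  "smooth_variety X \<longleftrightarrow>
     (\<forall>P\<in>X. enat (vec.dim (cone_tangent_space X P)) = krull_dim (zariski_on X) + 1)"

text \<open>
  Functions on \<open>W\<close> that are locally quotients of a pair from \<open>Q\<close>. A function on a subset \<open>W\<close>
  is represented by its extension by zero outside \<open>W\<close>, throughout.
\<close>

definition locally_quotient ::
    "'p topology \<Rightarrow> (('p \<Rightarrow> 'k) \<times> ('p \<Rightarrow> 'k)) set \<Rightarrow> 'p set \<Rightarrow> ('p \<Rightarrow> 'k::field) set" where
  "locally_quotient T Q W = {f. (\<forall>x. x \<notin> W \<longrightarrow> f x = 0) \<and>
     (\<forall>x\<in>W. \<exists>N p q. openin T N \<and> x \<in> N \<and> N \<subseteq> W \<and> (p, q) \<in> Q \<and>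
        (\<forall>y\<in>N. q y \<noteq> 0 \<and> f y = p y / q y))}"

definition regular_functions ::
    "('k::field, 'n::finite) proj set \<Rightarrow> ('k, 'n) proj set \<Rightarrow> (('k, 'n) proj \<Rightarrow> 'k) set" where
  "regular_functions X W = locally_quotient (zariski_on X)
     {(proj_eval F, proj_eval G) | F G. \<exists>d. homogeneous d F \<and> homogeneous d G} W"

text \<open>Affine \<open>m\<close>-space, with coordinates indexed by \<open>{..<m}\<close>.\<close>

definition affine_zariski :: "nat \<Rightarrow> (nat \<Rightarrow> 'k::field) topology" where
  "affine_zariski m = topology_generated_by
     {{x. (\<forall>i\<ge>m. x i = 0) \<and> mp_eval F x \<noteq> 0} | (F :: (nat, 'k) mpoly). True}"

definition affine_regular_functions ::
    "nat \<Rightarrow> (nat \<Rightarrow> 'k::field) set \<Rightarrow> (nat \<Rightarrow> 'k) set \<Rightarrow> ((nat \<Rightarrow> 'k) \<Rightarrow> 'k) set" where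
  "affine_regular_functions m Z W =
     locally_quotient (subtopology (affine_zariski m) Z) {(mp_eval F, mp_eval G) | F G. True} W"

text \<open>An open subset is affine if it is isomorphic to a closed subset of some affine space.\<close>

definition affine_open ::
    "('k::field, 'n::finite) proj set \<Rightarrow> ('k, 'n) proj set \<Rightarrow> bool" where
  "affine_open X W \<longleftrightarrow> openin (zariski_on X) W \<and>
     (\<exists>m Z \<phi>. closedin (affine_zariski m) Z \<and>
        homeomorphic_map (subtopology (zariski_on X) W) (subtopology (affine_zariski m) Z) \<phi> \<and>
        (\<forall>N f. openin (subtopology (affine_zariski m) Z) N \<longrightarrow> (\<forall>x. x \<notin> N \<longrightarrow> f x = 0) \<longrightarrow>
           (f \<in> affine_regular_functions m Z N \<longleftrightarrow>
            (\<lambda>P. if P \<in> W then f (\<phi> P) else 0) \<in> regular_functions X {P \<in> W. \<phi> P \<in> N})))"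


section \<open>Linear algebra over the ground field\<close>

text \<open>
  The ground field is a type. Vector spaces and algebras over it are records of type
  \<^typ>\<open>('k, 'a) module\<close>; multiplication and unit are left undefined where there are none.
\<close>

definition base_ring :: "'k::field ring" where
  "base_ring = \<lparr>carrier = UNIV, mult = (*), one = 1, zero = 0, add = (+)\<rparr>"

definition submodule_generated ::
    "('k::field, 'a, 'm) module_scheme \<Rightarrow> 'a set \<Rightarrow> 'a set" where
  "submodule_generated M S = \<Inter>{H. submodule H base_ring M \<and> S \<subseteq> H}"

definition quotient_module ::
    "('k, 'a, 'm) module_scheme \<Rightarrow> 'a set \<Rightarrow> ('k, 'a set) module" where
  "quotient_module M N =
     \<lparr>carrier = a_rcosets\<^bsub>M\<^esub> N, mult = undefined, one = undefined, zero = N, add = set_add M,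
      smult = (\<lambda>c A. \<Union>a\<in>A. N +>\<^bsub>M\<^esub> (c \<odot>\<^bsub>M\<^esub> a))\<rparr>"

definition quotient_algebra ::
    "('k, 'a, 'm) module_scheme \<Rightarrow> 'a set \<Rightarrow> ('k, 'a set) module" where
  "quotient_algebra M I =
     (quotient_module M I)\<lparr>mult := rcoset_mult M I, one := I +>\<^bsub>M\<^esub> \<one>\<^bsub>M\<^esub>\<rparr>"

definition free_module :: "'s set \<Rightarrow> ('k::field, 's \<Rightarrow>\<^sub>0 'k) module" where
  "free_module S =
     \<lparr>carrier = {f. Poly_Mapping.keys f \<subseteq> S}, mult = undefined, one = undefined,
      zero = 0, add = (+), smult = (\<lambda>c. Poly_Mapping.map ((*) c))\<rparr>"

text \<open>
  The value at \<open>u\<close> of the linear map into \<open>P\<close> given by \<open>h\<close> on basis elements, where \<open>u\<close> is a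
  coset, in a free module, of a submodule on which this linear map vanishes (so that the value
  does not depend on the chosen representative).
\<close>

definition lin_lift ::
    "('k::field, 'b, 'm) module_scheme \<Rightarrow> ('s \<Rightarrow> 'b) \<Rightarrow> ('s \<Rightarrow>\<^sub>0 'k) set \<Rightarrow> 'b" where
  "lin_lift P h u = (let f = SOME f. f \<in> u in
     \<Oplus>\<^bsub>P\<^esub>s\<in>Poly_Mapping.keys f. Poly_Mapping.lookup f s \<odot>\<^bsub>P\<^esub> h s)"

definition tensor_relations ::
    "('k::field, 'a, 'm) module_scheme \<Rightarrow> ('k, 'b, 'n) module_scheme \<Rightarrow> ('a \<times> 'b \<Rightarrow>\<^sub>0 'k) set" where
  "tensor_relations M N =
     {Poly_Mapping.single (a \<oplus>\<^bsub>M\<^esub> a', b) 1 - Poly_Mapping.single (a, b) 1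
        - Poly_Mapping.single (a', b) 1 | a a' b.
        a \<in> carrier M \<and> a' \<in> carrier M \<and> b \<in> carrier N} \<union>
     {Poly_Mapping.single (a, b \<oplus>\<^bsub>N\<^esub> b') 1 - Poly_Mapping.single (a, b) 1
        - Poly_Mapping.single (a, b') 1 | a b b'.
        a \<in> carrier M \<and> b \<in> carrier N \<and> b' \<in> carrier N} \<union>
     {Poly_Mapping.single (c \<odot>\<^bsub>M\<^esub> a, b) 1 - Poly_Mapping.single (a, b) c | c a b.
        a \<in> carrier M \<and> b \<in> carrier N} \<union>
     {Poly_Mapping.single (a, c \<odot>\<^bsub>N\<^esub> b) 1 - Poly_Mapping.single (a, b) c | c a b.
        a \<in> carrier M \<and> b \<in> carrier N}"

definition tensor_kernel ::
    "('k::field, 'a, 'm) module_scheme \<Rightarrow> ('k, 'b, 'n) module_scheme \<Rightarrow> ('a \<times> 'b \<Rightarrow>\<^sub>0 'k) set" where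
  "tensor_kernel M N =
     submodule_generated (free_module (carrier M \<times> carrier N)) (tensor_relations M N)"

definition tensor ::
    "('k::field, 'a, 'm) module_scheme \<Rightarrow> ('k, 'b, 'n) module_scheme \<Rightarrow>
     ('k, ('a \<times> 'b \<Rightarrow>\<^sub>0 'k) set) module" where
  "tensor M N = quotient_module (free_module (carrier M \<times> carrier N)) (tensor_kernel M N)"

definition pure ::
    "('k::field, 'a, 'm) module_scheme \<Rightarrow> ('k, 'b, 'n) module_scheme \<Rightarrow> 'a \<Rightarrow> 'b \<Rightarrow>
     ('a \<times> 'b \<Rightarrow>\<^sub>0 'k) set" where
  "pure M N a b = tensor_kernel M N +>\<^bsub>free_module (carrier M \<times> carrier N)\<^esub>
     Poly_Mapping.single (a, b) 1"

definition tensor_algebra_product ::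
    "('k::field, 'a, 'm) module_scheme \<Rightarrow> ('k, 'b, 'n) module_scheme \<Rightarrow>
     ('k, ('a \<times> 'b \<Rightarrow>\<^sub>0 'k) set) module" where
  "tensor_algebra_product M N = (tensor M N)
     \<lparr>mult := (\<lambda>u v. lin_lift (tensor M N) (\<lambda>(a, b).
        lin_lift (tensor M N) (\<lambda>(a', b'). pure M N (a \<otimes>\<^bsub>M\<^esub> a') (b \<otimes>\<^bsub>N\<^esub> b')) v) u),
      one := pure M N \<one>\<^bsub>M\<^esub> \<one>\<^bsub>N\<^esub>\<rparr>"

fun ideal_power :: "('a, 'm) ring_scheme \<Rightarrow> 'a set \<Rightarrow> nat \<Rightarrow> 'a set" where
  "ideal_power R I 0 = carrier R"
| "ideal_power R I (Suc k) = ideal_prod R (ideal_power R I k) I"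


section \<open>Universal enveloping algebras and smash products\<close>

record ('a, 'b) lie_alg = "('a, 'b) module" +
  lie_bracket :: "['b, 'b] \<Rightarrow> 'b"

definition free_algebra :: "'s set \<Rightarrow> ('k::field, 's list \<Rightarrow>\<^sub>0 'k) module" where
  "free_algebra S = (free_module (lists S))
     \<lparr>mult := (\<lambda>f g. \<Sum>u\<in>Poly_Mapping.keys f. \<Sum>v\<in>Poly_Mapping.keys g.
        Poly_Mapping.single (u @ v) (Poly_Mapping.lookup f u * Poly_Mapping.lookup g v)),
      one := Poly_Mapping.single [] 1\<rparr>"

text \<open>
  The first two families of relations turn the free algebra on the set \<open>carrier L\<close>
  into the tensor algebra of the vector space \<open>L\<close>.
\<close>

definition env_relations :: "('k::field, 'l, 'm) lie_alg_scheme \<Rightarrow> ('l list \<Rightarrow>\<^sub>0 'k) set" where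
  "env_relations L =
     {Poly_Mapping.single [x \<oplus>\<^bsub>L\<^esub> y] 1 - Poly_Mapping.single [x] 1 - Poly_Mapping.single [y] 1
        | x y. x \<in> carrier L \<and> y \<in> carrier L} \<union>
     {Poly_Mapping.single [c \<odot>\<^bsub>L\<^esub> x] 1 - Poly_Mapping.single [x] c | c x. x \<in> carrier L} \<union>
     {Poly_Mapping.single [x, y] 1 - Poly_Mapping.single [y, x] 1
        - Poly_Mapping.single [lie_bracket L x y] 1 | x y. x \<in> carrier L \<and> y \<in> carrier L}"

definition env_ideal :: "('k::field, 'l, 'm) lie_alg_scheme \<Rightarrow> ('l list \<Rightarrow>\<^sub>0 'k) set" where
  "env_ideal L = genideal (free_algebra (carrier L)) (env_relations L)"

definition env :: "('k::field, 'l, 'm) lie_alg_scheme \<Rightarrow> ('k, ('l list \<Rightarrow>\<^sub>0 'k) set) module" where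
  "env L = quotient_algebra (free_algebra (carrier L)) (env_ideal L)"

definition env_inj :: "('k::field, 'l, 'm) lie_alg_scheme \<Rightarrow> 'l \<Rightarrow> ('l list \<Rightarrow>\<^sub>0 'k) set" where
  "env_inj L x = env_ideal L +>\<^bsub>free_algebra (carrier L)\<^esub> Poly_Mapping.single [x] 1"

text \<open>The coproduct of the enveloping algebra: the algebra map in which elements of \<open>L\<close> are primitive.\<close>

definition env_coproduct ::
    "('k::field, 'l, 'm) lie_alg_scheme \<Rightarrow> ('l list \<Rightarrow>\<^sub>0 'k) set \<Rightarrow>
     (('l list \<Rightarrow>\<^sub>0 'k) set \<times> ('l list \<Rightarrow>\<^sub>0 'k) set \<Rightarrow>\<^sub>0 'k) set" where
  "env_coproduct L = (let U = env L; UU = tensor_algebra_product U U in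
     lin_lift UU (\<lambda>w. foldr (\<lambda>x t.
       (pure U U (env_inj L x) \<one>\<^bsub>U\<^esub> \<oplus>\<^bsub>UU\<^esub> pure U U \<one>\<^bsub>U\<^esub> (env_inj L x)) \<otimes>\<^bsub>UU\<^esub> t) w \<one>\<^bsub>UU\<^esub>))"

text \<open>The action of the enveloping algebra extending an action \<open>act\<close> of \<open>L\<close> on the vector space \<open>B\<close>.\<close>

definition env_act ::
    "('k::field, 'b, 'm) module_scheme \<Rightarrow> ('l \<Rightarrow> 'b \<Rightarrow> 'b) \<Rightarrow> ('l list \<Rightarrow>\<^sub>0 'k) set \<Rightarrow> 'b \<Rightarrow> 'b" where
  "env_act B act u b = lin_lift B (\<lambda>w. foldr act w b) u"

text \<open>
  The smash product of \<open>B\<close> with the enveloping algebra of \<open>L\<close>, where \<open>L\<close> acts on \<open>B\<close> by the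
  derivations \<open>act\<close>: the tensor product with the multiplication
  \<open>(a # u) (b # v) = \<Sum> a u\<^sub>1(b) # u\<^sub>2 v\<close>, where \<open>\<Sum> u\<^sub>1 \<otimes> u\<^sub>2\<close> is the coproduct of \<open>u\<close>.
\<close>

definition smash_product ::
    "('k::field, 'b, 'm) module_scheme \<Rightarrow> ('k, 'l, 'n) lie_alg_scheme \<Rightarrow> ('l \<Rightarrow> 'b \<Rightarrow> 'b) \<Rightarrow>
     ('k, ('b \<times> ('l list \<Rightarrow>\<^sub>0 'k) set \<Rightarrow>\<^sub>0 'k) set) module" where
  "smash_product B L act = (let U = env L; S = tensor B U in
     S\<lparr>mult := (\<lambda>x y. lin_lift S (\<lambda>(a, u). lin_lift S (\<lambda>(b, v).
          lin_lift S (\<lambda>(u1, u2). pure B U (a \<otimes>\<^bsub>B\<^esub> env_act B act u1 b) (u2 \<otimes>\<^bsub>U\<^esub> v))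
            (env_coproduct L u)) y) x),
       one := pure B U \<one>\<^bsub>B\<^esub> \<one>\<^bsub>U\<^esub>\<rparr>)"

text \<open>\<open>D(B, L)\<close>, where moreover \<open>L\<close> is a left \<open>B\<close>-module under \<open>bm\<close>.\<close>

definition D_ideal ::
    "('k::field, 'b, 'm) module_scheme \<Rightarrow> ('k, 'l, 'n) lie_alg_scheme \<Rightarrow> ('l \<Rightarrow> 'b \<Rightarrow> 'b) \<Rightarrow>
     ('b \<Rightarrow> 'l \<Rightarrow> 'l) \<Rightarrow> ('b \<times> ('l list \<Rightarrow>\<^sub>0 'k) set \<Rightarrow>\<^sub>0 'k) set set" where
  "D_ideal B L act bm = (let U = env L; S = smash_product B L act in
     genideal S {pure B U a \<one>\<^bsub>U\<^esub> \<otimes>\<^bsub>S\<^esub> pure B U \<one>\<^bsub>B\<^esub> (env_inj L s)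
        \<ominus>\<^bsub>S\<^esub> pure B U \<one>\<^bsub>B\<^esub> (env_inj L (bm a s)) | a s. a \<in> carrier B \<and> s \<in> carrier L})"

definition D_algebra ::
    "('k::field, 'b, 'm) module_scheme \<Rightarrow> ('k, 'l, 'n) lie_alg_scheme \<Rightarrow> ('l \<Rightarrow> 'b \<Rightarrow> 'b) \<Rightarrow>
     ('b \<Rightarrow> 'l \<Rightarrow> 'l) \<Rightarrow> ('k, ('b \<times> ('l list \<Rightarrow>\<^sub>0 'k) set \<Rightarrow>\<^sub>0 'k) set set) module" where
  "D_algebra B L act bm = quotient_algebra (smash_product B L act) (D_ideal B L act bm)"

definition D_map ::
    "('k::field, 'b, 'm) module_scheme \<Rightarrow> ('k, 'l, 'n) lie_alg_scheme \<Rightarrow> ('l \<Rightarrow> 'b \<Rightarrow> 'b) \<Rightarrow>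
     ('b \<Rightarrow> 'l \<Rightarrow> 'l) \<Rightarrow> 'l \<Rightarrow> ('b \<times> ('l list \<Rightarrow>\<^sub>0 'k) set \<Rightarrow>\<^sub>0 'k) set set" where
  "D_map B L act bm s =
     D_ideal B L act bm +>\<^bsub>smash_product B L act\<^esub> pure B (env L) \<one>\<^bsub>B\<^esub> (env_inj L s)"


section \<open>The sheaves of regular functions and of vector fields\<close>

definition Areg ::
    "('k::field, 'n::finite) proj set \<Rightarrow> ('k, 'n) proj set \<Rightarrow> ('k, ('k, 'n) proj \<Rightarrow> 'k) module" where
  "Areg X W =
     \<lparr>carrier = regular_functions X W,
      mult = (\<lambda>f g P. f P * g P), one = (\<lambda>P. if P \<in> W then 1 else 0),
      zero = (\<lambda>P. 0), add = (\<lambda>f g P. f P + g P), smult = (\<lambda>c f P. c * f P)\<rparr>"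

definition restrict_fun :: "'p set \<Rightarrow> ('p \<Rightarrow> 'k::zero) \<Rightarrow> 'p \<Rightarrow> 'k" where
  "restrict_fun W f = (\<lambda>P. if P \<in> W then f P else 0)"

definition derivation :: "('k, 'b, 'm) module_scheme \<Rightarrow> ('b \<Rightarrow> 'b) \<Rightarrow> bool" where
  "derivation B D \<longleftrightarrow> D \<in> carrier B \<rightarrow> carrier B \<and>
     (\<forall>f\<in>carrier B. \<forall>g\<in>carrier B. D (f \<oplus>\<^bsub>B\<^esub> g) = D f \<oplus>\<^bsub>B\<^esub> D g) \<and>
     (\<forall>c. \<forall>f\<in>carrier B. D (c \<odot>\<^bsub>B\<^esub> f) = c \<odot>\<^bsub>B\<^esub> D f) \<and>
     (\<forall>f\<in>carrier B. \<forall>g\<in>carrier B. D (f \<otimes>\<^bsub>B\<^esub> g) = D f \<otimes>\<^bsub>B\<^esub> g \<oplus>\<^bsub>B\<^esub> f \<otimes>\<^bsub>B\<^esub> D g)"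

text \<open>
  A vector field on \<open>W\<close> is a derivation of the structure sheaf restricted to \<open>W\<close>: a family of
  derivations \<open>\<eta> V\<close> of \<open>Areg X V\<close>, for \<open>V \<subseteq> W\<close> open, which commutes with restriction. Outside
  of these domains \<open>\<eta>\<close> is zero, which makes the representation unique.
\<close>

type_synonym ('k, 'n) vfield =
  "('k, 'n) proj set \<Rightarrow> (('k, 'n) proj \<Rightarrow> 'k) \<Rightarrow> ('k, 'n) proj \<Rightarrow> 'k"

definition is_vfield ::
    "('k::field, 'n::finite) proj set \<Rightarrow> ('k, 'n) proj set \<Rightarrow> ('k, 'n) vfield \<Rightarrow> bool" where
  "is_vfield X W \<eta> \<longleftrightarrow>
     (\<forall>V. openin (zariski_on X) V \<and> V \<subseteq> W \<longrightarrow> derivation (Areg X V) (\<eta> V)) \<and>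
     (\<forall>V V' f. openin (zariski_on X) V \<and> openin (zariski_on X) V' \<and> V' \<subseteq> V \<and> V \<subseteq> W \<and>
        f \<in> carrier (Areg X V) \<longrightarrow>
        \<eta> V' (restrict_fun V' f) = restrict_fun V' (\<eta> V f)) \<and>
     (\<forall>V f. \<not> (openin (zariski_on X) V \<and> V \<subseteq> W \<and> f \<in> carrier (Areg X V)) \<longrightarrow>
        \<eta> V f = (\<lambda>P. 0))"

definition Vect ::
    "('k::field, 'n::finite) proj set \<Rightarrow> ('k, 'n) proj set \<Rightarrow> ('k, ('k, 'n) vfield) lie_alg" where
  "Vect X W =
     \<lparr>carrier = {\<eta>. is_vfield X W \<eta>}, mult = undefined, one = undefined,
      zero = (\<lambda>V f P. 0), add = (\<lambda>\<eta> \<theta> V f P. \<eta> V f P + \<theta> V f P),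
      smult = (\<lambda>c \<eta> V f P. c * \<eta> V f P),
      lie_bracket = (\<lambda>\<eta> \<theta> V f P. \<eta> V (\<theta> V f) P - \<theta> V (\<eta> V f) P)\<rparr>"

definition vf_scale ::
    "(('k::field, 'n) proj \<Rightarrow> 'k) \<Rightarrow> ('k, 'n::finite) vfield \<Rightarrow> ('k, 'n) vfield" where
  "vf_scale h \<eta> = (\<lambda>V f P. h P * \<eta> V f P)"

definition restrict_vf ::
    "('k::field, 'n) proj set \<Rightarrow> ('k, 'n::finite) vfield \<Rightarrow> ('k, 'n) vfield" where
  "restrict_vf W \<eta> = (\<lambda>V f P. if V \<subseteq> W then \<eta> V f P else 0)"


section \<open>Jets of vector fields\<close>

type_synonym ('k, 'n) hash =
  "((('k, 'n) proj \<Rightarrow> 'k) \<times> ('k, 'n) vfield \<Rightarrow>\<^sub>0 'k) set"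

text \<open>The space \<open>B # \<V>(W)\<close>, for \<open>B = \<A>(W)\<close>, and its elements \<open>a # \<eta>\<close>.\<close>

definition hash ::
    "('k::field, 'n::finite) proj set \<Rightarrow> ('k, 'n) proj set \<Rightarrow>
     (('k, 'n) proj \<Rightarrow> 'k) \<Rightarrow> ('k, 'n) vfield \<Rightarrow> ('k, 'n) hash" where
  "hash X W a \<eta> = pure (Areg X W) (Vect X W) a \<eta>"

definition AhashV ::
    "('k::field, 'n::finite) proj set \<Rightarrow> ('k, 'n) proj set \<Rightarrow> ('k, ('k, 'n) hash) lie_alg" where
  "AhashV X W = (let B = Areg X W; T = tensor B (Vect X W) in
     module.extend T \<lparr>lie_bracket = (\<lambda>x y.
       lin_lift T (\<lambda>(a1, \<eta>1). lin_lift T (\<lambda>(a2, \<eta>2).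
         hash X W (a1 \<otimes>\<^bsub>B\<^esub> \<eta>1 W a2) \<eta>2 \<ominus>\<^bsub>T\<^esub> hash X W (a2 \<otimes>\<^bsub>B\<^esub> \<eta>2 W a1) \<eta>1
           \<oplus>\<^bsub>T\<^esub> hash X W (a1 \<otimes>\<^bsub>B\<^esub> a2) (lie_bracket (Vect X W) \<eta>1 \<eta>2)) y) x)\<rparr>)"

definition hash_lmult ::
    "('k::field, 'n::finite) proj set \<Rightarrow> ('k, 'n) proj set \<Rightarrow>
     (('k, 'n) proj \<Rightarrow> 'k) \<Rightarrow> ('k, 'n) hash \<Rightarrow> ('k, 'n) hash" where
  "hash_lmult X W b = lin_lift (AhashV X W) (\<lambda>(a, \<eta>). hash X W (b \<otimes>\<^bsub>Areg X W\<^esub> a) \<eta>)"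

definition hash_anchor ::
    "('k::field, 'n::finite) proj set \<Rightarrow> ('k, 'n) proj set \<Rightarrow> ('k, 'n) hash \<Rightarrow>
     (('k, 'n) proj \<Rightarrow> 'k) \<Rightarrow> ('k, 'n) proj \<Rightarrow> 'k" where
  "hash_anchor X W x b = lin_lift (Areg X W) (\<lambda>(a, \<eta>). a \<otimes>\<^bsub>Areg X W\<^esub> \<eta> W b) x"

type_synonym ('k, 'n) bitensor =
  "((('k, 'n) proj \<Rightarrow> 'k) \<times> (('k, 'n) proj \<Rightarrow> 'k) \<Rightarrow>\<^sub>0 'k) set"

definition Areg2 ::
    "('k::field, 'n::finite) proj set \<Rightarrow> ('k, 'n) proj set \<Rightarrow> ('k, ('k, 'n) bitensor) module" where
  "Areg2 X W = tensor_algebra_product (Areg X W) (Areg X W)"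

definition Delta ::
    "('k::field, 'n::finite) proj set \<Rightarrow> ('k, 'n) proj set \<Rightarrow> ('k, 'n) bitensor set" where
  "Delta X W = a_kernel (Areg2 X W) (Areg X W)
     (lin_lift (Areg X W) (\<lambda>(a, b). a \<otimes>\<^bsub>Areg X W\<^esub> b))"

definition delta ::
    "('k::field, 'n::finite) proj set \<Rightarrow> ('k, 'n) proj set \<Rightarrow>
     (('k, 'n) proj \<Rightarrow> 'k) \<Rightarrow> ('k, 'n) bitensor" where
  "delta X W f = (let B = Areg X W in pure B B f \<one>\<^bsub>B\<^esub> \<ominus>\<^bsub>Areg2 X W\<^esub> pure B B \<one>\<^bsub>B\<^esub> f)"

text \<open>\<open>u \<eta> = \<Sum> a\<^sub>i # b\<^sub>i \<eta>\<close> for \<open>u = \<Sum> a\<^sub>i \<otimes> b\<^sub>i\<close>.\<close>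

definition bitensor_vf ::
    "('k::field, 'n::finite) proj set \<Rightarrow> ('k, 'n) proj set \<Rightarrow>
     ('k, 'n) bitensor \<Rightarrow> ('k, 'n) vfield \<Rightarrow> ('k, 'n) hash" where
  "bitensor_vf X W u \<eta> = lin_lift (AhashV X W) (\<lambda>(a, b). hash X W a (vf_scale b \<eta>)) u"

text \<open>\<open>\<Delta>\<^bsup>k+1\<^esup> \<otimes>\<^sub>B \<V>(W)\<close>, as a subspace of \<open>(B \<otimes> B) \<otimes>\<^sub>B \<V>(W) = B # \<V>(W)\<close>.\<close>

definition Jker ::
    "('k::field, 'n::finite) proj set \<Rightarrow> ('k, 'n) proj set \<Rightarrow> nat \<Rightarrow> ('k, 'n) hash set" where
  "Jker X W k = submodule_generated (AhashV X W)
     {bitensor_vf X W u \<eta> | u \<eta>.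
        u \<in> ideal_power (Areg2 X W) (Delta X W) (k + 1) \<and> \<eta> \<in> carrier (Vect X W)}"

definition Jquot ::
    "('k::field, 'n::finite) proj set \<Rightarrow> ('k, 'n) proj set \<Rightarrow> nat \<Rightarrow>
     ('k, ('k, 'n) hash set) module" where
  "Jquot X W k = quotient_module (AhashV X W) (Jker X W k)"

text \<open>
  The inverse limit. The transition map from level \<open>k + 1\<close> to level \<open>k\<close> enlarges a coset of
  \<open>Jker X W (k + 1)\<close> to the coset of \<open>Jker X W k\<close> containing it.
\<close>

definition Jhat ::
    "('k::field, 'n::finite) proj set \<Rightarrow> ('k, 'n) proj set \<Rightarrow>
     ('k, nat \<Rightarrow> ('k, 'n) hash set) lie_alg" where
  "Jhat X W =
     \<lparr>carrier = {x. \<forall>k. x k \<in> carrier (Jquot X W k) \<and>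
        x k = Jker X W k <+>\<^bsub>AhashV X W\<^esub> x (Suc k)},
      mult = undefined, one = undefined, zero = (\<lambda>k. \<zero>\<^bsub>Jquot X W k\<^esub>),
      add = (\<lambda>x y k. x k \<oplus>\<^bsub>Jquot X W k\<^esub> y k), smult = (\<lambda>c x k. c \<odot>\<^bsub>Jquot X W k\<^esub> x k),
      lie_bracket = (\<lambda>x y k. \<Union>p\<in>x k. \<Union>q\<in>y k.
        Jker X W k +>\<^bsub>AhashV X W\<^esub> lie_bracket (AhashV X W) p q)\<rparr>"

definition to_Jhat ::
    "('k::field, 'n::finite) proj set \<Rightarrow> ('k, 'n) proj set \<Rightarrow>
     ('k, 'n) hash \<Rightarrow> nat \<Rightarrow> ('k, 'n) hash set" where
  "to_Jhat X W p = (\<lambda>k. Jker X W k +>\<^bsub>AhashV X W\<^esub> p)"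

definition Jhat_topology ::
    "('k::field, 'n::finite) proj set \<Rightarrow> ('k, 'n) proj set \<Rightarrow>
     (nat \<Rightarrow> ('k, 'n) hash set) topology" where
  "Jhat_topology X W = subtopology
     (product_topology (\<lambda>k. discrete_topology (carrier (Jquot X W k))) UNIV) (carrier (Jhat X W))"

definition Jhat_sums ::
    "('k::field, 'n::finite) proj set \<Rightarrow> ('k, 'n) proj set \<Rightarrow>
     (nat \<Rightarrow> nat \<Rightarrow> ('k, 'n) hash set) \<Rightarrow> (nat \<Rightarrow> ('k, 'n) hash set) \<Rightarrow> bool" where
  "Jhat_sums X W t x \<longleftrightarrow>
     limitin (Jhat_topology X W) (\<lambda>n. \<Oplus>\<^bsub>Jhat X W\<^esub>k\<in>{..<n}. t k) x sequentially"

definition Jhat_suminf ::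
    "('k::field, 'n::finite) proj set \<Rightarrow> ('k, 'n) proj set \<Rightarrow>
     (nat \<Rightarrow> nat \<Rightarrow> ('k, 'n) hash set) \<Rightarrow> nat \<Rightarrow> ('k, 'n) hash set" where
  "Jhat_suminf X W t = (THE x. Jhat_sums X W t x)"

definition Jhat_lmult ::
    "('k::field, 'n::finite) proj set \<Rightarrow> ('k, 'n) proj set \<Rightarrow>
     (('k, 'n) proj \<Rightarrow> 'k) \<Rightarrow> (nat \<Rightarrow> ('k, 'n) hash set) \<Rightarrow> nat \<Rightarrow> ('k, 'n) hash set" where
  "Jhat_lmult X W b x = (\<lambda>k. \<Union>p\<in>x k. Jker X W k +>\<^bsub>AhashV X W\<^esub> hash_lmult X W b p)"

text \<open>The anchor of \<open>B # \<V>(W)\<close> vanishes on \<open>Jker X W 0\<close>, so it extends to the inverse limit.\<close>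

definition Jhat_anchor ::
    "('k::field, 'n::finite) proj set \<Rightarrow> ('k, 'n) proj set \<Rightarrow> (nat \<Rightarrow> ('k, 'n) hash set) \<Rightarrow>
     (('k, 'n) proj \<Rightarrow> 'k) \<Rightarrow> ('k, 'n) proj \<Rightarrow> 'k" where
  "Jhat_anchor X W x b = hash_anchor X W (SOME p. p \<in> x 0) b"

definition AVhat ::
    "('k::field, 'n::finite) proj set \<Rightarrow> ('k, 'n) proj set \<Rightarrow>
     ('k, ((('k, 'n) proj \<Rightarrow> 'k) \<times> ((nat \<Rightarrow> ('k, 'n) hash set) list \<Rightarrow>\<^sub>0 'k) set \<Rightarrow>\<^sub>0 'k) set set)
       module" where
  "AVhat X W = D_algebra (Areg X W) (Jhat X W) (Jhat_anchor X W) (Jhat_lmult X W)"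

definition to_AVhat ::
    "('k::field, 'n::finite) proj set \<Rightarrow> ('k, 'n) proj set \<Rightarrow> (nat \<Rightarrow> ('k, 'n) hash set) \<Rightarrow>
     ((('k, 'n) proj \<Rightarrow> 'k) \<times> ((nat \<Rightarrow> ('k, 'n) hash set) list \<Rightarrow>\<^sub>0 'k) set \<Rightarrow>\<^sub>0 'k) set set" where
  "to_AVhat X W = D_map (Areg X W) (Jhat X W) (Jhat_anchor X W) (Jhat_lmult X W)"

end

theory Submission
  imports Defs
begin

text \<open>
  Put \<open>W = U\<^sub>g\<close>, \<open>B = \<A>(W)\<close>, and let \<open>h\<close> be the restriction of \<open>g\<close> to \<open>W\<close>, which is a unit of \<open>B\<close>.
  The statement is the geometric series in the commutative algebra \<open>B \<otimes> B\<close>. Let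
  \<open>u = 1/h \<otimes> 1\<close>, \<open>v = 1 \<otimes> h\<close>, \<open>v' = 1 \<otimes> 1/h\<close> and \<open>z = u \<delta>(h)\<close>. Since \<open>u (h \<otimes> 1) = 1\<close>, one has
  \<open>z = 1 - u v\<close>, and because \<open>v' v = 1\<close> the partial sums telescope to
  \<open>u + u z + \<dots> + u z\<^sup>n\<^sup>-\<^sup>1 = v' - v' z\<^sup>n\<close> (lemma \<open>geometric_sum\<close>). As \<open>\<delta>(h)\<close> lies in the ideal \<open>\<Delta>\<close>, the
  error \<open>v' z\<^sup>n\<close> lies in \<open>\<Delta>\<^sup>n\<close>. Applying the linear map \<open>w \<mapsto> w \<theta>\<close> to \<open>B # \<V>(W)\<close>, which sends \<open>v'\<close> to
  \<open>1 # (1/h) \<theta>\<close> and \<open>\<Delta>\<^sup>k\<^sup>+\<^sup>1\<close> into \<open>J\<^sub>k\<close>, shows that every component of the partial sums in the inverse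
  limit is eventually equal to that of \<open>1 # (1/h) \<theta>\<close>. This is convergence, the factors of the
  inverse limit being discrete (\<open>Jhat_sumsI\<close>).

  The two series agree term by term. On the one hand \<open>u z\<^sup>k = (1/h\<^sup>k\<^sup>+\<^sup>1 \<otimes> 1) \<delta>(h)\<^sup>k\<close>; on the other hand the
  binomial formula for \<open>(1 - u v)\<^sup>k\<close> (\<open>binomial_one_minus\<close>) expands \<open>u z\<^sup>k\<close> into the signed binomial
  sum of the tensors \<open>1/h\<^sup>s\<^sup>+\<^sup>1 \<otimes> h\<^sup>s\<close>. Both expansions are collected in \<open>inverse_vf_expansion\<close>. The relations
  in \<open>AVhat X W\<close> are the images of those in the inverse limit, where sums are unique because the
  topology is Hausdorff.

  Most of the text supplies the algebra behind this computation: the universal property of the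
  tensor product (\<open>tensor_lift\<close>), the fact that a tensor product of commutative algebras is a
  commutative algebra, the algebra of regular functions on an open set and the vector space of
  vector fields on it, and the additive structure of the inverse limit. The geometric input is
  that the set where a regular function does not vanish is open, and that a nowhere vanishing
  regular function is a unit.
\<close>

section \<open>Linear maps\<close>

lemma base_ring_simps [simp]:
  "carrier base_ring = UNIV" "mult base_ring = (*)" "one base_ring = 1"
  "zero base_ring = 0" "add base_ring = (+)"
  by (simp_all add: base_ring_def)

lemma base_ring_cring: "cring (base_ring :: 'k::field ring)"
proof (rule cringI)
  show "abelian_group (base_ring :: 'k ring)"
    by (rule abelian_groupI) (auto simp: add.assoc add.commute intro: exI[of _ "- x" for x])
  show "Group.comm_monoid (base_ring :: 'k ring)"
    by unfold_locales (auto simp: mult.assoc mult.commute)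
qed (auto simp: algebra_simps)

lemma base_ring_uminus [simp]: "\<ominus>\<^bsub>base_ring\<^esub> (c::'k::field) = - c"
proof -
  interpret cring "base_ring :: 'k ring" by (rule base_ring_cring)
  show ?thesis by (rule minus_equality) auto
qed

text \<open>
  The module laws with the operations of the record \<open>base_ring\<close> replaced by those of the field,
  which is the form in which rewriting can apply them.
\<close>

lemma base_ring_smult:
  assumes "module base_ring P"
  shows vs_closed: "x \<in> carrier P \<Longrightarrow> c \<odot>\<^bsub>P\<^esub> x \<in> carrier P"
    and vs_l_distr: "x \<in> carrier P \<Longrightarrow> (c + d) \<odot>\<^bsub>P\<^esub> x = c \<odot>\<^bsub>P\<^esub> x \<oplus>\<^bsub>P\<^esub> d \<odot>\<^bsub>P\<^esub> x"
    and vs_r_distr: "x \<in> carrier P \<Longrightarrow> y \<in> carrier P \<Longrightarrow> c \<odot>\<^bsub>P\<^esub> (x \<oplus>\<^bsub>P\<^esub> y) = c \<odot>\<^bsub>P\<^esub> x \<oplus>\<^bsub>P\<^esub> c \<odot>\<^bsub>P\<^esub> y"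
    and vs_assoc: "x \<in> carrier P \<Longrightarrow> (c * d) \<odot>\<^bsub>P\<^esub> x = c \<odot>\<^bsub>P\<^esub> (d \<odot>\<^bsub>P\<^esub> x)"
    and vs_one: "x \<in> carrier P \<Longrightarrow> 1 \<odot>\<^bsub>P\<^esub> x = x"
    and vs_l_null: "x \<in> carrier P \<Longrightarrow> 0 \<odot>\<^bsub>P\<^esub> x = \<zero>\<^bsub>P\<^esub>"
proof -
  interpret P: module base_ring P by fact
  show "x \<in> carrier P \<Longrightarrow> c \<odot>\<^bsub>P\<^esub> x \<in> carrier P"
    and "x \<in> carrier P \<Longrightarrow> (c + d) \<odot>\<^bsub>P\<^esub> x = c \<odot>\<^bsub>P\<^esub> x \<oplus>\<^bsub>P\<^esub> d \<odot>\<^bsub>P\<^esub> x"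
    and "x \<in> carrier P \<Longrightarrow> y \<in> carrier P \<Longrightarrow> c \<odot>\<^bsub>P\<^esub> (x \<oplus>\<^bsub>P\<^esub> y) = c \<odot>\<^bsub>P\<^esub> x \<oplus>\<^bsub>P\<^esub> c \<odot>\<^bsub>P\<^esub> y"
    and "x \<in> carrier P \<Longrightarrow> (c * d) \<odot>\<^bsub>P\<^esub> x = c \<odot>\<^bsub>P\<^esub> (d \<odot>\<^bsub>P\<^esub> x)"
    and "x \<in> carrier P \<Longrightarrow> 1 \<odot>\<^bsub>P\<^esub> x = x"
    and "x \<in> carrier P \<Longrightarrow> 0 \<odot>\<^bsub>P\<^esub> x = \<zero>\<^bsub>P\<^esub>"
    using P.smult_closed[of c x] P.smult_l_distr[of c d x] P.smult_r_distr[of c x y]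
      P.smult_assoc1[of c d x] P.smult_one[of x] P.smult_l_null[of x]
    by simp_all
qed

definition linear_map ::
    "('k::field, 'a, 'm) module_scheme \<Rightarrow> ('k, 'b, 'n) module_scheme \<Rightarrow> ('a \<Rightarrow> 'b) \<Rightarrow> bool" where
  "linear_map M P \<phi> \<longleftrightarrow> \<phi> \<in> carrier M \<rightarrow> carrier P \<and>
     (\<forall>x\<in>carrier M. \<forall>y\<in>carrier M. \<phi> (x \<oplus>\<^bsub>M\<^esub> y) = \<phi> x \<oplus>\<^bsub>P\<^esub> \<phi> y) \<and>
     (\<forall>c. \<forall>x\<in>carrier M. \<phi> (c \<odot>\<^bsub>M\<^esub> x) = c \<odot>\<^bsub>P\<^esub> \<phi> x)"

lemma linear_mapI:
  assumes "\<And>x. x \<in> carrier M \<Longrightarrow> \<phi> x \<in> carrier P"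
    and "\<And>x y. x \<in> carrier M \<Longrightarrow> y \<in> carrier M \<Longrightarrow> \<phi> (x \<oplus>\<^bsub>M\<^esub> y) = \<phi> x \<oplus>\<^bsub>P\<^esub> \<phi> y"
    and "\<And>c x. x \<in> carrier M \<Longrightarrow> \<phi> (c \<odot>\<^bsub>M\<^esub> x) = c \<odot>\<^bsub>P\<^esub> \<phi> x"
  shows "linear_map M P \<phi>"
  using assms by (auto simp: linear_map_def)

lemma linear_mapD:
  assumes "linear_map M P \<phi>"
  shows "x \<in> carrier M \<Longrightarrow> \<phi> x \<in> carrier P"
    and "x \<in> carrier M \<Longrightarrow> y \<in> carrier M \<Longrightarrow> \<phi> (x \<oplus>\<^bsub>M\<^esub> y) = \<phi> x \<oplus>\<^bsub>P\<^esub> \<phi> y"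
    and "x \<in> carrier M \<Longrightarrow> \<phi> (c \<odot>\<^bsub>M\<^esub> x) = c \<odot>\<^bsub>P\<^esub> \<phi> x"
  using assms by (auto simp: linear_map_def)

lemma linear_map_comp:
  "linear_map M N \<phi> \<Longrightarrow> linear_map N P \<psi> \<Longrightarrow> linear_map M P (\<lambda>x. \<psi> (\<phi> x))"
  by (intro linear_mapI) (simp_all add: linear_mapD)

lemma linear_map_zero:
  assumes "linear_map M P \<phi>" "module base_ring M" "module base_ring P"
  shows "\<phi> \<zero>\<^bsub>M\<^esub> = \<zero>\<^bsub>P\<^esub>"
proof -
  interpret M: module base_ring M by fact
  interpret P: module base_ring P by fact
  have "\<phi> (0 \<odot>\<^bsub>M\<^esub> \<zero>\<^bsub>M\<^esub>) = 0 \<odot>\<^bsub>P\<^esub> \<phi> \<zero>\<^bsub>M\<^esub>"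
    by (rule linear_mapD(3)[OF assms(1)]) simp
  then show ?thesis
    using M.smult_l_null[of "\<zero>\<^bsub>M\<^esub>"] P.smult_l_null[of "\<phi> \<zero>\<^bsub>M\<^esub>"] linear_mapD(1)[OF assms(1)]
    by simp
qed

lemma module_uminus_eq_smult:
  assumes "module base_ring M" "x \<in> carrier M"
  shows "\<ominus>\<^bsub>M\<^esub> x = (- 1) \<odot>\<^bsub>M\<^esub> x"
proof -
  interpret M: module base_ring M by fact
  show ?thesis using M.smult_l_minus[of 1 x] M.smult_one[of x] assms(2) by simp
qed

lemma linear_map_minus:
  assumes "linear_map M P \<phi>" "module base_ring M" "module base_ring P"
    and x: "x \<in> carrier M" and y: "y \<in> carrier M"
  shows "\<phi> (x \<ominus>\<^bsub>M\<^esub> y) = \<phi> x \<ominus>\<^bsub>P\<^esub> \<phi> y"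
proof -
  interpret M: module base_ring M by fact
  interpret P: module base_ring P by fact
  note L = linear_mapD[OF assms(1)]
  have "\<phi> (\<ominus>\<^bsub>M\<^esub> y) = \<ominus>\<^bsub>P\<^esub> \<phi> y"
    using module_uminus_eq_smult[OF assms(2) y] module_uminus_eq_smult[OF assms(3) L(1)[OF y]] L(3) y
    by simp
  then show ?thesis
    using L(2)[of x "\<ominus>\<^bsub>M\<^esub> y"] x y by (simp add: a_minus_def)
qed

lemma linear_map_finsum:
  assumes "linear_map M P \<phi>" "module base_ring M" "module base_ring P"
    and "finite A" "f \<in> A \<rightarrow> carrier M"
  shows "\<phi> (\<Oplus>\<^bsub>M\<^esub>i\<in>A. f i) = (\<Oplus>\<^bsub>P\<^esub>i\<in>A. \<phi> (f i))"
proof -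
  interpret M: module base_ring M by fact
  interpret P: module base_ring P by fact
  show ?thesis using assms(4,5)
  proof (induction A)
    case empty
    then show ?case using linear_map_zero[OF assms(1-3)] by simp
  next
    case (insert a A)
    then have "f \<in> A \<rightarrow> carrier M" "f a \<in> carrier M" by auto
    then have "(\<lambda>i. \<phi> (f i)) \<in> A \<rightarrow> carrier P" "\<phi> (f a) \<in> carrier P"
      using linear_mapD(1)[OF assms(1)] by auto
    with insert \<open>f \<in> A \<rightarrow> carrier M\<close> \<open>f a \<in> carrier M\<close> show ?case
      using linear_mapD(2)[OF assms(1)] by simp
  qed
qed

lemma linear_map_kernel_submodule:
  assumes "linear_map M P \<phi>" "module base_ring M" "module base_ring P"
  shows "submodule {x \<in> carrier M. \<phi> x = \<zero>\<^bsub>P\<^esub>} base_ring M"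
proof -
  interpret M: module base_ring M by fact
  interpret P: module base_ring P by fact
  note L = linear_mapD[OF assms(1)]
  show ?thesis
  proof (rule M.submoduleI)
    show c: "c \<odot>\<^bsub>M\<^esub> x \<in> {x \<in> carrier M. \<phi> x = \<zero>\<^bsub>P\<^esub>}"
      if "x \<in> {x \<in> carrier M. \<phi> x = \<zero>\<^bsub>P\<^esub>}" for c x
      using that L(3)[of x c] P.smult_r_null[of c] M.smult_closed[of c x] by simp
    show "\<ominus>\<^bsub>M\<^esub> x \<in> {x \<in> carrier M. \<phi> x = \<zero>\<^bsub>P\<^esub>}"
      if "x \<in> {x \<in> carrier M. \<phi> x = \<zero>\<^bsub>P\<^esub>}" for x
      using c[OF that, of "- 1"] module_uminus_eq_smult[OF assms(2)] that by simp
  qed (use L(2) linear_map_zero[OF assms] in auto)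
qed

text \<open>
  A module structure involves only the addition and the scalar multiplication. So it survives
  when a vector space is equipped with a product or a Lie bracket.
\<close>

lemma module_transfer:
  assumes "module R M" "carrier N = carrier M" "add N = add M" "zero N = zero M" "smult N = smult M"
  shows "module R N"
proof -
  interpret M: module R M by fact
  have "abelian_group N"
    by (rule abelian_groupI) (auto simp: assms(2-) M.add.m_ac intro: M.l_neg)
  then show ?thesis
    by (rule moduleI[OF M.R.is_cring])
      (auto simp: assms(2-) M.smult_l_distr M.smult_r_distr M.smult_assoc1)
qed


section \<open>Submodules and quotients\<close>

lemma submodule_abelian_subgroup:
  assumes "module base_ring M" "submodule N base_ring M"
  shows "abelian_subgroup N M"
proof -
  interpret M: module base_ring M by fact
  interpret submodule N base_ring M by fact
  show ?thesis
    by (rule abelian_subgroupI3[OF additive_subgroupI[OF subgroup_axioms] M.abelian_group_axioms])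
qed

lemma submodule_generated_submodule:
  assumes "module base_ring M" "S \<subseteq> carrier M"
  shows "submodule (submodule_generated M S) base_ring M"
proof -
  interpret M: module base_ring M by fact
  let ?F = "{H. submodule H base_ring M \<and> S \<subseteq> H}"
  have C: "carrier M \<in> ?F" using M.carrier_is_submodule assms(2) by auto
  show ?thesis unfolding submodule_generated_def
  proof (rule M.submoduleI)
    show "\<Inter>?F \<subseteq> carrier M" using C by blast
    show "\<zero>\<^bsub>M\<^esub> \<in> \<Inter>?F"
      using additive_subgroup.zero_closed[OF abelian_subgroup.axioms(1)[OF
          submodule_abelian_subgroup[OF assms(1)]]] by blast
    show "\<ominus>\<^bsub>M\<^esub> a \<in> \<Inter>?F" if "a \<in> \<Inter>?F" for a
      using M.submoduleE(3) that by blast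
    show "a \<oplus>\<^bsub>M\<^esub> b \<in> \<Inter>?F" if "a \<in> \<Inter>?F" "b \<in> \<Inter>?F" for a b
      using M.submoduleE(5) that by blast
    show "a \<odot>\<^bsub>M\<^esub> x \<in> \<Inter>?F" if "a \<in> carrier base_ring" "x \<in> \<Inter>?F" for a x
      using M.submoduleE(4) that by blast
  qed
qed

lemma submodule_generated_incl: "S \<subseteq> submodule_generated M S"
  by (auto simp: submodule_generated_def)

lemma submodule_generated_minimal:
  "submodule H base_ring M \<Longrightarrow> S \<subseteq> H \<Longrightarrow> submodule_generated M S \<subseteq> H"
  by (auto simp: submodule_generated_def)

lemma quotient_module_simps:
  "carrier (quotient_module M N) = a_rcosets\<^bsub>M\<^esub> N"
  "zero (quotient_module M N) = N"
  "add (quotient_module M N) = set_add M"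
  by (simp_all add: quotient_module_def)

context
  fixes M :: "('k::field, 'a, 'm) module_scheme" and N :: "'a set"
  assumes M: "module base_ring M" and N: "submodule N base_ring M"
begin

interpretation M: module base_ring M by (rule M)
interpretation N: abelian_subgroup N M by (rule submodule_abelian_subgroup[OF M N])

lemma coset_eq_iff:
  assumes "x \<in> carrier M" "y \<in> carrier M"
  shows "N +>\<^bsub>M\<^esub> x = N +>\<^bsub>M\<^esub> y \<longleftrightarrow> x \<ominus>\<^bsub>M\<^esub> y \<in> N"
proof
  assume "N +>\<^bsub>M\<^esub> x = N +>\<^bsub>M\<^esub> y"
  then have "x \<in> N +>\<^bsub>M\<^esub> y" using N.a_rcos_self[OF assms(1)] by simp
  then show "x \<ominus>\<^bsub>M\<^esub> y \<in> N"
    using N.a_rcos_module_imp[of y x] assms by (simp add: a_minus_def)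
next
  assume "x \<ominus>\<^bsub>M\<^esub> y \<in> N"
  then have "x \<in> N +>\<^bsub>M\<^esub> y"
    using N.a_rcos_module_rev[of y x] assms by (simp add: a_minus_def)
  then show "N +>\<^bsub>M\<^esub> x = N +>\<^bsub>M\<^esub> y"
    using M.a_repr_independence[OF _ assms(2) N.a_subgroup] by simp
qed

lemma quotient_smult_coset:
  assumes "x \<in> carrier M"
  shows "c \<odot>\<^bsub>quotient_module M N\<^esub> (N +>\<^bsub>M\<^esub> x) = N +>\<^bsub>M\<^esub> (c \<odot>\<^bsub>M\<^esub> x)"
proof -
  have "N +>\<^bsub>M\<^esub> (c \<odot>\<^bsub>M\<^esub> a) = N +>\<^bsub>M\<^esub> (c \<odot>\<^bsub>M\<^esub> x)" if a: "a \<in> N +>\<^bsub>M\<^esub> x" for a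
  proof -
    obtain n where n: "n \<in> N" "a = n \<oplus>\<^bsub>M\<^esub> x" using a by (auto simp: a_r_coset_def')
    have nM: "n \<in> carrier M" using n N.a_subset by auto
    have "c \<odot>\<^bsub>M\<^esub> a \<ominus>\<^bsub>M\<^esub> c \<odot>\<^bsub>M\<^esub> x = c \<odot>\<^bsub>M\<^esub> n"
      using n nM assms by (simp add: M.smult_r_distr a_minus_def M.a_assoc M.r_neg)
    also have "\<dots> \<in> N" using M.submoduleE(4)[OF N] n by simp
    finally show ?thesis using n nM assms by (subst coset_eq_iff) auto
  qed
  then have "(\<Union>a\<in>N +>\<^bsub>M\<^esub> x. N +>\<^bsub>M\<^esub> (c \<odot>\<^bsub>M\<^esub> a)) = N +>\<^bsub>M\<^esub> (c \<odot>\<^bsub>M\<^esub> x)"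
    using N.a_rcos_self[OF assms] by blast
  then show ?thesis by (simp add: quotient_module_def)
qed

lemma quotient_module_module: "module base_ring (quotient_module M N)"
proof (rule moduleI)
  have carrier: "\<exists>x\<in>carrier M. A = N +>\<^bsub>M\<^esub> x" if "A \<in> carrier (quotient_module M N)" for A
    using that by (auto simp: quotient_module_simps A_RCOSETS_def')
  have coset: "N +>\<^bsub>M\<^esub> x \<in> carrier (quotient_module M N)" if "x \<in> carrier M" for x
    using that by (auto simp: quotient_module_simps A_RCOSETS_def')
  have add: "(N +>\<^bsub>M\<^esub> x) \<oplus>\<^bsub>quotient_module M N\<^esub> (N +>\<^bsub>M\<^esub> y) = N +>\<^bsub>M\<^esub> (x \<oplus>\<^bsub>M\<^esub> y)"
    if "x \<in> carrier M" "y \<in> carrier M" for x y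
    using that by (simp add: quotient_module_simps N.a_rcos_sum)
  have zero: "\<zero>\<^bsub>quotient_module M N\<^esub> = N +>\<^bsub>M\<^esub> \<zero>\<^bsub>M\<^esub>"
    using N.a_subset by (simp add: quotient_module_simps)
  show "abelian_group (quotient_module M N)"
  proof (rule abelian_groupI)
    fix A B C
    assume A: "A \<in> carrier (quotient_module M N)"
    obtain x where x: "x \<in> carrier M" "A = N +>\<^bsub>M\<^esub> x" using carrier[OF A] by blast
    show "\<zero>\<^bsub>quotient_module M N\<^esub> \<oplus>\<^bsub>quotient_module M N\<^esub> A = A"
      using x by (simp add: zero add)
    show "\<exists>B\<in>carrier (quotient_module M N).
        B \<oplus>\<^bsub>quotient_module M N\<^esub> A = \<zero>\<^bsub>quotient_module M N\<^esub>"
      using x by (intro bexI[OF _ coset[of "\<ominus>\<^bsub>M\<^esub> x"]]) (simp_all add: zero add M.l_neg)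
    assume B: "B \<in> carrier (quotient_module M N)"
    obtain y where y: "y \<in> carrier M" "B = N +>\<^bsub>M\<^esub> y" using carrier[OF B] by blast
    show "A \<oplus>\<^bsub>quotient_module M N\<^esub> B \<in> carrier (quotient_module M N)"
      using x y by (simp add: add coset)
    show "A \<oplus>\<^bsub>quotient_module M N\<^esub> B = B \<oplus>\<^bsub>quotient_module M N\<^esub> A"
      using x y M.a_comm[of x y] by (simp add: add)
    assume C: "C \<in> carrier (quotient_module M N)"
    obtain z where z: "z \<in> carrier M" "C = N +>\<^bsub>M\<^esub> z" using carrier[OF C] by blast
    show "A \<oplus>\<^bsub>quotient_module M N\<^esub> B \<oplus>\<^bsub>quotient_module M N\<^esub> C =
        A \<oplus>\<^bsub>quotient_module M N\<^esub> (B \<oplus>\<^bsub>quotient_module M N\<^esub> C)"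
      using x y z by (simp add: add M.a_assoc)
  qed (simp add: zero coset)
next
  fix a b A B
  assume "A \<in> carrier (quotient_module M N)" "B \<in> carrier (quotient_module M N)"
  then obtain x y where x: "x \<in> carrier M" "A = N +>\<^bsub>M\<^esub> x" and y: "y \<in> carrier M" "B = N +>\<^bsub>M\<^esub> y"
    by (auto simp: quotient_module_simps A_RCOSETS_def')
  show "a \<odot>\<^bsub>quotient_module M N\<^esub> (A \<oplus>\<^bsub>quotient_module M N\<^esub> B) =
      a \<odot>\<^bsub>quotient_module M N\<^esub> A \<oplus>\<^bsub>quotient_module M N\<^esub> a \<odot>\<^bsub>quotient_module M N\<^esub> B"
    using M.smult_r_distr[of a x y] x y
    by (simp add: quotient_module_simps quotient_smult_coset N.a_rcos_sum)
next
  fix a b A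
  assume "A \<in> carrier (quotient_module M N)"
  then obtain x where x: "x \<in> carrier M" "A = N +>\<^bsub>M\<^esub> x"
    by (auto simp: quotient_module_simps A_RCOSETS_def')
  show "a \<odot>\<^bsub>quotient_module M N\<^esub> A \<in> carrier (quotient_module M N)"
    using x M.smult_closed[of a x]
    by (auto simp: quotient_module_simps A_RCOSETS_def' quotient_smult_coset)
  show "(a \<oplus>\<^bsub>base_ring\<^esub> b) \<odot>\<^bsub>quotient_module M N\<^esub> A =
      a \<odot>\<^bsub>quotient_module M N\<^esub> A \<oplus>\<^bsub>quotient_module M N\<^esub> b \<odot>\<^bsub>quotient_module M N\<^esub> A"
    using M.smult_l_distr[of a b x] x
    by (simp add: quotient_module_simps quotient_smult_coset N.a_rcos_sum)
  show "(a \<otimes>\<^bsub>base_ring\<^esub> b) \<odot>\<^bsub>quotient_module M N\<^esub> A =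
      a \<odot>\<^bsub>quotient_module M N\<^esub> (b \<odot>\<^bsub>quotient_module M N\<^esub> A)"
    using M.smult_assoc1[of a b x] x by (simp add: quotient_smult_coset)
  show "\<one>\<^bsub>base_ring\<^esub> \<odot>\<^bsub>quotient_module M N\<^esub> A = A"
    using M.smult_one[of x] x by (simp add: quotient_smult_coset)
qed (rule base_ring_cring)

lemma quotient_map_linear: "linear_map M (quotient_module M N) (\<lambda>x. N +>\<^bsub>M\<^esub> x)"
proof (rule linear_mapI)
  show "N +>\<^bsub>M\<^esub> x \<in> carrier (quotient_module M N)" if "x \<in> carrier M" for x
    using that by (auto simp: quotient_module_simps A_RCOSETS_def')
  show "N +>\<^bsub>M\<^esub> (x \<oplus>\<^bsub>M\<^esub> y) = (N +>\<^bsub>M\<^esub> x) \<oplus>\<^bsub>quotient_module M N\<^esub> (N +>\<^bsub>M\<^esub> y)"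
    if "x \<in> carrier M" "y \<in> carrier M" for x y
    using that by (simp add: quotient_module_simps N.a_rcos_sum)
  show "N +>\<^bsub>M\<^esub> (c \<odot>\<^bsub>M\<^esub> x) = c \<odot>\<^bsub>quotient_module M N\<^esub> (N +>\<^bsub>M\<^esub> x)"
    if "x \<in> carrier M" for c x
    by (rule quotient_smult_coset[OF that, symmetric])
qed

lemma mem_coset_iff:
  assumes x: "x \<in> carrier M"
  shows "y \<in> N +>\<^bsub>M\<^esub> x \<longleftrightarrow> y \<in> carrier M \<and> y \<ominus>\<^bsub>M\<^esub> x \<in> N"
proof (cases "y \<in> carrier M")
  case True
  then show ?thesis using N.a_rcos_module[OF x True] by (simp add: a_minus_def)
next
  case False
  then show ?thesis using M.a_r_coset_subset_G[OF N.a_subset x] by auto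
qed

end


section \<open>Free modules and tensor products\<close>

lemma free_module_simps [simp]:
  "carrier (free_module S) = {f. Poly_Mapping.keys f \<subseteq> S}"
  "zero (free_module S) = 0" "add (free_module S) = (+)"
  "smult (free_module S) c = Poly_Mapping.map ((*) c)"
  by (simp_all add: free_module_def)

lemma lookup_scale [simp]:
  "Poly_Mapping.lookup (Poly_Mapping.map ((*) (c::'k::field)) f) s = c * Poly_Mapping.lookup f s"
  by (simp add: Poly_Mapping.map.rep_eq when_def)

lemma keys_scale: "Poly_Mapping.keys (Poly_Mapping.map ((*) (c::'k::field)) f) \<subseteq> Poly_Mapping.keys f"
  by (auto simp: in_keys_iff)

lemma free_module_module: "module base_ring (free_module S :: ('k::field, 's \<Rightarrow>\<^sub>0 'k) module)"
proof (rule moduleI)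
  have keys_plus: "Poly_Mapping.keys (f + g) \<subseteq> S"
    if "Poly_Mapping.keys f \<subseteq> S" "Poly_Mapping.keys g \<subseteq> S" for f g :: "'s \<Rightarrow>\<^sub>0 'k"
    using keys_add[of f g] that by blast
  show "abelian_group (free_module S :: ('k, 's \<Rightarrow>\<^sub>0 'k) module)"
  proof (rule abelian_groupI)
    fix f :: "'s \<Rightarrow>\<^sub>0 'k" assume "f \<in> carrier (free_module S)"
    then show "\<exists>g\<in>carrier (free_module S). g \<oplus>\<^bsub>free_module S\<^esub> f = \<zero>\<^bsub>free_module S\<^esub>"
      by (intro bexI[of _ "- f"]) simp_all
  qed (simp_all add: keys_plus ac_simps)
  show "c \<odot>\<^bsub>free_module S\<^esub> f \<in> carrier (free_module S)"
    if "f \<in> carrier (free_module S)" for c :: 'k and f :: "'s \<Rightarrow>\<^sub>0 'k"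
    using that keys_scale[of c f] by (simp add: subset_trans)
qed (simp_all add: base_ring_cring poly_mapping_eq_iff fun_eq_iff lookup_add algebra_simps)

lemma free_module_minus:
  assumes "Poly_Mapping.keys f \<subseteq> S" "Poly_Mapping.keys g \<subseteq> S"
  shows "f \<ominus>\<^bsub>free_module S\<^esub> g = f - (g :: 's \<Rightarrow>\<^sub>0 'k::field)"
proof -
  interpret F: module base_ring "free_module S :: ('k, 's \<Rightarrow>\<^sub>0 'k) module" by (rule free_module_module)
  have "\<ominus>\<^bsub>free_module S\<^esub> g = - g"
    by (rule F.minus_equality) (use assms in auto)
  then show ?thesis by (simp add: a_minus_def)
qed

lemma sum_monomials:
  "(\<Sum>m\<in>Poly_Mapping.keys F. Poly_Mapping.single m (Poly_Mapping.lookup F m)) =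
    (F :: 'v \<Rightarrow>\<^sub>0 'k::comm_monoid_add)"
  by (rule poly_mapping_eqI) (simp add: lookup_sum lookup_single when_def in_keys_iff sum.delta)

lemma free_module_induct [consumes 1, case_names zero single add]:
  fixes f :: "'s \<Rightarrow>\<^sub>0 'k::field"
  assumes "Poly_Mapping.keys f \<subseteq> S"
    and zero: "P 0"
    and single: "\<And>s c. s \<in> S \<Longrightarrow> P (Poly_Mapping.single s c)"
    and add: "\<And>f g. Poly_Mapping.keys f \<subseteq> S \<Longrightarrow> Poly_Mapping.keys g \<subseteq> S \<Longrightarrow> P f \<Longrightarrow> P g \<Longrightarrow> P (f + g)"
  shows "P f"
proof -
  let ?m = "\<lambda>s. Poly_Mapping.single s (Poly_Mapping.lookup f s)"
  have "P (sum ?m T) \<and> Poly_Mapping.keys (sum ?m T) \<subseteq> S" if "finite T" "T \<subseteq> S" for T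
    using that
  proof (induction T)
    case (insert s T)
    then have "P (sum ?m T)" "Poly_Mapping.keys (sum ?m T) \<subseteq> S" and s: "s \<in> S" by simp_all
    moreover have "Poly_Mapping.keys (?m s) \<subseteq> S" using s by simp
    ultimately have "P (?m s + sum ?m T)" "Poly_Mapping.keys (?m s + sum ?m T) \<subseteq> S"
      using add[of "?m s" "sum ?m T"] single[OF s] keys_add[of "?m s" "sum ?m T"] by blast+
    then show ?case using insert.hyps by simp
  qed (simp add: zero)
  moreover have "sum ?m (Poly_Mapping.keys f) = f" by (rule sum_monomials)
  ultimately show ?thesis using assms(1) by (metis finite_keys)
qed

text \<open>
  The linear extension of \<open>h\<close> from the basis of a free module. The map \<open>lin_lift P h\<close> is its value
  at a chosen representative of a coset.
\<close>

definition lin_ext ::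
    "('k::field, 'b, 'm) module_scheme \<Rightarrow> ('s \<Rightarrow> 'b) \<Rightarrow> ('s \<Rightarrow>\<^sub>0 'k) \<Rightarrow> 'b" where
  "lin_ext P h f = (\<Oplus>\<^bsub>P\<^esub>s\<in>Poly_Mapping.keys f. Poly_Mapping.lookup f s \<odot>\<^bsub>P\<^esub> h s)"

lemma lin_lift_eq: "lin_lift P h u = lin_ext P h (SOME f. f \<in> u)"
  by (simp add: lin_lift_def lin_ext_def Let_def)

context
  fixes P :: "('k::field, 'b, 'm) module_scheme" and h :: "'s \<Rightarrow> 'b" and S :: "'s set"
  assumes P: "module base_ring P" and h: "h \<in> S \<rightarrow> carrier P"
begin

interpretation P: module base_ring P by (rule P)
private lemmas smult_P = base_ring_smult[OF P]

text \<open>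
  Enlarging the index set allows the sums for two vectors to be compared over the same set.
\<close>

lemma lin_ext_superset:
  assumes "finite T" "Poly_Mapping.keys f \<subseteq> T" "T \<subseteq> S"
  shows "lin_ext P h f = (\<Oplus>\<^bsub>P\<^esub>s\<in>T. Poly_Mapping.lookup f s \<odot>\<^bsub>P\<^esub> h s)"
  unfolding lin_ext_def
proof (rule P.add.finprod_mono_neutral_cong_left)
  show "Poly_Mapping.lookup f s \<odot>\<^bsub>P\<^esub> h s = \<zero>\<^bsub>P\<^esub>" if "s \<in> T - Poly_Mapping.keys f" for s
    using that assms h smult_P(6)[of "h s"] by (auto simp: in_keys_iff)
  show "(\<lambda>s. Poly_Mapping.lookup f s \<odot>\<^bsub>P\<^esub> h s) \<in> T \<rightarrow> carrier P"
    using assms h smult_P(1) by blast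
qed (use assms in simp_all)

lemma lin_ext_linear: "linear_map (free_module S) P (lin_ext P h)"
proof (rule linear_mapI)
  fix f g assume f: "f \<in> carrier (free_module S :: ('k, 's \<Rightarrow>\<^sub>0 'k) module)" and g: "g \<in> carrier (free_module S :: ('k, 's \<Rightarrow>\<^sub>0 'k) module)"
  let ?T = "Poly_Mapping.keys f \<union> Poly_Mapping.keys g"
  have T: "finite ?T" "?T \<subseteq> S" using f g by auto
  have h': "h s \<in> carrier P" if "s \<in> ?T" for s using T h that by auto
  show "lin_ext P h f \<in> carrier P"
    unfolding lin_ext_def by (rule P.finsum_closed) (use h' smult_P in auto)
  have "lin_ext P h (f \<oplus>\<^bsub>free_module S\<^esub> g) =
      (\<Oplus>\<^bsub>P\<^esub>s\<in>?T. (Poly_Mapping.lookup f s + Poly_Mapping.lookup g s) \<odot>\<^bsub>P\<^esub> h s)"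
    using lin_ext_superset[OF T(1) _ T(2), of "f + g"] keys_add[of f g] by (simp add: lookup_add)
  also have "\<dots> = (\<Oplus>\<^bsub>P\<^esub>s\<in>?T. Poly_Mapping.lookup f s \<odot>\<^bsub>P\<^esub> h s \<oplus>\<^bsub>P\<^esub> Poly_Mapping.lookup g s \<odot>\<^bsub>P\<^esub> h s)"
    by (rule P.finsum_cong') (use h' smult_P in auto)
  also have "\<dots> = lin_ext P h f \<oplus>\<^bsub>P\<^esub> lin_ext P h g"
    using lin_ext_superset[OF T(1) _ T(2), of f] lin_ext_superset[OF T(1) _ T(2), of g]
    by (subst P.finsum_addf) (use h' smult_P in auto)
  finally show "lin_ext P h (f \<oplus>\<^bsub>free_module S\<^esub> g) = lin_ext P h f \<oplus>\<^bsub>P\<^esub> lin_ext P h g" .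
next
  fix c f assume f: "f \<in> carrier (free_module S :: ('k, 's \<Rightarrow>\<^sub>0 'k) module)"
  let ?T = "Poly_Mapping.keys f"
  have T: "finite ?T" "?T \<subseteq> S" using f by auto
  have h': "h s \<in> carrier P" if "s \<in> ?T" for s using T h that by auto
  have "lin_ext P h (c \<odot>\<^bsub>free_module S\<^esub> f) = (\<Oplus>\<^bsub>P\<^esub>s\<in>?T. (c * Poly_Mapping.lookup f s) \<odot>\<^bsub>P\<^esub> h s)"
    using lin_ext_superset[OF T(1) _ T(2), of "Poly_Mapping.map ((*) c) f"] keys_scale[of c f] by simp
  also have "\<dots> = (\<Oplus>\<^bsub>P\<^esub>s\<in>?T. c \<odot>\<^bsub>P\<^esub> (Poly_Mapping.lookup f s \<odot>\<^bsub>P\<^esub> h s))"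
    by (rule P.finsum_cong') (use h' smult_P in auto)
  also have "\<dots> = c \<odot>\<^bsub>P\<^esub> lin_ext P h f"
    unfolding lin_ext_def by (rule P.finsum_smult_ldistr[symmetric]) (use h' smult_P in auto)
  finally show "lin_ext P h (c \<odot>\<^bsub>free_module S\<^esub> f) = c \<odot>\<^bsub>P\<^esub> lin_ext P h f" .
qed

lemma lin_ext_single: "s \<in> S \<Longrightarrow> lin_ext P h (Poly_Mapping.single s c) = c \<odot>\<^bsub>P\<^esub> h s"
  using lin_ext_superset[of "{s}" "Poly_Mapping.single s c"] h by (auto simp: Pi_def)

end

text \<open>
  Two representatives of a coset differ by an element of \<open>N\<close>, which \<open>\<phi>\<close> annihilates; so the value
  of \<open>\<phi>\<close> at a chosen representative does not depend on the choice.
\<close>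

lemma quotient_lift:
  assumes M: "module base_ring M" and N: "submodule N base_ring M"
    and P: "module base_ring P" and \<phi>: "linear_map M P \<phi>"
    and van: "\<And>f. f \<in> N \<Longrightarrow> \<phi> f = \<zero>\<^bsub>P\<^esub>"
    and \<psi>: "\<And>u. \<psi> u = \<phi> (SOME f. f \<in> u)"
  shows quotient_lift_coset: "f \<in> carrier M \<Longrightarrow> \<psi> (N +>\<^bsub>M\<^esub> f) = \<phi> f"
    and quotient_lift_linear: "linear_map (quotient_module M N) P \<psi>"
proof -
  interpret M: module base_ring M by (rule M)
  interpret P: module base_ring P by (rule P)
  interpret N: abelian_subgroup N M by (rule submodule_abelian_subgroup[OF M N])
  note L = linear_mapD[OF \<phi>]
  have eq: "\<psi> (N +>\<^bsub>M\<^esub> f) = \<phi> f" if f: "f \<in> carrier M" for f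
  proof -
    define g where "g = (SOME g. g \<in> N +>\<^bsub>M\<^esub> f)"
    have "g \<in> N +>\<^bsub>M\<^esub> f" unfolding g_def by (rule someI) (rule N.a_rcos_self[OF f])
    then have g: "g \<in> carrier M" "g \<ominus>\<^bsub>M\<^esub> f \<in> N"
      using mem_coset_iff[OF M N f] by auto
    have "\<phi> g \<ominus>\<^bsub>P\<^esub> \<phi> f = \<zero>\<^bsub>P\<^esub>"
      using van[OF g(2)] linear_map_minus[OF \<phi> M P g(1) f] by simp
    then have "\<phi> g = \<phi> f"
      using P.minus_equality[of "\<phi> g" "\<ominus>\<^bsub>P\<^esub> \<phi> f"] P.minus_minus L(1)[OF f] L(1)[OF g(1)]
      by (simp add: a_minus_def)
    then show ?thesis by (simp add: \<psi> g_def)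
  qed
  then show "f \<in> carrier M \<Longrightarrow> \<psi> (N +>\<^bsub>M\<^esub> f) = \<phi> f" by simp
  have coset: "\<exists>x\<in>carrier M. A = N +>\<^bsub>M\<^esub> x" if "A \<in> carrier (quotient_module M N)" for A
    using that by (auto simp: quotient_module_simps A_RCOSETS_def')
  show "linear_map (quotient_module M N) P \<psi>"
  proof (rule linear_mapI)
    fix c A B assume A: "A \<in> carrier (quotient_module M N)"
    obtain x where x: "x \<in> carrier M" "A = N +>\<^bsub>M\<^esub> x" using coset[OF A] by blast
    show "\<psi> A \<in> carrier P" using eq x L(1) by simp
    show "\<psi> (c \<odot>\<^bsub>quotient_module M N\<^esub> A) = c \<odot>\<^bsub>P\<^esub> \<psi> A"
      using eq x L(3) vs_closed[OF M] by (simp add: quotient_smult_coset[OF M N])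
    assume B: "B \<in> carrier (quotient_module M N)"
    obtain y where y: "y \<in> carrier M" "B = N +>\<^bsub>M\<^esub> y" using coset[OF B] by blast
    show "\<psi> (A \<oplus>\<^bsub>quotient_module M N\<^esub> B) = \<psi> A \<oplus>\<^bsub>P\<^esub> \<psi> B"
      using eq x y L(2) by (simp add: quotient_module_simps N.a_rcos_sum)
  qed
qed

context
  fixes M :: "('k::field, 'a, 'm) module_scheme" and N :: "('k, 'b, 'n) module_scheme"
  assumes M: "module base_ring M" and N: "module base_ring N"
begin

interpretation M: module base_ring M by (rule M)
interpretation N: module base_ring N by (rule N)
private abbreviation (input) "F \<equiv> free_module (carrier M \<times> carrier N) :: ('k, 'a \<times> 'b \<Rightarrow>\<^sub>0 'k) module"
interpretation F: module base_ring F by (rule free_module_module)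

lemma tensor_relations_carrier: "tensor_relations M N \<subseteq> carrier F"
proof -
  have minus: "f - g \<in> carrier F" if "f \<in> carrier F" "g \<in> carrier F" for f g
    using F.minus_closed[OF that] free_module_minus[of f _ g] that by simp
  have single: "Poly_Mapping.single (a, b) c \<in> carrier F" if "a \<in> carrier M" "b \<in> carrier N" for a b c
    using that by simp
  show ?thesis unfolding tensor_relations_def
    using M.a_closed N.a_closed vs_closed[OF M] vs_closed[OF N]
    by (auto simp del: free_module_simps intro!: minus single)
qed

lemma tensor_kernel_submodule: "submodule (tensor_kernel M N) base_ring F"
  unfolding tensor_kernel_def
  by (rule submodule_generated_submodule[OF F.module_axioms tensor_relations_carrier])

lemma tensor_module: "module base_ring (tensor M N)"
  unfolding tensor_def by (rule quotient_module_module[OF F.module_axioms tensor_kernel_submodule])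

private lemmas Q = linear_mapD[OF quotient_map_linear[OF F.module_axioms tensor_kernel_submodule],
    folded tensor_def]

lemma pure_closed: "a \<in> carrier M \<Longrightarrow> b \<in> carrier N \<Longrightarrow> pure M N a b \<in> carrier (tensor M N)"
  unfolding pure_def by (rule Q(1)) simp

text \<open>
  The relations are stated as differences; this turns them into equations between cosets.
\<close>

lemma pure_relation:
  assumes "f \<in> carrier F" "g \<in> carrier F" "f - g \<in> tensor_relations M N"
  shows "tensor_kernel M N +>\<^bsub>F\<^esub> f = tensor_kernel M N +>\<^bsub>F\<^esub> g"
proof -
  have "f \<ominus>\<^bsub>F\<^esub> g \<in> tensor_kernel M N"
    using assms submodule_generated_incl[of "tensor_relations M N" F] free_module_minus[of f _ g]
    by (auto simp: tensor_kernel_def)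
  then show ?thesis
    using coset_eq_iff[OF F.module_axioms tensor_kernel_submodule assms(1,2)] by simp
qed

lemma pure_smult:
  assumes "a \<in> carrier M" "b \<in> carrier N"
  shows "pure M N (c \<odot>\<^bsub>M\<^esub> a) b = c \<odot>\<^bsub>tensor M N\<^esub> pure M N a b"
    and "pure M N a (c \<odot>\<^bsub>N\<^esub> b) = c \<odot>\<^bsub>tensor M N\<^esub> pure M N a b"
proof -
  have ab: "Poly_Mapping.single (a, b) d \<in> carrier F" for d using assms by simp
  have r: "c \<odot>\<^bsub>tensor M N\<^esub> pure M N a b = tensor_kernel M N +>\<^bsub>F\<^esub> Poly_Mapping.single (a, b) c"
    unfolding pure_def using Q(3)[OF ab, of c 1] by simp
  have "Poly_Mapping.single (c \<odot>\<^bsub>M\<^esub> a, b) 1 - Poly_Mapping.single (a, b) c \<in> tensor_relations M N"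
    "Poly_Mapping.single (a, c \<odot>\<^bsub>N\<^esub> b) 1 - Poly_Mapping.single (a, b) c \<in> tensor_relations M N"
    using assms unfolding tensor_relations_def by blast+
  then show "pure M N (c \<odot>\<^bsub>M\<^esub> a) b = c \<odot>\<^bsub>tensor M N\<^esub> pure M N a b"
    and "pure M N a (c \<odot>\<^bsub>N\<^esub> b) = c \<odot>\<^bsub>tensor M N\<^esub> pure M N a b"
    unfolding r unfolding pure_def
    using assms vs_closed[OF M] vs_closed[OF N] by (simp_all add: pure_relation)
qed

lemma pure_add:
  assumes "a \<in> carrier M" "b \<in> carrier N"
  shows "a' \<in> carrier M \<Longrightarrow> pure M N (a \<oplus>\<^bsub>M\<^esub> a') b = pure M N a b \<oplus>\<^bsub>tensor M N\<^esub> pure M N a' b"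
    and "b' \<in> carrier N \<Longrightarrow> pure M N a (b \<oplus>\<^bsub>N\<^esub> b') = pure M N a b \<oplus>\<^bsub>tensor M N\<^esub> pure M N a b'"
proof -
  have sum: "pure M N a b \<oplus>\<^bsub>tensor M N\<^esub> pure M N x y =
      tensor_kernel M N +>\<^bsub>F\<^esub> (Poly_Mapping.single (a, b) 1 + Poly_Mapping.single (x, y) 1)"
    and sumF: "Poly_Mapping.single (a, b) 1 + Poly_Mapping.single (x, y) 1 \<in> carrier F"
    if "x \<in> carrier M" "y \<in> carrier N" for x y
    unfolding pure_def
    using assms that Q(2)[of "Poly_Mapping.single (a, b) 1" "Poly_Mapping.single (x, y) 1"]
      F.a_closed[of "Poly_Mapping.single (a, b) 1" "Poly_Mapping.single (x, y) 1"] by simp_all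
  {
    assume a': "a' \<in> carrier M"
    have "Poly_Mapping.single (a \<oplus>\<^bsub>M\<^esub> a', b) 1
        - (Poly_Mapping.single (a, b) 1 + Poly_Mapping.single (a', b) 1) \<in> tensor_relations M N"
      using assms a' unfolding tensor_relations_def diff_diff_eq[symmetric] by blast
    then show "pure M N (a \<oplus>\<^bsub>M\<^esub> a') b = pure M N a b \<oplus>\<^bsub>tensor M N\<^esub> pure M N a' b"
      unfolding sum[OF a' assms(2)] unfolding pure_def
      by (intro pure_relation sumF[OF a' assms(2)]) (use assms a' in simp)
  }
  {
    assume b': "b' \<in> carrier N"
    have "Poly_Mapping.single (a, b \<oplus>\<^bsub>N\<^esub> b') 1
        - (Poly_Mapping.single (a, b) 1 + Poly_Mapping.single (a, b') 1) \<in> tensor_relations M N"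
      using assms b' unfolding tensor_relations_def diff_diff_eq[symmetric] by blast
    then show "pure M N a (b \<oplus>\<^bsub>N\<^esub> b') = pure M N a b \<oplus>\<^bsub>tensor M N\<^esub> pure M N a b'"
      unfolding sum[OF assms(1) b'] unfolding pure_def
      by (intro pure_relation sumF[OF assms(1) b']) (use assms b' in simp)
  }
qed

text \<open>
  A scalar can be absorbed into the first factor of a pure tensor. Hence every tensor is a sum of
  pure tensors, the zero tensor included, and induction over sums reaches all of them.
\<close>

lemma tensor_induct:
  assumes u: "u \<in> carrier (tensor M N)"
    and Rpure: "\<And>a b. a \<in> carrier M \<Longrightarrow> b \<in> carrier N \<Longrightarrow> R (pure M N a b)"
    and Radd: "\<And>u v. u \<in> carrier (tensor M N) \<Longrightarrow> v \<in> carrier (tensor M N) \<Longrightarrow> R u \<Longrightarrow> R v \<Longrightarrow>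
      R (u \<oplus>\<^bsub>tensor M N\<^esub> v)"
  shows "R u"
proof -
  obtain f where f: "f \<in> carrier F" "u = tensor_kernel M N +>\<^bsub>F\<^esub> f"
    using u by (auto simp: tensor_def quotient_module_simps A_RCOSETS_def')
  have Rsingle: "R (tensor_kernel M N +>\<^bsub>F\<^esub> Poly_Mapping.single s c)"
    if "s \<in> carrier M \<times> carrier N" for s c
  proof -
    obtain a b where s: "s = (a, b)" "a \<in> carrier M" "b \<in> carrier N" using \<open>s \<in> _\<close> by blast
    have "tensor_kernel M N +>\<^bsub>F\<^esub> Poly_Mapping.single s c = pure M N (c \<odot>\<^bsub>M\<^esub> a) b"
      unfolding pure_smult(1)[OF s(2,3)] unfolding pure_def
      using Q(3)[of "Poly_Mapping.single (a, b) 1" c] s by simp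
    then show ?thesis using Rpure s vs_closed[OF M] by simp
  qed
  have "Poly_Mapping.keys f \<subseteq> carrier M \<times> carrier N" using f(1) by simp
  then have "R (tensor_kernel M N +>\<^bsub>F\<^esub> f)"
  proof (induction rule: free_module_induct)
    case zero
    show ?case using Rsingle[of "(\<zero>\<^bsub>M\<^esub>, \<zero>\<^bsub>N\<^esub>)" 0] by simp
  next
    case (single s c)
    then show ?case by (rule Rsingle)
  next
    case (add f g)
    then have "f \<in> carrier F" "g \<in> carrier F" by simp_all
    then show ?case
      using Q(2)[of f g] Q(1)[of f] Q(1)[of g] Radd[OF _ _ add.IH] by simp
  qed
  then show ?thesis using f by simp
qed

text \<open>
  The universal property of the tensor product: the linear extension of a bilinear map annihilates
  each of the four families of relations, hence the submodule that they generate.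
\<close>

lemma tensor_lift:
  assumes P: "module base_ring P"
    and h: "\<And>a b. a \<in> carrier M \<Longrightarrow> b \<in> carrier N \<Longrightarrow> h (a, b) \<in> carrier P"
    and h1: "\<And>b. b \<in> carrier N \<Longrightarrow> linear_map M P (\<lambda>a. h (a, b))"
    and h2: "\<And>a. a \<in> carrier M \<Longrightarrow> linear_map N P (\<lambda>b. h (a, b))"
  shows lin_lift_linear: "linear_map (tensor M N) P (lin_lift P h)"
    and lin_lift_pure: "a \<in> carrier M \<Longrightarrow> b \<in> carrier N \<Longrightarrow> lin_lift P h (pure M N a b) = h (a, b)"
proof -
  interpret P: module base_ring P by (rule P)
  let ?l = "lin_ext P h"
  have h': "h \<in> carrier M \<times> carrier N \<rightarrow> carrier P" using h by auto
  note L = lin_ext_linear[OF P h']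
  note LD = linear_mapD[OF L] and LM = linear_map_minus[OF L F.module_axioms P]
  have single: "?l (Poly_Mapping.single (a, b) c) = c \<odot>\<^bsub>P\<^esub> h (a, b)"
    if "a \<in> carrier M" "b \<in> carrier N" for a b c
    using lin_ext_single[OF P h'] that by simp
  have diff0: "?l (f - g) = \<zero>\<^bsub>P\<^esub>" if "f \<in> carrier F" "g \<in> carrier F" "?l f = ?l g" for f g
    using LM[OF that(1,2)] that LD(1)[of g] free_module_minus[of f _ g] by (simp add: P.r_neg a_minus_def)
  have plus: "?l (f + g) = ?l f \<oplus>\<^bsub>P\<^esub> ?l g" "f + g \<in> carrier F"
    if "f \<in> carrier F" "g \<in> carrier F" for f g
    using LD(2)[OF that] F.a_closed[OF that] by simp_all
  have S: "Poly_Mapping.single (a, b) c \<in> carrier F" if "a \<in> carrier M" "b \<in> carrier N" for a b c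
    using that by simp
  have "?l r = \<zero>\<^bsub>P\<^esub>" if "r \<in> tensor_relations M N" for r
    using that unfolding tensor_relations_def diff_diff_eq
    using M.a_closed N.a_closed vs_closed[OF M] vs_closed[OF N]
      linear_mapD(2,3)[OF h1] linear_mapD(2,3)[OF h2] h
    by (elim UnE CollectE exE conjE; hypsubst)
      (rule diff0; simp add: S plus single vs_one[OF P] del: free_module_simps)+
  then have "tensor_relations M N \<subseteq> {f \<in> carrier F. ?l f = \<zero>\<^bsub>P\<^esub>}"
    using tensor_relations_carrier by blast
  then have "tensor_kernel M N \<subseteq> {f \<in> carrier F. ?l f = \<zero>\<^bsub>P\<^esub>}"
    unfolding tensor_kernel_def
    by (rule submodule_generated_minimal[OF linear_map_kernel_submodule[OF L F.module_axioms P]])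
  then have van: "?l f = \<zero>\<^bsub>P\<^esub>" if "f \<in> tensor_kernel M N" for f using that by blast
  have coset: "lin_lift P h (tensor_kernel M N +>\<^bsub>F\<^esub> f) = ?l f" if "f \<in> carrier F" for f
    by (rule quotient_lift_coset[OF F.module_axioms tensor_kernel_submodule P L _ lin_lift_eq that])
      (rule van)
  show "linear_map (tensor M N) P (lin_lift P h)" unfolding tensor_def
    by (rule quotient_lift_linear[OF F.module_axioms tensor_kernel_submodule P L _ lin_lift_eq])
      (rule van)
  show "a \<in> carrier M \<Longrightarrow> b \<in> carrier N \<Longrightarrow> lin_lift P h (pure M N a b) = h (a, b)"
    unfolding pure_def using coset[OF S] single h vs_one[OF P] by simp
qed

end


section \<open>Identities in commutative algebras\<close>

context
  fixes R :: "('k::field, 'a, 'm) module_scheme"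
  assumes R: "algebra base_ring R"
begin

interpretation R: algebra base_ring R by (rule R)
private lemmas smult_R = base_ring_smult[OF R.module]

lemma alg_smult_left: "x \<in> carrier R \<Longrightarrow> y \<in> carrier R \<Longrightarrow> (c \<odot>\<^bsub>R\<^esub> x) \<otimes>\<^bsub>R\<^esub> y = c \<odot>\<^bsub>R\<^esub> (x \<otimes>\<^bsub>R\<^esub> y)"
  using R.smult_assoc2[of c x y] by simp

lemma alg_smult_right: "x \<in> carrier R \<Longrightarrow> y \<in> carrier R \<Longrightarrow> x \<otimes>\<^bsub>R\<^esub> (c \<odot>\<^bsub>R\<^esub> y) = c \<odot>\<^bsub>R\<^esub> (x \<otimes>\<^bsub>R\<^esub> y)"
  using alg_smult_left[of y x c] R.m_comm[of x y] R.m_comm[of x "c \<odot>\<^bsub>R\<^esub> y"] smult_R(1)[of y c] by simp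

lemma mult_linear: "x \<in> carrier R \<Longrightarrow> linear_map R R (\<lambda>y. x \<otimes>\<^bsub>R\<^esub> y)"
  by (rule linear_mapI) (simp_all add: R.r_distr alg_smult_right)

text \<open>
  By induction on \<open>k\<close>: multiplication by \<open>1 - w\<close> subtracts from the coefficients their shift by one,
  which is Pascal's rule with signs.
\<close>

lemma binomial_one_minus:
  assumes w: "w \<in> carrier R"
  shows "(\<one>\<^bsub>R\<^esub> \<ominus>\<^bsub>R\<^esub> w) [^]\<^bsub>R\<^esub> k =
    (\<Oplus>\<^bsub>R\<^esub>s\<in>{..k}. ((-1) ^ s * of_nat (k choose s)) \<odot>\<^bsub>R\<^esub> (w [^]\<^bsub>R\<^esub> s))"
proof (induction k)
  case 0
  show ?case using smult_R(5)[of "\<one>\<^bsub>R\<^esub>"] by simp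
next
  case (Suc k)
  let ?c = "\<lambda>k s. (-1) ^ s * of_nat (k choose s) :: 'k"
  let ?t = "\<lambda>k s. ?c k s \<odot>\<^bsub>R\<^esub> (w [^]\<^bsub>R\<^esub> s)"
  have t: "?t l s \<in> carrier R" for l s using w smult_R(1) by simp
  have t': "(\<lambda>s. ?t l s) \<in> A \<rightarrow> carrier R" "(\<lambda>s. ?t l (Suc s)) \<in> A \<rightarrow> carrier R"
    "(\<lambda>s. ?t l s \<otimes>\<^bsub>R\<^esub> w) \<in> A \<rightarrow> carrier R" for l A
    using t w R.m_closed by blast+
  let ?S = "\<Oplus>\<^bsub>R\<^esub>s\<in>{..k}. ?t k s" and ?S1 = "\<Oplus>\<^bsub>R\<^esub>s\<in>{..k}. ?t k (Suc s)"
  have Sc: "?S \<in> carrier R" "?S1 \<in> carrier R" using t' by (blast intro: R.finsum_closed)+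
  have split: "?S = ?S1 \<oplus>\<^bsub>R\<^esub> ?t k 0"
  proof -
    have "?S = (\<Oplus>\<^bsub>R\<^esub>s\<in>{..Suc k}. ?t k s)"
      using R.finsum_Suc[OF t'(1), of k k] Sc w smult_R(6)[of "w [^]\<^bsub>R\<^esub> Suc k"] by (simp add: binomial_eq_0)
    also have "\<dots> = ?S1 \<oplus>\<^bsub>R\<^esub> ?t k 0"
      by (rule R.finsum_Suc2[OF t'(1)])
    finally show ?thesis .
  qed
\<comment> \<open>Pascal's rule, for the coefficients of \<open>w\<^sup>s\<^sup>+\<^sup>1\<close>\<close>
  have shift: "?t (Suc k) (Suc s) = ?t k (Suc s) \<oplus>\<^bsub>R\<^esub> (- 1) \<odot>\<^bsub>R\<^esub> (?t k s \<otimes>\<^bsub>R\<^esub> w)" for s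
  proof -
    have "?t k s \<otimes>\<^bsub>R\<^esub> w = ?c k s \<odot>\<^bsub>R\<^esub> (w [^]\<^bsub>R\<^esub> Suc s)"
      using w by (simp add: alg_smult_left)
    then have "?t k (Suc s) \<oplus>\<^bsub>R\<^esub> (- 1) \<odot>\<^bsub>R\<^esub> (?t k s \<otimes>\<^bsub>R\<^esub> w) =
        (?c k (Suc s) + (- 1) * ?c k s) \<odot>\<^bsub>R\<^esub> (w [^]\<^bsub>R\<^esub> Suc s)"
      using smult_R(2)[of "w [^]\<^bsub>R\<^esub> Suc s" "?c k (Suc s)" "(- 1) * ?c k s"]
        smult_R(4)[of "w [^]\<^bsub>R\<^esub> Suc s" "- 1" "?c k s"] w by simp
    also have "?c k (Suc s) + (- 1) * ?c k s = ?c (Suc k) (Suc s)"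
      by (simp add: algebra_simps)
    finally show ?thesis by simp
  qed
  have "(\<Oplus>\<^bsub>R\<^esub>s\<in>{..Suc k}. ?t (Suc k) s) = (\<Oplus>\<^bsub>R\<^esub>s\<in>{..k}. ?t (Suc k) (Suc s)) \<oplus>\<^bsub>R\<^esub> ?t (Suc k) 0"
    by (rule R.finsum_Suc2[OF t'(1)])
  also have "(\<Oplus>\<^bsub>R\<^esub>s\<in>{..k}. ?t (Suc k) (Suc s)) =
      (\<Oplus>\<^bsub>R\<^esub>s\<in>{..k}. ?t k (Suc s) \<oplus>\<^bsub>R\<^esub> (- 1) \<odot>\<^bsub>R\<^esub> (?t k s \<otimes>\<^bsub>R\<^esub> w))"
    by (simp only: shift)
  also have "\<dots> = ?S1 \<oplus>\<^bsub>R\<^esub> (\<Oplus>\<^bsub>R\<^esub>s\<in>{..k}. (- 1) \<odot>\<^bsub>R\<^esub> (?t k s \<otimes>\<^bsub>R\<^esub> w))"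
    by (rule R.finsum_addf) (use t w smult_R(1) in \<open>auto simp del: R.smult_closed\<close>)
  also have "(\<Oplus>\<^bsub>R\<^esub>s\<in>{..k}. (- 1) \<odot>\<^bsub>R\<^esub> (?t k s \<otimes>\<^bsub>R\<^esub> w)) = (- 1) \<odot>\<^bsub>R\<^esub> (\<Oplus>\<^bsub>R\<^esub>s\<in>{..k}. ?t k s \<otimes>\<^bsub>R\<^esub> w)"
    by (rule R.finsum_smult_ldistr[symmetric]) (use t w in auto)
  also have "(\<Oplus>\<^bsub>R\<^esub>s\<in>{..k}. ?t k s \<otimes>\<^bsub>R\<^esub> w) = ?S \<otimes>\<^bsub>R\<^esub> w"
    by (rule R.finsum_ldistr[symmetric]) (use t w in auto)
  also have "(- 1) \<odot>\<^bsub>R\<^esub> (?S \<otimes>\<^bsub>R\<^esub> w) = \<ominus>\<^bsub>R\<^esub> (?S \<otimes>\<^bsub>R\<^esub> w)"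
    using module_uminus_eq_smult[OF R.module, of "?S \<otimes>\<^bsub>R\<^esub> w"] Sc w by simp
  also have "?S1 \<oplus>\<^bsub>R\<^esub> \<ominus>\<^bsub>R\<^esub> (?S \<otimes>\<^bsub>R\<^esub> w) \<oplus>\<^bsub>R\<^esub> ?t (Suc k) 0 = ?S1 \<oplus>\<^bsub>R\<^esub> ?t k 0 \<oplus>\<^bsub>R\<^esub> \<ominus>\<^bsub>R\<^esub> (?S \<otimes>\<^bsub>R\<^esub> w)"
    using Sc t[of k 0] w by (simp add: R.a_ac)
  also have "\<dots> = ?S \<oplus>\<^bsub>R\<^esub> \<ominus>\<^bsub>R\<^esub> (?S \<otimes>\<^bsub>R\<^esub> w)" by (simp only: split[symmetric])
  also have "\<dots> = ?S \<otimes>\<^bsub>R\<^esub> (\<one>\<^bsub>R\<^esub> \<ominus>\<^bsub>R\<^esub> w)"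
    using Sc w by (simp add: a_minus_def R.r_distr R.r_minus)
  finally show ?case using Suc by simp
qed

text \<open>
  With \<open>z = 1 - u v\<close> one has \<open>v' z = v' - u\<close>. So \<open>u z\<^sup>n = v' z\<^sup>n - v' z\<^sup>n\<^sup>+\<^sup>1\<close>, and the sum telescopes.
\<close>

lemma geometric_sum:
  assumes u: "u \<in> carrier R" and v: "v \<in> carrier R" and v': "v' \<in> carrier R"
    and inv: "v' \<otimes>\<^bsub>R\<^esub> v = \<one>\<^bsub>R\<^esub>"
  shows "(\<Oplus>\<^bsub>R\<^esub>k\<in>{..<n::nat}. u \<otimes>\<^bsub>R\<^esub> (\<one>\<^bsub>R\<^esub> \<ominus>\<^bsub>R\<^esub> u \<otimes>\<^bsub>R\<^esub> v) [^]\<^bsub>R\<^esub> k) =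
    v' \<ominus>\<^bsub>R\<^esub> v' \<otimes>\<^bsub>R\<^esub> (\<one>\<^bsub>R\<^esub> \<ominus>\<^bsub>R\<^esub> u \<otimes>\<^bsub>R\<^esub> v) [^]\<^bsub>R\<^esub> n"
proof (induction n)
  case 0
  show ?case using v' by (simp add: a_minus_def R.r_neg)
next
  case (Suc n)
  define z where "z = \<one>\<^bsub>R\<^esub> \<ominus>\<^bsub>R\<^esub> u \<otimes>\<^bsub>R\<^esub> v"
  have z: "z \<in> carrier R" using u v by (simp add: z_def)
  have "v' \<otimes>\<^bsub>R\<^esub> z = v' \<ominus>\<^bsub>R\<^esub> v' \<otimes>\<^bsub>R\<^esub> (u \<otimes>\<^bsub>R\<^esub> v)"
    using u v v' by (simp add: z_def a_minus_def R.r_distr R.r_minus)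
  also have "v' \<otimes>\<^bsub>R\<^esub> (u \<otimes>\<^bsub>R\<^esub> v) = u \<otimes>\<^bsub>R\<^esub> (v' \<otimes>\<^bsub>R\<^esub> v)"
    using u v v' by (simp add: R.m_ac)
  finally have vz: "v' \<otimes>\<^bsub>R\<^esub> z = v' \<ominus>\<^bsub>R\<^esub> u" using u inv by simp
  have "v' \<otimes>\<^bsub>R\<^esub> z [^]\<^bsub>R\<^esub> Suc n = (v' \<otimes>\<^bsub>R\<^esub> z) \<otimes>\<^bsub>R\<^esub> z [^]\<^bsub>R\<^esub> n"
    using z v' by (simp add: R.m_ac)
  also have "\<dots> = v' \<otimes>\<^bsub>R\<^esub> z [^]\<^bsub>R\<^esub> n \<ominus>\<^bsub>R\<^esub> u \<otimes>\<^bsub>R\<^esub> z [^]\<^bsub>R\<^esub> n"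
    using u v' z by (simp add: vz a_minus_def R.l_distr R.l_minus)
  finally have step: "v' \<otimes>\<^bsub>R\<^esub> z [^]\<^bsub>R\<^esub> Suc n = v' \<otimes>\<^bsub>R\<^esub> z [^]\<^bsub>R\<^esub> n \<ominus>\<^bsub>R\<^esub> u \<otimes>\<^bsub>R\<^esub> z [^]\<^bsub>R\<^esub> n" .
  have "(\<Oplus>\<^bsub>R\<^esub>k\<in>{..<Suc n}. u \<otimes>\<^bsub>R\<^esub> z [^]\<^bsub>R\<^esub> k) = u \<otimes>\<^bsub>R\<^esub> z [^]\<^bsub>R\<^esub> n \<oplus>\<^bsub>R\<^esub> (\<Oplus>\<^bsub>R\<^esub>k\<in>{..<n}. u \<otimes>\<^bsub>R\<^esub> z [^]\<^bsub>R\<^esub> k)"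
    unfolding lessThan_Suc by (rule R.finsum_insert) (use u z in auto)
  also have "\<dots> = u \<otimes>\<^bsub>R\<^esub> z [^]\<^bsub>R\<^esub> n \<oplus>\<^bsub>R\<^esub> (v' \<ominus>\<^bsub>R\<^esub> v' \<otimes>\<^bsub>R\<^esub> z [^]\<^bsub>R\<^esub> n)"
    using Suc.IH by (simp add: z_def)
  also have "\<dots> = v' \<ominus>\<^bsub>R\<^esub> v' \<otimes>\<^bsub>R\<^esub> z [^]\<^bsub>R\<^esub> Suc n"
    unfolding step using u v' z by (simp add: a_minus_def R.minus_add R.a_ac)
  finally show ?case by (simp add: z_def)
qed

end


section \<open>Powers of ideals\<close>

lemma (in ring) ideal_power_ideal: "ideal I R \<Longrightarrow> ideal (ideal_power R I k) R"
  by (induction k) (simp_all add: oneideal ideal_prod_is_ideal)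

lemma (in ring) ideal_power_antimono:
  assumes I: "ideal I R" and "j \<le> k"
  shows "ideal_power R I k \<subseteq> ideal_power R I j"
  using assms(2)
proof (induction k rule: dec_induct)
  case (step k)
  then show ?case using ideal_prod_inter[OF ideal_power_ideal[OF I] I, of k] by auto
qed simp

lemma (in ring) pow_in_ideal_power:
  assumes "ideal I R" "x \<in> I"
  shows "x [^] k \<in> ideal_power R I k"
proof (induction k)
  case (Suc k)
  then show ?case using ideal_prod.prod[of _ "ideal_power R I k" x I R] assms(2) by simp
qed simp


section \<open>Tensor products of commutative algebras\<close>

context
  fixes M :: "('k::field, 'a, 'm) module_scheme" and N :: "('k, 'b, 'n) module_scheme"
  assumes M: "algebra base_ring M" and N: "algebra base_ring N"
begin

interpretation M: algebra base_ring M by (rule M)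
interpretation N: algebra base_ring N by (rule N)
private lemmas MN = M.module N.module
private lemmas tensor_ind = tensor_induct[OF MN, consumes 1, case_names pure add]
private abbreviation (input) "T \<equiv> tensor M N"
private abbreviation (input) "P \<equiv> tensor_algebra_product M N"
private lemmas T = tensor_module[OF MN]
interpretation T: module base_ring T by (rule T)
private lemmas smult_T = base_ring_smult[OF T]
private lemmas smult_M = base_ring_smult[OF M.module]
private lemmas smult_N = base_ring_smult[OF N.module]

lemma tensor_algebra_product_simps:
  "carrier P = carrier T" "zero P = zero T" "add P = add T" "smult P = smult T"
  "one P = pure M N \<one>\<^bsub>M\<^esub> \<one>\<^bsub>N\<^esub>"
  by (simp_all add: tensor_algebra_product_def)

lemma tensor_algebra_product_module: "module base_ring P"
  by (rule module_transfer[OF T]) (simp_all add: tensor_algebra_product_simps)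

text \<open>
  The product of \<open>tensor_algebra_product M N\<close> consists of two nested linear extensions. The inner one,
  \<open>mult_by_pure a b\<close>, is the multiplication by the pure tensor of \<open>a\<close> and \<open>b\<close>.
\<close>

private abbreviation (input) "mult_by_pure a b \<equiv> lin_lift T (\<lambda>(a', b'). pure M N (a \<otimes>\<^bsub>M\<^esub> a') (b \<otimes>\<^bsub>N\<^esub> b'))"

private lemma mult_by_pure:
  assumes "a \<in> carrier M" "b \<in> carrier N"
  shows mult_by_pure_linear: "linear_map T T (mult_by_pure a b)"
    and mult_by_pure_pure: "a' \<in> carrier M \<Longrightarrow> b' \<in> carrier N \<Longrightarrow>
      mult_by_pure a b (pure M N a' b') = pure M N (a \<otimes>\<^bsub>M\<^esub> a') (b \<otimes>\<^bsub>N\<^esub> b')"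
proof -
  let ?h = "\<lambda>(a', b'). pure M N (a \<otimes>\<^bsub>M\<^esub> a') (b \<otimes>\<^bsub>N\<^esub> b')"
  have 1: "?h (a', b') \<in> carrier T" if "a' \<in> carrier M" "b' \<in> carrier N" for a' b'
    using that assms by (simp add: pure_closed[OF MN])
  have 2: "linear_map M T (\<lambda>a'. ?h (a', b'))" if "b' \<in> carrier N" for b'
    using that assms by (intro linear_mapI)
      (simp_all add: pure_closed[OF MN] M.r_distr pure_add[OF MN] alg_smult_right[OF M] pure_smult[OF MN])
  have 3: "linear_map N T (\<lambda>b'. ?h (a', b'))" if "a' \<in> carrier M" for a'
    using that assms by (intro linear_mapI)
      (simp_all add: pure_closed[OF MN] N.r_distr pure_add[OF MN] alg_smult_right[OF N] pure_smult[OF MN])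
  show "linear_map T T (mult_by_pure a b)" by (rule lin_lift_linear[OF MN T 1 2 3])
  show "a' \<in> carrier M \<Longrightarrow> b' \<in> carrier N \<Longrightarrow>
      mult_by_pure a b (pure M N a' b') = pure M N (a \<otimes>\<^bsub>M\<^esub> a') (b \<otimes>\<^bsub>N\<^esub> b')"
    using lin_lift_pure[OF MN T 1 2 3] by simp
qed

text \<open>
  Bilinearity in \<open>(a, b)\<close> is what the outer linear extension requires. It is inherited from the pure
  tensors, by induction on \<open>v\<close>.
\<close>

private lemma mult_by_pure_bilinear:
  assumes v: "v \<in> carrier T"
  shows "b \<in> carrier N \<Longrightarrow> linear_map M T (\<lambda>a. mult_by_pure a b v)"
    and "a \<in> carrier M \<Longrightarrow> linear_map N T (\<lambda>b. mult_by_pure a b v)"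
proof -
  have closed: "mult_by_pure a b v \<in> carrier T" if "a \<in> carrier M" "b \<in> carrier N" for a b
    using linear_mapD(1)[OF mult_by_pure_linear] that v by blast
  show "linear_map M T (\<lambda>a. mult_by_pure a b v)" if b: "b \<in> carrier N"
  proof (rule linear_mapI)
    fix a a' assume a: "a \<in> carrier M" and a': "a' \<in> carrier M"
    show "mult_by_pure (a \<oplus>\<^bsub>M\<^esub> a') b v = mult_by_pure a b v \<oplus>\<^bsub>T\<^esub> mult_by_pure a' b v"
      using v
    proof (induction rule: tensor_ind)
      case (pure x y)
      then show ?case using a a' b by (simp add: mult_by_pure_pure M.l_distr pure_add[OF MN])
    next
      case (add u w)
      have "mult_by_pure a b u \<in> carrier T" "mult_by_pure a b w \<in> carrier T"
        "mult_by_pure a' b u \<in> carrier T" "mult_by_pure a' b w \<in> carrier T"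
        using linear_mapD(1)[OF mult_by_pure_linear] a a' b add by blast+
      then show ?case
        using a a' b add linear_mapD(2)[OF mult_by_pure_linear] by (simp add: T.a_ac)
    qed
  next
    fix c a assume a: "a \<in> carrier M"
    show "mult_by_pure (c \<odot>\<^bsub>M\<^esub> a) b v = c \<odot>\<^bsub>T\<^esub> mult_by_pure a b v"
      using v
    proof (induction rule: tensor_ind)
      case (pure x y)
      then show ?case using a b smult_M(1) by (simp add: mult_by_pure_pure alg_smult_left[OF M] pure_smult[OF MN])
    next
      case (add u w)
      have "mult_by_pure a b u \<in> carrier T" "mult_by_pure a b w \<in> carrier T"
        using linear_mapD(1)[OF mult_by_pure_linear] a b add by blast+
      then show ?case
        using a b add linear_mapD(2)[OF mult_by_pure_linear] smult_M(1) smult_T(3) by simp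
    qed
  qed (use b closed in simp)
  show "linear_map N T (\<lambda>b. mult_by_pure a b v)" if a: "a \<in> carrier M"
  proof (rule linear_mapI)
    fix b b' assume b: "b \<in> carrier N" and b': "b' \<in> carrier N"
    show "mult_by_pure a (b \<oplus>\<^bsub>N\<^esub> b') v = mult_by_pure a b v \<oplus>\<^bsub>T\<^esub> mult_by_pure a b' v"
      using v
    proof (induction rule: tensor_ind)
      case (pure x y)
      then show ?case using a b b' by (simp add: mult_by_pure_pure N.l_distr pure_add[OF MN])
    next
      case (add u w)
      have "mult_by_pure a b u \<in> carrier T" "mult_by_pure a b w \<in> carrier T"
        "mult_by_pure a b' u \<in> carrier T" "mult_by_pure a b' w \<in> carrier T"
        using linear_mapD(1)[OF mult_by_pure_linear] a b b' add by blast+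
      then show ?case
        using a b b' add linear_mapD(2)[OF mult_by_pure_linear] by (simp add: T.a_ac)
    qed
  next
    fix c b assume b: "b \<in> carrier N"
    show "mult_by_pure a (c \<odot>\<^bsub>N\<^esub> b) v = c \<odot>\<^bsub>T\<^esub> mult_by_pure a b v"
      using v
    proof (induction rule: tensor_ind)
      case (pure x y)
      then show ?case using a b smult_N(1) by (simp add: mult_by_pure_pure alg_smult_left[OF N] pure_smult[OF MN])
    next
      case (add u w)
      have "mult_by_pure a b u \<in> carrier T" "mult_by_pure a b w \<in> carrier T"
        using linear_mapD(1)[OF mult_by_pure_linear] a b add by blast+
      then show ?case
        using a b add linear_mapD(2)[OF mult_by_pure_linear] smult_N(1) smult_T(3) by simp
    qed
  qed (use a closed in simp)
qed

private lemma mult_eq: "u \<otimes>\<^bsub>P\<^esub> v = lin_lift T (\<lambda>(a, b). mult_by_pure a b v) u"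
  by (simp add: tensor_algebra_product_def)

private lemma mult_left:
  assumes v: "v \<in> carrier T"
  shows mult_left_linear: "linear_map T T (\<lambda>u. u \<otimes>\<^bsub>P\<^esub> v)"
    and mult_pure_left: "a \<in> carrier M \<Longrightarrow> b \<in> carrier N \<Longrightarrow> pure M N a b \<otimes>\<^bsub>P\<^esub> v = mult_by_pure a b v"
proof -
  let ?h = "\<lambda>(a, b). mult_by_pure a b v"
  have 1: "?h (a, b) \<in> carrier T" if "a \<in> carrier M" "b \<in> carrier N" for a b
    using linear_mapD(1)[OF mult_by_pure_linear] that v by simp
  have 2: "linear_map M T (\<lambda>a. ?h (a, b))" if "b \<in> carrier N" for b
    using mult_by_pure_bilinear(1)[OF v that] by simp
  have 3: "linear_map N T (\<lambda>b. ?h (a, b))" if "a \<in> carrier M" for a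
    using mult_by_pure_bilinear(2)[OF v that] by simp
  show "linear_map T T (\<lambda>u. u \<otimes>\<^bsub>P\<^esub> v)"
    unfolding mult_eq by (rule lin_lift_linear[OF MN T 1 2 3])
  show "a \<in> carrier M \<Longrightarrow> b \<in> carrier N \<Longrightarrow> pure M N a b \<otimes>\<^bsub>P\<^esub> v = mult_by_pure a b v"
    unfolding mult_eq using lin_lift_pure[OF MN T 1 2 3] by simp
qed

lemma mult_pure:
  "a \<in> carrier M \<Longrightarrow> b \<in> carrier N \<Longrightarrow> a' \<in> carrier M \<Longrightarrow> b' \<in> carrier N \<Longrightarrow>
    pure M N a b \<otimes>\<^bsub>P\<^esub> pure M N a' b' = pure M N (a \<otimes>\<^bsub>M\<^esub> a') (b \<otimes>\<^bsub>N\<^esub> b')"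
  by (simp add: mult_pure_left pure_closed[OF MN] mult_by_pure_pure)

private lemma closed: "u \<in> carrier T \<Longrightarrow> v \<in> carrier T \<Longrightarrow> u \<otimes>\<^bsub>P\<^esub> v \<in> carrier T"
  using linear_mapD(1)[OF mult_left_linear] .

private lemma l_distr: "u \<in> carrier T \<Longrightarrow> u' \<in> carrier T \<Longrightarrow> v \<in> carrier T \<Longrightarrow>
    (u \<oplus>\<^bsub>T\<^esub> u') \<otimes>\<^bsub>P\<^esub> v = u \<otimes>\<^bsub>P\<^esub> v \<oplus>\<^bsub>T\<^esub> u' \<otimes>\<^bsub>P\<^esub> v"
  using linear_mapD(2)[OF mult_left_linear] .

private lemma r_distr:
  assumes "u \<in> carrier T" "v \<in> carrier T" "v' \<in> carrier T"
  shows "u \<otimes>\<^bsub>P\<^esub> (v \<oplus>\<^bsub>T\<^esub> v') = u \<otimes>\<^bsub>P\<^esub> v \<oplus>\<^bsub>T\<^esub> u \<otimes>\<^bsub>P\<^esub> v'"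
  using assms(1)
proof (induction rule: tensor_ind)
  case (pure a b)
  then show ?case using assms linear_mapD(2)[OF mult_by_pure_linear] by (simp add: mult_pure_left)
next
  case (add u w)
  have "u \<otimes>\<^bsub>P\<^esub> v \<in> carrier T" "u \<otimes>\<^bsub>P\<^esub> v' \<in> carrier T" "w \<otimes>\<^bsub>P\<^esub> v \<in> carrier T" "w \<otimes>\<^bsub>P\<^esub> v' \<in> carrier T"
    using closed add assms by blast+
  then show ?case using add assms by (simp add: l_distr T.a_ac)
qed

private lemma comm:
  assumes "u \<in> carrier T" "v \<in> carrier T"
  shows "u \<otimes>\<^bsub>P\<^esub> v = v \<otimes>\<^bsub>P\<^esub> u"
  using assms(1)
proof (induction rule: tensor_ind)
  case (pure a b)
  show ?case using assms(2)
  proof (induction rule: tensor_ind)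
    case (pure a' b')
    then show ?case using \<open>a \<in> carrier M\<close> \<open>b \<in> carrier N\<close>
      by (simp add: mult_pure M.m_comm N.m_comm)
  next
    case (add v w)
    then show ?case using \<open>a \<in> carrier M\<close> \<open>b \<in> carrier N\<close> pure_closed[OF MN]
      by (simp add: l_distr r_distr)
  qed
next
  case (add u w)
  then show ?case using assms(2) by (simp add: l_distr r_distr)
qed

private lemma assoc:
  assumes u: "u \<in> carrier T" and v: "v \<in> carrier T" and w: "w \<in> carrier T"
  shows "(u \<otimes>\<^bsub>P\<^esub> v) \<otimes>\<^bsub>P\<^esub> w = u \<otimes>\<^bsub>P\<^esub> (v \<otimes>\<^bsub>P\<^esub> w)"
  using u
proof (induction rule: tensor_ind)
  case u: (pure a b)
  show ?case using v
  proof (induction rule: tensor_ind)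
    case v: (pure a' b')
    show ?case using w
    proof (induction rule: tensor_ind)
      case w: (pure a'' b'')
      then show ?case using u v w by (simp add: mult_pure M.m_assoc N.m_assoc)
    next
      case (add w w')
      then show ?case using u v pure_closed[OF MN] by (simp add: r_distr closed)
    qed
  next
    case (add v v')
    then show ?case using u w pure_closed[OF MN] by (simp add: r_distr l_distr closed)
  qed
next
  case (add u u')
  then show ?case using v w by (simp add: l_distr closed)
qed

private lemma one: "u \<in> carrier T \<Longrightarrow> pure M N \<one>\<^bsub>M\<^esub> \<one>\<^bsub>N\<^esub> \<otimes>\<^bsub>P\<^esub> u = u"
proof (induction rule: tensor_ind)
  case (pure a b)
  then show ?case by (simp add: mult_pure)
next
  case (add u w)
  then show ?case by (simp add: r_distr pure_closed[OF MN])
qed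

text \<open>
  Every law of a commutative algebra is additive in each variable, so it need only be checked on
  pure tensors, where it is a law of \<open>M\<close> and of \<open>N\<close>.
\<close>

lemma tensor_algebra_product_algebra: "algebra base_ring P"
proof -
  interpret P: module base_ring P by (rule tensor_algebra_product_module)
  note S = tensor_algebra_product_simps
  have "Group.comm_monoid P"
    by (rule comm_monoidI) (simp_all add: S closed assoc one pure_closed[OF MN], rule comm)
  then have "cring P"
    by (intro cringI P.abelian_group_axioms) (simp_all add: S l_distr)
  then show ?thesis
    using linear_mapD(3)[OF mult_left_linear] smult_T
    by (intro algebraI) (simp_all add: S base_ring_cring)
qed

end

text \<open>
  The multiplication of a commutative algebra is bilinear, and commutativity makes the induced map
  on the tensor product multiplicative.
\<close>

lemma multiplication_map:
  assumes B: "algebra base_ring B"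
  defines "\<mu> \<equiv> lin_lift B (\<lambda>(a, b). a \<otimes>\<^bsub>B\<^esub> b)"
  shows multiplication_map_hom: "\<mu> \<in> ring_hom (tensor_algebra_product B B) B"
    and multiplication_map_linear: "linear_map (tensor_algebra_product B B) B \<mu>"
    and multiplication_map_pure: "a \<in> carrier B \<Longrightarrow> b \<in> carrier B \<Longrightarrow> \<mu> (pure B B a b) = a \<otimes>\<^bsub>B\<^esub> b"
proof -
  interpret B: algebra base_ring B by (rule B)
  note BB = B.module B.module
  note tensor_ind = tensor_induct[OF BB, consumes 1, case_names pure add]
  note S = tensor_algebra_product_simps[OF B B]
  let ?h = "\<lambda>(a, b). a \<otimes>\<^bsub>B\<^esub> b" and ?T = "tensor B B"
  have 1: "?h (a, b) \<in> carrier B" if "a \<in> carrier B" "b \<in> carrier B" for a b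
    using that by simp
  have 2: "linear_map B B (\<lambda>a. ?h (a, b))" if "b \<in> carrier B" for b
    using that by (intro linear_mapI) (simp_all add: B.l_distr alg_smult_left[OF B])
  have 3: "linear_map B B (\<lambda>b. ?h (a, b))" if "a \<in> carrier B" for a
    using mult_linear[OF B that] by simp
  show mu_pure: "\<mu> (pure B B a b) = a \<otimes>\<^bsub>B\<^esub> b" if "a \<in> carrier B" "b \<in> carrier B" for a b
    using lin_lift_pure[OF BB B.module 1 2 3 that] by (simp add: \<mu>_def)
  have lin: "linear_map ?T B \<mu>"
    unfolding \<mu>_def by (rule lin_lift_linear[OF BB B.module 1 2 3])
  note L = linear_mapD[OF lin]
  show "linear_map (tensor_algebra_product B B) B \<mu>"
    using L by (intro linear_mapI) (simp_all add: S)
  interpret P: algebra base_ring "tensor_algebra_product B B"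
    by (rule tensor_algebra_product_algebra[OF B B])
  have mult: "\<mu> (u \<otimes>\<^bsub>tensor_algebra_product B B\<^esub> v) = \<mu> u \<otimes>\<^bsub>B\<^esub> \<mu> v"
    if u: "u \<in> carrier ?T" and v: "v \<in> carrier ?T" for u v
    using u
  proof (induction rule: tensor_ind)
    case u: (pure a b)
    show ?case using v
    proof (induction rule: tensor_ind)
      case (pure a' b')
      then show ?case using u by (simp add: mult_pure[OF B B] mu_pure B.m_ac)
    next
      case (add v w)
      have "pure B B a b \<in> carrier ?T" using u by (simp add: pure_closed[OF BB])
      then show ?case
        using add L P.r_distr[unfolded S, of v w "pure B B a b"] P.m_closed[unfolded S]
        by (simp add: B.r_distr)
    qed
  next
    case (add u w)
    then show ?case
      using v L P.l_distr[unfolded S, of u w v] P.m_closed[unfolded S] by (simp add: B.l_distr)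
  qed
  show "\<mu> \<in> ring_hom (tensor_algebra_product B B) B"
    using L(1,2) mult mu_pure[of "\<one>\<^bsub>B\<^esub>" "\<one>\<^bsub>B\<^esub>"] by (intro ring_hom_memI) (simp_all add: S)
qed

lemma multiplication_kernel_ideal:
  assumes B: "algebra base_ring B"
  shows "ideal (a_kernel (tensor_algebra_product B B) B (lin_lift B (\<lambda>(a, b). a \<otimes>\<^bsub>B\<^esub> b)))
    (tensor_algebra_product B B)"
proof -
  interpret B: algebra base_ring B by (rule B)
  interpret P: algebra base_ring "tensor_algebra_product B B"
    by (rule tensor_algebra_product_algebra[OF B B])
  interpret ring_hom_ring "tensor_algebra_product B B" B "lin_lift B (\<lambda>(a, b). a \<otimes>\<^bsub>B\<^esub> b)"
    by (rule ring_hom_ringI2[OF P.ring_axioms B.ring_axioms multiplication_map_hom[OF B]])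
  show ?thesis by (rule kernel_is_ideal)
qed


section \<open>Regular functions\<close>

definition monom_eval :: "('v \<Rightarrow>\<^sub>0 nat) \<Rightarrow> ('v \<Rightarrow> 'k::comm_ring_1) \<Rightarrow> 'k" where
  "monom_eval m x = (\<Prod>i\<in>Poly_Mapping.keys m. x i ^ Poly_Mapping.lookup m i)"

lemma monom_eval_superset:
  assumes "finite S" "Poly_Mapping.keys m \<subseteq> S"
  shows "monom_eval m x = (\<Prod>i\<in>S. x i ^ Poly_Mapping.lookup m i)"
  unfolding monom_eval_def
  by (rule prod.mono_neutral_left) (use assms in \<open>auto simp: in_keys_iff\<close>)

lemma monom_eval_add: "monom_eval (m + m') x = monom_eval m x * monom_eval m' x"
proof -
  let ?S = "Poly_Mapping.keys m \<union> Poly_Mapping.keys m'"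
  have "monom_eval (m + m') x = (\<Prod>i\<in>?S. x i ^ Poly_Mapping.lookup (m + m') i)"
    using keys_add[of m m'] by (intro monom_eval_superset) auto
  also have "\<dots> = monom_eval m x * monom_eval m' x"
    using monom_eval_superset[of ?S m x] monom_eval_superset[of ?S m' x]
    by (simp add: lookup_add power_add prod.distrib)
  finally show ?thesis .
qed

lemma mp_eval_eq: "mp_eval F x = (\<Sum>m\<in>Poly_Mapping.keys F. Poly_Mapping.lookup F m * monom_eval m x)"
  by (simp add: mp_eval_def monom_eval_def)

lemma mp_eval_add: "mp_eval (F + G) x = mp_eval F x + mp_eval G x"
  unfolding mp_eval_eq
  by (rule setsum_keys_plus_distrib[of "\<lambda>m c. c * monom_eval m x"]) (simp_all add: distrib_right)

lemma mp_eval_single: "mp_eval (Poly_Mapping.single m c) x = c * monom_eval m x"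
  by (simp add: mp_eval_eq)

lemma mp_eval_zero: "mp_eval 0 x = 0"
  by (simp add: mp_eval_eq)

lemma mp_eval_sum: "mp_eval (sum F A) x = (\<Sum>i\<in>A. mp_eval (F i) x)"
  by (induction A rule: infinite_finite_induct) (simp_all add: mp_eval_zero mp_eval_add)

text \<open>
  Evaluation is multiplicative on monomials; both factors are expanded into monomials.
\<close>

lemma mp_eval_mult: "mp_eval (F * G) x = mp_eval F x * mp_eval G x"
proof -
  let ?s = "\<lambda>F m. Poly_Mapping.single m (Poly_Mapping.lookup F m)"
  have "F * G = (\<Sum>m\<in>Poly_Mapping.keys F. ?s F m) * (\<Sum>m\<in>Poly_Mapping.keys G. ?s G m)"
    by (simp only: sum_monomials)
  also have "\<dots> = (\<Sum>m\<in>Poly_Mapping.keys F. \<Sum>m'\<in>Poly_Mapping.keys G.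
      Poly_Mapping.single (m + m') (Poly_Mapping.lookup F m * Poly_Mapping.lookup G m'))"
    by (simp add: sum_product mult_single)
  finally have "mp_eval (F * G) x = (\<Sum>m\<in>Poly_Mapping.keys F. \<Sum>m'\<in>Poly_Mapping.keys G.
      (Poly_Mapping.lookup F m * monom_eval m x) * (Poly_Mapping.lookup G m' * monom_eval m' x))"
    by (simp add: mp_eval_sum mp_eval_single monom_eval_add mult_ac)
  then show ?thesis by (simp add: mp_eval_eq sum_product)
qed

lemma proj_eval_ops:
  "proj_eval (F + G) P = proj_eval F P + proj_eval G P"
  "proj_eval (F * G) P = proj_eval F P * proj_eval G P"
  "proj_eval (Poly_Mapping.single 0 c) P = c"
  "proj_eval 1 P = 1"
  using mp_eval_single[of 0 1 "vec_nth (rep_proj P)"]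
  by (simp_all add: proj_eval_def mp_eval_add mp_eval_mult mp_eval_single monom_eval_def)

lemma homogeneous_add: "homogeneous d F \<Longrightarrow> homogeneous d G \<Longrightarrow> homogeneous d (F + G)"
  using keys_add[of F G] unfolding homogeneous_def by blast

lemma homogeneous_const: "homogeneous 0 (Poly_Mapping.single 0 c)"
  by (simp add: homogeneous_def)

lemma homogeneous_mult:
  fixes F G :: "('v, 'k::comm_ring_1) mpoly"
  assumes "homogeneous d F" "homogeneous e G"
  shows "homogeneous (d + e) (F * G)"
proof -
  have deg: "(\<Sum>i\<in>Poly_Mapping.keys (m + m'). Poly_Mapping.lookup (m + m') i) =
      (\<Sum>i\<in>Poly_Mapping.keys m. Poly_Mapping.lookup m i) + (\<Sum>i\<in>Poly_Mapping.keys m'. Poly_Mapping.lookup m' i)"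
    for m m' :: "'v \<Rightarrow>\<^sub>0 nat"
    by (rule setsum_keys_plus_distrib[of "\<lambda>m c. c"]) simp_all
  show ?thesis
    unfolding homogeneous_def
  proof
    fix m assume "m \<in> Poly_Mapping.keys (F * G)"
    then obtain a b where "m = a + b" "a \<in> Poly_Mapping.keys F" "b \<in> Poly_Mapping.keys G"
      using keys_mult[of F G] by blast
    then show "(\<Sum>i\<in>Poly_Mapping.keys m. Poly_Mapping.lookup m i) = d + e"
      using assms deg by (simp add: homogeneous_def)
  qed
qed

text \<open>
  The same fraction \<open>F / G\<close> of forms of equal degree represents \<open>f\<close> on all of \<open>N\<close>.
\<close>

definition quotient_on ::
    "('k::field, 'n::finite) proj set \<Rightarrow> (('k, 'n) proj \<Rightarrow> 'k) \<Rightarrow> ('n, 'k) mpoly \<Rightarrow> ('n, 'k) mpoly \<Rightarrow> bool" where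
  "quotient_on N f F G \<longleftrightarrow> (\<exists>d. homogeneous d F \<and> homogeneous d G) \<and>
     (\<forall>P\<in>N. proj_eval G P \<noteq> 0 \<and> f P = proj_eval F P / proj_eval G P)"

lemma regular_functions_iff:
  "f \<in> regular_functions X W \<longleftrightarrow> (\<forall>P. P \<notin> W \<longrightarrow> f P = 0) \<and>
     (\<forall>P\<in>W. \<exists>N F G. openin (zariski_on X) N \<and> P \<in> N \<and> N \<subseteq> W \<and> quotient_on N f F G)"
  unfolding regular_functions_def locally_quotient_def quotient_on_def
  by (simp only: mem_Collect_eq prod.inject) blast

lemma quotient_on_subset: "quotient_on N f F G \<Longrightarrow> N' \<subseteq> N \<Longrightarrow> quotient_on N' f F G"
  unfolding quotient_on_def by blast

lemma quotient_on_add: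
  assumes "quotient_on N f F G" "quotient_on N f' F' G'"
  shows "quotient_on N (\<lambda>P. f P + f' P) (F * G' + F' * G) (G * G')"
proof -
  obtain d e where "homogeneous d F" "homogeneous d G" "homogeneous e F'" "homogeneous e G'"
    using assms by (auto simp: quotient_on_def)
  then have "homogeneous (d + e) (F * G' + F' * G)" "homogeneous (d + e) (G * G')"
    using homogeneous_mult[of e F' d G] by (simp_all add: homogeneous_mult homogeneous_add add.commute)
  then show ?thesis
    using assms unfolding quotient_on_def by (auto simp: proj_eval_ops add_frac_eq)
qed

lemma quotient_on_mult:
  assumes "quotient_on N f F G" "quotient_on N f' F' G'"
  shows "quotient_on N (\<lambda>P. f P * f' P) (F * F') (G * G')"
proof -
  obtain d e where "homogeneous d F" "homogeneous d G" "homogeneous e F'" "homogeneous e G'"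
    using assms by (auto simp: quotient_on_def)
  then have "homogeneous (d + e) (F * F')" "homogeneous (d + e) (G * G')"
    by (simp_all add: homogeneous_mult)
  then show ?thesis
    using assms unfolding quotient_on_def by (auto simp: proj_eval_ops)
qed

text \<open>
  Regularity is local: two functions are represented by single fractions on a common neighbourhood
  of each point, so it suffices that \<open>h\<close> is a fraction wherever \<open>f\<close> and \<open>f'\<close> are.
\<close>

lemma regular_combine:
  assumes f: "f \<in> regular_functions X W" and f': "f' \<in> regular_functions X W"
    and h: "\<And>N F G F' G'. quotient_on N f F G \<Longrightarrow> quotient_on N f' F' G' \<Longrightarrow> \<exists>F'' G''. quotient_on N h F'' G''"
    and 0: "\<And>P. f P = 0 \<Longrightarrow> f' P = 0 \<Longrightarrow> h P = 0"
  shows "h \<in> regular_functions X W"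
  unfolding regular_functions_iff
proof (intro conjI allI ballI impI)
  show "h P = 0" if "P \<notin> W" for P
    using f f' 0 that unfolding regular_functions_iff by blast
  fix P assume P: "P \<in> W"
  obtain N F G where N: "openin (zariski_on X) N" "P \<in> N" "N \<subseteq> W" "quotient_on N f F G"
    using f P unfolding regular_functions_iff by blast
  obtain N' F' G' where N': "openin (zariski_on X) N'" "P \<in> N'" "N' \<subseteq> W" "quotient_on N' f' F' G'"
    using f' P unfolding regular_functions_iff by blast
  have "quotient_on (N \<inter> N') f F G" "quotient_on (N \<inter> N') f' F' G'"
    using N N' quotient_on_subset by blast+
  then obtain F'' G'' where "quotient_on (N \<inter> N') h F'' G''" using h by blast
  then show "\<exists>N F G. openin (zariski_on X) N \<and> P \<in> N \<and> N \<subseteq> W \<and> quotient_on N h F G"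
    using N N' openin_Int[of "zariski_on X" N N'] by blast
qed

lemma regular_add:
  "f \<in> regular_functions X W \<Longrightarrow> f' \<in> regular_functions X W \<Longrightarrow> (\<lambda>P. f P + f' P) \<in> regular_functions X W"
  by (rule regular_combine[of f X W f'], assumption+) (rule exI, rule exI, erule (1) quotient_on_add, simp)

lemma regular_mult:
  "f \<in> regular_functions X W \<Longrightarrow> f' \<in> regular_functions X W \<Longrightarrow> (\<lambda>P. f P * f' P) \<in> regular_functions X W"
  by (rule regular_combine[of f X W f'], assumption+) (rule exI, rule exI, erule (1) quotient_on_mult, simp)

lemma regular_const:
  assumes W: "openin (zariski_on X) W"
  shows "(\<lambda>P. if P \<in> W then c else 0) \<in> regular_functions X W"
  unfolding regular_functions_iff
proof (intro conjI allI ballI impI)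
  have "quotient_on W (\<lambda>P. if P \<in> W then c else 0) (Poly_Mapping.single 0 c) (Poly_Mapping.single 0 1)"
    unfolding quotient_on_def using homogeneous_const by (auto simp: proj_eval_ops simp del: single_one)
  then show "\<exists>N F G. openin (zariski_on X) N \<and> P \<in> N \<and> N \<subseteq> W \<and>
      quotient_on N (\<lambda>P. if P \<in> W then c else 0) F G" if "P \<in> W" for P
    using that W by blast
qed simp

lemma regular_zero: "f \<in> regular_functions X W \<Longrightarrow> P \<notin> W \<Longrightarrow> f P = 0"
  by (simp add: regular_functions_iff)

lemma regular_scale:
  assumes W: "openin (zariski_on X) W" and f: "f \<in> regular_functions X W"
  shows "(\<lambda>P. c * f P) \<in> regular_functions X W"
proof -
  have "(\<lambda>P. c * f P) = (\<lambda>P. (if P \<in> W then c else 0) * f P)"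
    using regular_zero[OF f] by auto
  then show ?thesis using regular_mult[OF regular_const[OF W, of c] f] by simp
qed

lemma regular_restrict:
  assumes V: "openin (zariski_on X) V" "V \<subseteq> W" and f: "f \<in> regular_functions X W"
  shows "restrict_fun V f \<in> regular_functions X V"
  unfolding regular_functions_iff
proof (intro conjI allI ballI impI)
  show "restrict_fun V f P = 0" if "P \<notin> V" for P using that by (simp add: restrict_fun_def)
  fix P assume P: "P \<in> V"
  then obtain N F G where N: "openin (zariski_on X) N" "P \<in> N" "quotient_on N f F G"
    using f V unfolding regular_functions_iff by blast
  then have "quotient_on (N \<inter> V) (restrict_fun V f) F G"
    by (auto simp: quotient_on_def restrict_fun_def)
  then show "\<exists>N F G. openin (zariski_on X) N \<and> P \<in> N \<and> N \<subseteq> V \<and> quotient_on N (restrict_fun V f) F G"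
    using N(1,2) V(1) P openin_Int[of "zariski_on X" N V] by blast
qed

text \<open>
  Where \<open>f = F / G\<close> with \<open>G\<close> nowhere zero, \<open>f\<close> vanishes exactly with \<open>F\<close>, and the set where the form \<open>F\<close>
  does not vanish belongs to the subbasis of the Zariski topology.
\<close>

lemma nonvanishing_open:
  assumes f: "f \<in> regular_functions X W"
  shows "openin (zariski_on X) {P \<in> W. f P \<noteq> 0}"
proof (subst openin_subopen, intro ballI)
  fix P assume P: "P \<in> {P \<in> W. f P \<noteq> 0}"
  then obtain N F G where N: "openin (zariski_on X) N" "P \<in> N" "N \<subseteq> W" "quotient_on N f F G"
    using f unfolding regular_functions_iff by blast
  then obtain d where "homogeneous d F" by (auto simp: quotient_on_def)
  then have "openin zariski {P. proj_eval F P \<noteq> 0}"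
    unfolding zariski_def by (intro topology_generated_by_Basis) blast
  then have "openin (zariski_on X) (X \<inter> {P. proj_eval F P \<noteq> 0})"
    unfolding zariski_on_def by (simp add: openin_subtopology_Int2)
  then have "openin (zariski_on X) (N \<inter> (X \<inter> {P. proj_eval F P \<noteq> 0}))"
    using N(1) by (rule openin_Int[rotated])
  moreover have "N \<subseteq> X" using openin_subset[OF N(1)] by (auto simp: zariski_on_def)
  ultimately show "\<exists>T. openin (zariski_on X) T \<and> P \<in> T \<and> T \<subseteq> {P \<in> W. f P \<noteq> 0}"
    using N P by (intro exI[of _ "N \<inter> (X \<inter> {P. proj_eval F P \<noteq> 0})"]) (auto simp: quotient_on_def)
qed

lemma regular_inverse:
  assumes f: "f \<in> regular_functions X W" and nz: "\<And>P. P \<in> W \<Longrightarrow> f P \<noteq> 0"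
  shows "(\<lambda>P. inverse (f P)) \<in> regular_functions X W"
  unfolding regular_functions_iff
proof (intro conjI allI ballI impI)
  show "inverse (f P) = 0" if "P \<notin> W" for P using regular_zero[OF f that] by simp
  fix P assume "P \<in> W"
  then obtain N F G where N: "openin (zariski_on X) N" "P \<in> N" "N \<subseteq> W" "quotient_on N f F G"
    using f unfolding regular_functions_iff by blast
  have "quotient_on N (\<lambda>P. inverse (f P)) G F"
    unfolding quotient_on_def
  proof (intro conjI ballI)
    show "\<exists>d. homogeneous d G \<and> homogeneous d F" using N(4) by (auto simp: quotient_on_def)
    fix Q assume "Q \<in> N"
    then have "Q \<in> W" using N by blast
    then have "f Q \<noteq> 0" by (rule nz)
    moreover have "proj_eval G Q \<noteq> 0 \<and> f Q = proj_eval F Q / proj_eval G Q"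
      using N(4) \<open>Q \<in> N\<close> unfolding quotient_on_def by blast
    ultimately have "proj_eval G Q \<noteq> 0" "f Q = proj_eval F Q / proj_eval G Q" "f Q \<noteq> 0"
      by blast+
    then show "proj_eval F Q \<noteq> 0" "inverse (f Q) = proj_eval G Q / proj_eval F Q" by auto
  qed
  then show "\<exists>N F G. openin (zariski_on X) N \<and> P \<in> N \<and> N \<subseteq> W \<and> quotient_on N (\<lambda>P. inverse (f P)) F G"
    using N by blast
qed

lemma Areg_simps:
  "carrier (Areg X W) = regular_functions X W"
  "f \<otimes>\<^bsub>Areg X W\<^esub> f' = (\<lambda>P. f P * f' P)" "f \<oplus>\<^bsub>Areg X W\<^esub> f' = (\<lambda>P. f P + f' P)"
  "\<one>\<^bsub>Areg X W\<^esub> = (\<lambda>P. if P \<in> W then 1 else 0)" "\<zero>\<^bsub>Areg X W\<^esub> = (\<lambda>P. 0)"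
  "c \<odot>\<^bsub>Areg X W\<^esub> f = (\<lambda>P. c * f P)"
  by (simp_all add: Areg_def)

lemma Areg_algebra:
  assumes W: "openin (zariski_on X) W"
  shows "algebra base_ring (Areg X W)"
proof (rule algebraI)
  have neg: "(\<lambda>P. - f P) \<in> regular_functions X W" if "f \<in> regular_functions X W" for f
    using regular_scale[OF W that, of "- 1"] by simp
  have zero: "(\<lambda>P. 0) \<in> regular_functions X W"
    using regular_const[OF W, of 0] by simp
  have G: "abelian_group (Areg X W)"
  proof (rule abelian_groupI)
    fix f assume "f \<in> carrier (Areg X W)"
    then show "\<exists>h\<in>carrier (Areg X W). h \<oplus>\<^bsub>Areg X W\<^esub> f = \<zero>\<^bsub>Areg X W\<^esub>"
      by (intro bexI[of _ "\<lambda>P. - f P"]) (simp_all add: Areg_simps neg)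
  qed (simp_all add: Areg_simps regular_add zero ac_simps)
  have "Group.comm_monoid (Areg X W)"
    by (rule comm_monoidI)
      (auto simp: Areg_simps regular_mult regular_const[OF W] ac_simps regular_zero fun_eq_iff)
  then show "cring (Areg X W)"
    using G by (intro cringI) (simp_all add: Areg_simps distrib_right)
qed (simp_all add: base_ring_cring Areg_simps regular_scale[OF W] algebra_simps)

lemma nonvanishing_regular_unit:
  assumes W: "openin (zariski_on X) W" and f: "f \<in> regular_functions X W"
    and nz: "\<And>P. P \<in> W \<Longrightarrow> f P \<noteq> 0"
  shows "f \<in> Units (Areg X W)"
proof -
  have "(\<lambda>P. inverse (f P)) \<in> carrier (Areg X W)"
    using regular_inverse[OF f nz] by (simp add: Areg_simps)
  moreover have "(\<lambda>P. inverse (f P)) \<otimes>\<^bsub>Areg X W\<^esub> f = \<one>\<^bsub>Areg X W\<^esub>"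
    "f \<otimes>\<^bsub>Areg X W\<^esub> (\<lambda>P. inverse (f P)) = \<one>\<^bsub>Areg X W\<^esub>"
    using regular_zero[OF f] nz by (auto simp: Areg_simps fun_eq_iff)
  ultimately show ?thesis
    using f unfolding Units_def by (auto simp: Areg_simps(1))
qed


section \<open>Vector fields\<close>

lemma Vect_simps:
  "carrier (Vect X W) = {\<eta>. is_vfield X W \<eta>}" "\<zero>\<^bsub>Vect X W\<^esub> = (\<lambda>V f P. 0)"
  "\<eta> \<oplus>\<^bsub>Vect X W\<^esub> \<theta> = (\<lambda>V f P. \<eta> V f P + \<theta> V f P)" "c \<odot>\<^bsub>Vect X W\<^esub> \<eta> = (\<lambda>V f P. c * \<eta> V f P)"
  by (simp_all add: Vect_def)

lemma derivation_Areg_iff: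
  "derivation (Areg X V) D \<longleftrightarrow>
     (\<forall>f\<in>regular_functions X V. D f \<in> regular_functions X V) \<and>
     (\<forall>f\<in>regular_functions X V. \<forall>g\<in>regular_functions X V. D (\<lambda>P. f P + g P) = (\<lambda>P. D f P + D g P)) \<and>
     (\<forall>c. \<forall>f\<in>regular_functions X V. D (\<lambda>P. c * f P) = (\<lambda>P. c * D f P)) \<and>
     (\<forall>f\<in>regular_functions X V. \<forall>g\<in>regular_functions X V.
        D (\<lambda>P. f P * g P) = (\<lambda>P. D f P * g P + f P * D g P))"
  unfolding derivation_def Areg_simps Pi_iff by (rule refl)

lemma is_vfieldD:
  assumes "is_vfield X W \<eta>"
  shows "openin (zariski_on X) V \<Longrightarrow> V \<subseteq> W \<Longrightarrow> derivation (Areg X V) (\<eta> V)"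
    and "openin (zariski_on X) V \<Longrightarrow> openin (zariski_on X) V' \<Longrightarrow> V' \<subseteq> V \<Longrightarrow> V \<subseteq> W \<Longrightarrow>
      f \<in> regular_functions X V \<Longrightarrow> \<eta> V' (restrict_fun V' f) = restrict_fun V' (\<eta> V f)"
    and "\<not> (openin (zariski_on X) V \<and> V \<subseteq> W \<and> f \<in> regular_functions X V) \<Longrightarrow> \<eta> V f = (\<lambda>P. 0)"
proof -
  note D = assms[unfolded is_vfield_def Areg_simps]
  show "openin (zariski_on X) V \<Longrightarrow> V \<subseteq> W \<Longrightarrow> derivation (Areg X V) (\<eta> V)"
    using conjunct1[OF D] by simp
  show "openin (zariski_on X) V \<Longrightarrow> openin (zariski_on X) V' \<Longrightarrow> V' \<subseteq> V \<Longrightarrow> V \<subseteq> W \<Longrightarrow>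
      f \<in> regular_functions X V \<Longrightarrow> \<eta> V' (restrict_fun V' f) = restrict_fun V' (\<eta> V f)"
    using conjunct1[OF conjunct2[OF D]] by simp
  show "\<not> (openin (zariski_on X) V \<and> V \<subseteq> W \<and> f \<in> regular_functions X V) \<Longrightarrow> \<eta> V f = (\<lambda>P. 0)"
    using conjunct2[OF conjunct2[OF D]] by metis
qed

lemma is_vfieldI:
  assumes "\<And>V. openin (zariski_on X) V \<Longrightarrow> V \<subseteq> W \<Longrightarrow> derivation (Areg X V) (\<eta> V)"
    and "\<And>V V' f. openin (zariski_on X) V \<Longrightarrow> openin (zariski_on X) V' \<Longrightarrow> V' \<subseteq> V \<Longrightarrow> V \<subseteq> W \<Longrightarrow>
      f \<in> regular_functions X V \<Longrightarrow> \<eta> V' (restrict_fun V' f) = restrict_fun V' (\<eta> V f)"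
    and "\<And>V f. \<not> (openin (zariski_on X) V \<and> V \<subseteq> W \<and> f \<in> regular_functions X V) \<Longrightarrow> \<eta> V f = (\<lambda>P. 0)"
  shows "is_vfield X W \<eta>"
  unfolding is_vfield_def Areg_simps
proof (intro conjI allI impI)
qed (use assms in simp_all)

lemma is_vfield_add:
  assumes \<eta>: "is_vfield X W \<eta>" and \<theta>: "is_vfield X W \<theta>"
  shows "is_vfield X W (\<lambda>V f P. \<eta> V f P + \<theta> V f P)"
proof (rule is_vfieldI)
  fix V assume V: "openin (zariski_on X) V" "V \<subseteq> W"
  show "derivation (Areg X V) (\<lambda>f P. \<eta> V f P + \<theta> V f P)"
    using is_vfieldD(1)[OF \<eta> V] is_vfieldD(1)[OF \<theta> V] unfolding derivation_Areg_iff
    by (simp add: regular_add algebra_simps)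
next
  fix V V' f assume V: "openin (zariski_on X) V" "openin (zariski_on X) V'" "V' \<subseteq> V" "V \<subseteq> W"
    "f \<in> regular_functions X V"
  show "(\<lambda>P. \<eta> V' (restrict_fun V' f) P + \<theta> V' (restrict_fun V' f) P) =
      restrict_fun V' (\<lambda>P. \<eta> V f P + \<theta> V f P)"
    unfolding is_vfieldD(2)[OF \<eta> V] is_vfieldD(2)[OF \<theta> V] by (auto simp: restrict_fun_def)
qed (simp add: is_vfieldD(3)[OF \<eta>] is_vfieldD(3)[OF \<theta>])

text \<open>
  On an open \<open>V \<subseteq> W\<close> the values of \<open>\<eta>\<close> vanish outside \<open>V\<close>, so multiplying them by \<open>b\<close> amounts to
  multiplying them by the restriction of \<open>b\<close> to \<open>V\<close>, a regular function on \<open>V\<close>.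
\<close>

lemma vf_scale_vfield:
  assumes W: "openin (zariski_on X) W" and b: "b \<in> regular_functions X W" and \<eta>: "is_vfield X W \<eta>"
  shows "is_vfield X W (vf_scale b \<eta>)"
  unfolding vf_scale_def
proof (rule is_vfieldI)
  fix V assume V: "openin (zariski_on X) V" "V \<subseteq> W"
  note D = is_vfieldD(1)[OF \<eta> V, unfolded derivation_Areg_iff]
  have "(\<lambda>P. b P * \<eta> V f P) \<in> regular_functions X V" if f: "f \<in> regular_functions X V" for f
  proof -
    have \<eta>f: "\<eta> V f \<in> regular_functions X V" using D f by blast
    have "(\<lambda>P. b P * \<eta> V f P) = (\<lambda>P. restrict_fun V b P * \<eta> V f P)"
      using regular_zero[OF \<eta>f] by (auto simp: restrict_fun_def)
    then show ?thesis using regular_mult[OF regular_restrict[OF V b] \<eta>f] by simp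
  qed
  then show "derivation (Areg X V) (\<lambda>f P. b P * \<eta> V f P)"
    using D unfolding derivation_Areg_iff by (simp add: algebra_simps)
next
  fix V V' f assume V: "openin (zariski_on X) V" "openin (zariski_on X) V'" "V' \<subseteq> V" "V \<subseteq> W"
    "f \<in> regular_functions X V"
  show "(\<lambda>P. b P * \<eta> V' (restrict_fun V' f) P) = restrict_fun V' (\<lambda>P. b P * \<eta> V f P)"
    unfolding is_vfieldD(2)[OF \<eta> V] by (auto simp: restrict_fun_def)
qed (simp add: is_vfieldD(3)[OF \<eta>])

lemma is_vfield_zero:
  assumes "openin (zariski_on X) W"
  shows "is_vfield X W (\<lambda>V f P. 0)"
proof (rule is_vfieldI)
  fix V assume "openin (zariski_on X) V"
  then show "derivation (Areg X V) (\<lambda>f P. 0)"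
    using regular_const[of X V 0] by (simp add: derivation_Areg_iff)
qed (auto simp: restrict_fun_def)

text \<open>
  Vector fields on \<open>W\<close> take values that vanish outside \<open>W\<close>, so the scalar \<open>c\<close> acts as the regular
  function with constant value \<open>c\<close> on \<open>W\<close>.
\<close>

lemma is_vfield_smult:
  assumes W: "openin (zariski_on X) W" and \<eta>: "is_vfield X W \<eta>"
  shows "is_vfield X W (\<lambda>V f P. c * \<eta> V f P)"
proof -
  have "(\<lambda>V f P. c * \<eta> V f P) = vf_scale (\<lambda>P. if P \<in> W then c else 0) \<eta>"
  proof (intro ext)
    fix V f P
    have "\<eta> V f P = 0" if P: "P \<notin> W"
    proof (cases "openin (zariski_on X) V \<and> V \<subseteq> W \<and> f \<in> regular_functions X V")
      case True
      then have "\<eta> V f \<in> regular_functions X V"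
        using is_vfieldD(1)[OF \<eta>, of V] by (auto simp: derivation_Areg_iff)
      then show ?thesis by (rule regular_zero) (use True P in blast)
    qed (simp add: is_vfieldD(3)[OF \<eta>])
    then show "c * \<eta> V f P = vf_scale (\<lambda>P. if P \<in> W then c else 0) \<eta> V f P"
      by (simp add: vf_scale_def)
  qed
  then show ?thesis using vf_scale_vfield[OF W regular_const[OF W] \<eta>] by simp
qed

lemma restrict_vf_vfield:
  assumes W: "W \<subseteq> U" and \<eta>: "is_vfield X U \<eta>"
  shows "is_vfield X W (restrict_vf W \<eta>)"
proof (rule is_vfieldI)
  fix V assume "openin (zariski_on X) V" "V \<subseteq> W"
  then show "derivation (Areg X V) (restrict_vf W \<eta> V)"
    using is_vfieldD(1)[OF \<eta>, of V] W by (simp add: restrict_vf_def)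
next
  fix V V' f assume V: "openin (zariski_on X) V" "openin (zariski_on X) V'" "V' \<subseteq> V" "V \<subseteq> W"
    "f \<in> regular_functions X V"
  then show "restrict_vf W \<eta> V' (restrict_fun V' f) = restrict_fun V' (restrict_vf W \<eta> V f)"
    using is_vfieldD(2)[OF \<eta>, of V V' f] subset_trans[OF V(4) W] subset_trans[OF V(3,4)]
    by (simp add: restrict_vf_def)
next
  fix V f assume "\<not> (openin (zariski_on X) V \<and> V \<subseteq> W \<and> f \<in> regular_functions X V)"
  then show "restrict_vf W \<eta> V f = (\<lambda>P. 0)"
    using is_vfieldD(3)[OF \<eta>, of V f] by (cases "V \<subseteq> W") (simp_all add: restrict_vf_def)
qed

lemma Vect_module:
  assumes W: "openin (zariski_on X) W"
  shows "module base_ring (Vect X W)"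
proof (rule moduleI)
  show "abelian_group (Vect X W)"
  proof (rule abelian_groupI)
    fix \<eta> assume "\<eta> \<in> carrier (Vect X W)"
    then show "\<exists>\<theta>\<in>carrier (Vect X W). \<theta> \<oplus>\<^bsub>Vect X W\<^esub> \<eta> = \<zero>\<^bsub>Vect X W\<^esub>"
      using is_vfield_smult[OF W, of \<eta> "- 1"]
      by (intro bexI[of _ "\<lambda>V f P. - 1 * \<eta> V f P"]) (simp_all add: Vect_simps)
  qed (simp_all add: Vect_simps is_vfield_add is_vfield_zero[OF W] ac_simps)
qed (simp_all add: base_ring_cring Vect_simps is_vfield_smult[OF W] algebra_simps)

lemma vf_scale_linear:
  assumes W: "openin (zariski_on X) W" and \<eta>: "\<eta> \<in> carrier (Vect X W)"
  shows "linear_map (Areg X W) (Vect X W) (\<lambda>b. vf_scale b \<eta>)"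
  by (rule linear_mapI)
    (use vf_scale_vfield[OF W] \<eta> in \<open>simp_all add: Areg_simps Vect_simps vf_scale_def algebra_simps\<close>)


section \<open>Jets of vector fields\<close>

context
  fixes X W :: "('k::field, 'n::finite) proj set"
  assumes W: "openin (zariski_on X) W"
begin

private abbreviation (input) "B \<equiv> Areg X W"
private abbreviation (input) "L \<equiv> AhashV X W"
private abbreviation (input) "BB \<equiv> Areg2 X W"

private lemmas AB = Areg_algebra[OF W]
interpretation B: algebra base_ring B by (rule AB)
private lemmas BV = B.module Vect_module[OF W]

lemma AhashV_simps:
  "carrier L = carrier (tensor B (Vect X W))" "zero L = zero (tensor B (Vect X W))"
  "add L = add (tensor B (Vect X W))" "smult L = smult (tensor B (Vect X W))"
  by (simp_all add: AhashV_def Let_def module.defs)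

lemma AhashV_module: "module base_ring L"
  by (rule module_transfer[OF tensor_module[OF BV]]) (simp_all add: AhashV_simps)

interpretation L: module base_ring L by (rule AhashV_module)

lemma Areg2_algebra: "algebra base_ring BB"
  unfolding Areg2_def by (rule tensor_algebra_product_algebra[OF AB AB])

interpretation BB: algebra base_ring BB by (rule Areg2_algebra)

lemma hash_linear:
  shows "\<eta> \<in> carrier (Vect X W) \<Longrightarrow> linear_map B L (\<lambda>a. hash X W a \<eta>)"
    and "a \<in> carrier B \<Longrightarrow> linear_map (Vect X W) L (\<lambda>\<eta>. hash X W a \<eta>)"
  by (intro linear_mapI;
      simp add: hash_def AhashV_simps pure_closed[OF BV] pure_add[OF BV] pure_smult[OF BV])+

text \<open>
  The map \<open>(a, b) \<mapsto> a # b \<eta>\<close> is bilinear, so it factors through the tensor product.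
\<close>

lemma bitensor_vf:
  assumes \<eta>: "\<eta> \<in> carrier (Vect X W)"
  shows bitensor_vf_linear: "linear_map BB L (\<lambda>u. bitensor_vf X W u \<eta>)"
    and bitensor_vf_pure: "a \<in> carrier B \<Longrightarrow> b \<in> carrier B \<Longrightarrow>
      bitensor_vf X W (pure B B a b) \<eta> = hash X W a (vf_scale b \<eta>)"
proof -
  let ?h = "\<lambda>(a, b). hash X W a (vf_scale b \<eta>)"
  note S = linear_mapD(1)[OF vf_scale_linear[OF W \<eta>]]
  have 1: "?h (a, b) \<in> carrier L" if "a \<in> carrier B" "b \<in> carrier B" for a b
    using linear_mapD(1)[OF hash_linear(1)[OF S[OF that(2)]] that(1)] by simp
  have 2: "linear_map B L (\<lambda>a. ?h (a, b))" if "b \<in> carrier B" for b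
    using hash_linear(1)[OF S[OF that]] by simp
  have 3: "linear_map B L (\<lambda>b. ?h (a, b))" if "a \<in> carrier B" for a
    using linear_map_comp[OF vf_scale_linear[OF W \<eta>] hash_linear(2)[OF that]] by simp
  note I = tensor_lift[OF B.module B.module L.module_axioms 1 2 3]
  show "linear_map BB L (\<lambda>u. bitensor_vf X W u \<eta>)"
    using linear_mapD[OF I(1)] unfolding Areg2_def bitensor_vf_def
    by (intro linear_mapI) (simp_all add: tensor_algebra_product_simps[OF AB AB])
  show "a \<in> carrier B \<Longrightarrow> b \<in> carrier B \<Longrightarrow>
      bitensor_vf X W (pure B B a b) \<eta> = hash X W a (vf_scale b \<eta>)"
    using I(2)[of a b] by (simp add: bitensor_vf_def)
qed

lemma Delta_ideal: "ideal (Delta X W) BB"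
  unfolding Delta_def Areg2_def by (rule multiplication_kernel_ideal[OF AB])

lemma Jker_submodule: "submodule (Jker X W k) base_ring L"
  unfolding Jker_def
proof (rule submodule_generated_submodule[OF L.module_axioms], safe)
  fix u \<eta> assume "u \<in> ideal_power BB (Delta X W) (k + 1)" "\<eta> \<in> carrier (Vect X W)"
  moreover from this have "u \<in> carrier BB"
    using ideal.Icarr[OF BB.ideal_power_ideal[OF Delta_ideal]] by blast
  ultimately show "bitensor_vf X W u \<eta> \<in> carrier L"
    using linear_mapD(1)[OF bitensor_vf_linear] by blast
qed

lemma bitensor_vf_in_Jker:
  "u \<in> ideal_power BB (Delta X W) (k + 1) \<Longrightarrow> \<eta> \<in> carrier (Vect X W) \<Longrightarrow> bitensor_vf X W u \<eta> \<in> Jker X W k"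
  unfolding Jker_def by (rule subsetD[OF submodule_generated_incl]) blast

lemma Jker_antimono: "j \<le> k \<Longrightarrow> Jker X W k \<subseteq> Jker X W j"
proof (unfold Jker_def[of X W k], rule submodule_generated_minimal[OF Jker_submodule], safe)
  fix u \<eta> assume "j \<le> k" "u \<in> ideal_power BB (Delta X W) (k + 1)" "\<eta> \<in> carrier (Vect X W)"
  then show "bitensor_vf X W u \<eta> \<in> Jker X W j"
    using BB.ideal_power_antimono[OF Delta_ideal, of "j + 1" "k + 1"] bitensor_vf_in_Jker by auto
qed


section \<open>The inverse limit\<close>

interpretation J: abelian_subgroup "Jker X W k" L for k
  by (rule submodule_abelian_subgroup[OF L.module_axioms Jker_submodule])

private abbreviation (input) "co k p \<equiv> Jker X W k +>\<^bsub>L\<^esub> p"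

lemma Jquot_module: "module base_ring (Jquot X W k)"
  unfolding Jquot_def by (rule quotient_module_module[OF L.module_axioms Jker_submodule])

lemma Jquot_simps:
  "carrier (Jquot X W k) = (\<lambda>p. co k p) ` carrier L"
  "p \<in> carrier L \<Longrightarrow> q \<in> carrier L \<Longrightarrow> co k p \<oplus>\<^bsub>Jquot X W k\<^esub> co k q = co k (p \<oplus>\<^bsub>L\<^esub> q)"
  "\<zero>\<^bsub>Jquot X W k\<^esub> = co k \<zero>\<^bsub>L\<^esub>"
  unfolding Jquot_def quotient_module_simps A_RCOSETS_def'
  by (simp_all add: J.a_rcos_sum UNION_singleton_eq_range J.a_subset)

text \<open>
  The transition maps of the inverse system do not change representatives.
\<close>

lemma Jker_add_coset:
  assumes "p \<in> carrier L"
  shows "Jker X W k <+>\<^bsub>L\<^esub> co (Suc k) p = co k p"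
proof -
  have sub: "Jker X W (Suc k) \<subseteq> Jker X W k" by (rule Jker_antimono) simp
  have "Jker X W k <+>\<^bsub>L\<^esub> Jker X W (Suc k) = Jker X W k"
  proof
    show "Jker X W k <+>\<^bsub>L\<^esub> Jker X W (Suc k) \<subseteq> Jker X W k"
      using sub J.a_closed[of _ k] unfolding set_add_def' by blast
    show "Jker X W k \<subseteq> Jker X W k <+>\<^bsub>L\<^esub> Jker X W (Suc k)"
    proof
      fix p assume p: "p \<in> Jker X W k"
      then have "p = p \<oplus>\<^bsub>L\<^esub> \<zero>\<^bsub>L\<^esub>" using J.a_subset[of k] by auto
      then show "p \<in> Jker X W k <+>\<^bsub>L\<^esub> Jker X W (Suc k)"
        using p J.zero_closed[of "Suc k"] unfolding set_add_def' by blast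
    qed
  qed
  then show ?thesis
    using L.a_setmult_rcos_assoc[OF J.a_subset J.a_subset assms, of k "Suc k"] by simp
qed

lemma Jhat_simps:
  "\<zero>\<^bsub>Jhat X W\<^esub> = (\<lambda>k. \<zero>\<^bsub>Jquot X W k\<^esub>)" "x \<oplus>\<^bsub>Jhat X W\<^esub> y = (\<lambda>k. x k \<oplus>\<^bsub>Jquot X W k\<^esub> y k)"
  by (simp_all add: Jhat_def)

lemma Jhat_carrier:
  "x \<in> carrier (Jhat X W) \<longleftrightarrow>
    (\<forall>k. x k \<in> carrier (Jquot X W k) \<and> x k = Jker X W k <+>\<^bsub>L\<^esub> x (Suc k))"
  unfolding Jhat_def by simp

text \<open>
  A transition map only enlarges a coset, so any representative of the component at level \<open>k + 1\<close>
  also represents the component at level \<open>k\<close>. The components of a sum are computed on such common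
  representatives.
\<close>

lemma Jhat_carrier_iff:
  "x \<in> carrier (Jhat X W) \<longleftrightarrow>
    (\<forall>k. \<exists>p\<in>carrier L. x k = co k p \<and> x (Suc k) = co (Suc k) p)"
proof
  assume x: "x \<in> carrier (Jhat X W)"
  show "\<forall>k. \<exists>p\<in>carrier L. x k = co k p \<and> x (Suc k) = co (Suc k) p"
  proof
    fix k
    have "x (Suc k) \<in> carrier (Jquot X W (Suc k))" and k: "x k = Jker X W k <+>\<^bsub>L\<^esub> x (Suc k)"
      using x unfolding Jhat_carrier by blast+
    then obtain p where p: "p \<in> carrier L" "x (Suc k) = co (Suc k) p"
      unfolding Jquot_simps(1) by blast
    then show "\<exists>p\<in>carrier L. x k = co k p \<and> x (Suc k) = co (Suc k) p"
      using k Jker_add_coset by (intro bexI[OF _ p(1)]) simp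
  qed
next
  assume x: "\<forall>k. \<exists>p\<in>carrier L. x k = co k p \<and> x (Suc k) = co (Suc k) p"
  have "x k \<in> carrier (Jquot X W k) \<and> x k = Jker X W k <+>\<^bsub>L\<^esub> x (Suc k)" for k
  proof -
    obtain p where "p \<in> carrier L" "x k = co k p" "x (Suc k) = co (Suc k) p" using x by blast
    then show ?thesis by (simp add: Jquot_simps(1) Jker_add_coset)
  qed
  then show "x \<in> carrier (Jhat X W)" unfolding Jhat_carrier by blast
qed

lemma to_Jhat_closed: "p \<in> carrier L \<Longrightarrow> to_Jhat X W p \<in> carrier (Jhat X W)"
  unfolding Jhat_carrier_iff to_Jhat_def by blast

lemma Jhat_abelian_monoid: "abelian_monoid (Jhat X W)"
proof (rule abelian_monoidI)
  interpret Q: module base_ring "Jquot X W k" for k by (rule Jquot_module)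
  have comp: "x k \<in> carrier (Jquot X W k)" if "x \<in> carrier (Jhat X W)" for x k
    using that unfolding Jhat_carrier by blast
  fix x y z
  show "\<zero>\<^bsub>Jhat X W\<^esub> \<in> carrier (Jhat X W)"
    unfolding Jhat_carrier_iff Jhat_simps Jquot_simps by blast
  assume x: "x \<in> carrier (Jhat X W)"
  show "\<zero>\<^bsub>Jhat X W\<^esub> \<oplus>\<^bsub>Jhat X W\<^esub> x = x"
    using comp[OF x] by (simp add: Jhat_simps)
  assume y: "y \<in> carrier (Jhat X W)"
  show "x \<oplus>\<^bsub>Jhat X W\<^esub> y = y \<oplus>\<^bsub>Jhat X W\<^esub> x"
    using comp[OF x] comp[OF y] by (simp add: Jhat_simps Q.a_comm)
  show "x \<oplus>\<^bsub>Jhat X W\<^esub> y \<in> carrier (Jhat X W)"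
    unfolding Jhat_carrier_iff Jhat_simps
  proof
    fix k
    obtain p where p: "p \<in> carrier L" "x k = co k p" "x (Suc k) = co (Suc k) p"
      using x unfolding Jhat_carrier_iff by blast
    obtain q where q: "q \<in> carrier L" "y k = co k q" "y (Suc k) = co (Suc k) q"
      using y unfolding Jhat_carrier_iff by blast
    show "\<exists>p\<in>carrier L. x k \<oplus>\<^bsub>Jquot X W k\<^esub> y k = co k p \<and>
        x (Suc k) \<oplus>\<^bsub>Jquot X W (Suc k)\<^esub> y (Suc k) = co (Suc k) p"
      using p q by (intro bexI[of _ "p \<oplus>\<^bsub>L\<^esub> q"]) (simp_all add: Jquot_simps)
  qed
  assume z: "z \<in> carrier (Jhat X W)"
  show "x \<oplus>\<^bsub>Jhat X W\<^esub> y \<oplus>\<^bsub>Jhat X W\<^esub> z = x \<oplus>\<^bsub>Jhat X W\<^esub> (y \<oplus>\<^bsub>Jhat X W\<^esub> z)"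
    using comp[OF x] comp[OF y] comp[OF z] by (simp add: Jhat_simps Q.a_assoc)
qed

lemma to_Jhat_finsum:
  assumes "finite A" "f \<in> A \<rightarrow> carrier L"
  shows "(\<Oplus>\<^bsub>Jhat X W\<^esub>i\<in>A. to_Jhat X W (f i)) = to_Jhat X W (\<Oplus>\<^bsub>L\<^esub>i\<in>A. f i)"
  using assms
proof (induction A)
  interpret H: abelian_monoid "Jhat X W" by (rule Jhat_abelian_monoid)
  case empty
  show ?case by (simp add: Jhat_simps Jquot_simps to_Jhat_def)
next
  interpret H: abelian_monoid "Jhat X W" by (rule Jhat_abelian_monoid)
  case (insert i A)
  then have f: "f \<in> A \<rightarrow> carrier L" "f i \<in> carrier L" by auto
  then have "(\<lambda>i. to_Jhat X W (f i)) \<in> A \<rightarrow> carrier (Jhat X W)" "to_Jhat X W (f i) \<in> carrier (Jhat X W)"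
    using to_Jhat_closed by auto
  moreover have "to_Jhat X W p \<oplus>\<^bsub>Jhat X W\<^esub> to_Jhat X W q = to_Jhat X W (p \<oplus>\<^bsub>L\<^esub> q)"
    if "p \<in> carrier L" "q \<in> carrier L" for p q
    using that by (simp add: Jhat_simps to_Jhat_def Jquot_simps)
  ultimately show ?case
    using f insert by simp
qed

text \<open>
  The factors of the inverse limit are discrete, so a sequence converges as soon as each of its
  components is eventually equal to that of the limit.
\<close>

lemma Jhat_sumsI:
  assumes f: "\<And>k. f k \<in> carrier L" and p: "p \<in> carrier L"
    and approx: "\<And>k n. k < n \<Longrightarrow> (\<Oplus>\<^bsub>L\<^esub>i\<in>{..<n}. f i) \<ominus>\<^bsub>L\<^esub> p \<in> Jker X W k"
  shows "Jhat_sums X W (\<lambda>k. to_Jhat X W (f k)) (to_Jhat X W p)"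
proof -
  let ?S = "\<lambda>n. \<Oplus>\<^bsub>L\<^esub>i\<in>{..<n}. f i"
  let ?T = "product_topology (\<lambda>k. discrete_topology (carrier (Jquot X W k))) UNIV"
  have S: "?S n \<in> carrier L" for n using f by (intro L.finsum_closed) auto
  have sum: "(\<Oplus>\<^bsub>Jhat X W\<^esub>k\<in>{..<n}. to_Jhat X W (f k)) = to_Jhat X W (?S n)" for n :: nat
    by (rule to_Jhat_finsum) (use f in auto)
  have comp: "to_Jhat X W q k \<in> carrier (Jquot X W k)" if "q \<in> carrier L" for q k
    using that by (simp add: to_Jhat_def Jquot_simps)
  have "limitin (discrete_topology (carrier (Jquot X W k))) (\<lambda>n. to_Jhat X W (?S n) k)
      (to_Jhat X W p k) sequentially" for k
  proof (rule limitin_eventually)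
    show "\<forall>\<^sub>F n in sequentially. to_Jhat X W (?S n) k = to_Jhat X W p k"
      unfolding eventually_sequentially to_Jhat_def
      using approx[of k] coset_eq_iff[OF L.module_axioms Jker_submodule S p]
      by (intro exI[of _ "Suc k"]) simp
  qed (use comp[OF p] in simp)
  then have "limitin ?T (\<lambda>n. to_Jhat X W (?S n)) (to_Jhat X W p) sequentially"
    unfolding limitin_componentwise using comp[OF S] by (simp add: PiE_UNIV_domain)
  then show ?thesis
    unfolding Jhat_sums_def Jhat_topology_def limitin_subtopology sum
    using to_Jhat_closed[OF p] to_Jhat_closed[OF S] by simp
qed

lemma Jhat_suminf_eq:
  assumes "Jhat_sums X W t x"
  shows "Jhat_suminf X W t = x"
proof -
  have "Hausdorff_space (Jhat_topology X W)"
    unfolding Jhat_topology_def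
    by (intro Hausdorff_space_subtopology) (simp add: Hausdorff_space_product_topology)
  then have unique: "y = x" if "Jhat_sums X W t y" for y
    using limitin_Hausdorff_unique[of "Jhat_topology X W"] assms that
    unfolding Jhat_sums_def by (meson trivial_limit_sequentially)
  show ?thesis
    unfolding Jhat_suminf_def by (rule the_equality) (fact assms, rule unique)
qed


section \<open>Inverting a function in the second factor\<close>

lemma pure_pow:
  assumes a: "a \<in> carrier B" and b: "b \<in> carrier B"
  shows "pure B B a b [^]\<^bsub>BB\<^esub> (n::nat) = pure B B (a [^]\<^bsub>B\<^esub> n) (b [^]\<^bsub>B\<^esub> n)"
proof (induction n)
  case 0
  show ?case by (simp add: Areg2_def tensor_algebra_product_simps[OF AB AB])
next
  case (Suc n)
  then show ?case using a b mult_pure[OF AB AB] by (simp add: Areg2_def)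
qed

context
  fixes h and \<eta> :: "('k, 'n) vfield"
  assumes h: "h \<in> Units B" and \<eta>: "\<eta> \<in> carrier (Vect X W)"
begin

text \<open>
  The elements of \<open>B \<otimes> B\<close> that enter the geometric series. That \<open>z\<close> is the product of \<open>u\<close> and \<open>\<delta>(h)\<close>
  is lemma \<open>u_delta\<close>.
\<close>

private definition "h' = inv\<^bsub>B\<^esub> h"
private definition "u = pure B B h' \<one>\<^bsub>B\<^esub>"
private definition "v = pure B B \<one>\<^bsub>B\<^esub> h"
private definition "v' = pure B B \<one>\<^bsub>B\<^esub> h'"
private definition "z = \<one>\<^bsub>BB\<^esub> \<ominus>\<^bsub>BB\<^esub> u \<otimes>\<^bsub>BB\<^esub> v"

private lemma h_facts: "h \<in> carrier B" "h' \<in> carrier B" "h' \<otimes>\<^bsub>B\<^esub> h = \<one>\<^bsub>B\<^esub>" "h \<otimes>\<^bsub>B\<^esub> h' = \<one>\<^bsub>B\<^esub>"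
  using h by (auto simp: h'_def)

private lemma pure_BB_closed: "a \<in> carrier B \<Longrightarrow> b \<in> carrier B \<Longrightarrow> pure B B a b \<in> carrier BB"
  unfolding Areg2_def tensor_algebra_product_simps[OF AB AB] by (rule pure_closed[OF B.module B.module])

private lemma pure_BB_mult: "a \<in> carrier B \<Longrightarrow> b \<in> carrier B \<Longrightarrow> a' \<in> carrier B \<Longrightarrow> b' \<in> carrier B \<Longrightarrow>
    pure B B a b \<otimes>\<^bsub>BB\<^esub> pure B B a' b' = pure B B (a \<otimes>\<^bsub>B\<^esub> a') (b \<otimes>\<^bsub>B\<^esub> b')"
  unfolding Areg2_def by (rule mult_pure[OF AB AB])

private lemma one_BB: "\<one>\<^bsub>BB\<^esub> = pure B B \<one>\<^bsub>B\<^esub> \<one>\<^bsub>B\<^esub>"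
  unfolding Areg2_def tensor_algebra_product_simps[OF AB AB] ..

private lemma uv_facts: "u \<in> carrier BB" "v \<in> carrier BB" "v' \<in> carrier BB" "v' \<otimes>\<^bsub>BB\<^esub> v = \<one>\<^bsub>BB\<^esub>" "z \<in> carrier BB"
  "u \<otimes>\<^bsub>BB\<^esub> v = pure B B h' h"
  using h_facts by (simp_all add: u_def v_def v'_def z_def pure_BB_closed pure_BB_mult one_BB[symmetric])

private lemma inv_pow: "inv\<^bsub>B\<^esub> (h [^]\<^bsub>B\<^esub> (n::nat)) = h' [^]\<^bsub>B\<^esub> n"
proof (rule B.comm_inv_char)
  show "h [^]\<^bsub>B\<^esub> n \<otimes>\<^bsub>B\<^esub> h' [^]\<^bsub>B\<^esub> n = \<one>\<^bsub>B\<^esub>"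
    using h_facts B.nat_pow_distrib[of h h' n] by simp
qed (use h_facts in simp_all)

private lemma delta_eq: "delta X W h = pure B B h \<one>\<^bsub>B\<^esub> \<ominus>\<^bsub>BB\<^esub> v"
  by (simp add: delta_def Let_def v_def)

private lemma delta_closed: "delta X W h \<in> carrier BB"
  using h_facts pure_BB_closed uv_facts(1-5) by (simp add: delta_eq)

private lemma u_delta: "u \<otimes>\<^bsub>BB\<^esub> delta X W h = z"
proof -
  have "u \<otimes>\<^bsub>BB\<^esub> delta X W h = u \<otimes>\<^bsub>BB\<^esub> pure B B h \<one>\<^bsub>B\<^esub> \<ominus>\<^bsub>BB\<^esub> u \<otimes>\<^bsub>BB\<^esub> v"
    using h_facts pure_BB_closed uv_facts(1-5) by (simp add: delta_eq a_minus_def BB.r_distr BB.r_minus)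
  also have "u \<otimes>\<^bsub>BB\<^esub> pure B B h \<one>\<^bsub>B\<^esub> = \<one>\<^bsub>BB\<^esub>"
    using h_facts by (simp add: u_def pure_BB_mult one_BB)
  finally show ?thesis by (simp add: z_def)
qed

private lemma delta_in_Delta: "delta X W h \<in> Delta X W"
proof -
  let ?\<mu> = "lin_lift B (\<lambda>(a, b). a \<otimes>\<^bsub>B\<^esub> b)"
  have "?\<mu> (delta X W h) = ?\<mu> (pure B B h \<one>\<^bsub>B\<^esub>) \<ominus>\<^bsub>B\<^esub> ?\<mu> v"
    unfolding delta_eq
    using linear_map_minus[OF multiplication_map_linear[OF AB] _ B.module, folded Areg2_def]
      BB.module pure_BB_closed h_facts uv_facts(1-5) by simp
  also have "\<dots> = \<zero>\<^bsub>B\<^esub>"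
    using h_facts multiplication_map_pure[OF AB] by (simp add: v_def a_minus_def B.r_neg)
  finally show ?thesis
    using delta_closed unfolding Delta_def a_kernel_def' by simp
qed

text \<open>
  The error term of the geometric series is small in the topology defined by the powers of \<open>\<Delta>\<close>.
\<close>

private lemma z_power_in_ideal_power: "w \<in> carrier BB \<Longrightarrow> w \<otimes>\<^bsub>BB\<^esub> z [^]\<^bsub>BB\<^esub> (n::nat) \<in> ideal_power BB (Delta X W) n"
  using ideal.I_l_closed[OF BB.ideal_power_ideal[OF Delta_ideal]
      BB.pow_in_ideal_power[OF Delta_ideal ideal.I_l_closed[OF Delta_ideal delta_in_Delta uv_facts(1)]]]
  by (simp add: u_delta)

text \<open>
  As \<open>1/h\<^sup>k\<^sup>+\<^sup>1 \<otimes> 1 = u\<^sup>k\<^sup>+\<^sup>1\<close>, the factor \<open>u\<^sup>k\<close> can be combined with \<open>\<delta>(h)\<^sup>k\<close> to \<open>z\<^sup>k\<close>.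
\<close>

private lemma delta_term_eq:
  "pure B B (inv\<^bsub>B\<^esub> (h [^]\<^bsub>B\<^esub> (k + 1))) \<one>\<^bsub>B\<^esub> \<otimes>\<^bsub>BB\<^esub> (delta X W h [^]\<^bsub>BB\<^esub> (k::nat)) = u \<otimes>\<^bsub>BB\<^esub> z [^]\<^bsub>BB\<^esub> k"
proof -
  have "pure B B (inv\<^bsub>B\<^esub> (h [^]\<^bsub>B\<^esub> (k + 1))) \<one>\<^bsub>B\<^esub> = u [^]\<^bsub>BB\<^esub> (k + 1)"
    using h_facts pure_pow[of h' "\<one>\<^bsub>B\<^esub>" "k + 1"] by (simp add: inv_pow[of "k + 1", simplified] u_def)
  also have "\<dots> = u \<otimes>\<^bsub>BB\<^esub> u [^]\<^bsub>BB\<^esub> k"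
    using uv_facts(1-5) by (simp add: BB.m_comm)
  finally show ?thesis
    using uv_facts(1-5) delta_closed BB.nat_pow_distrib[of u "delta X W h" k] by (simp add: BB.m_assoc u_delta)
qed

text \<open>
  The binomial expansion of \<open>u (1 - u v)\<^sup>k\<close>, in which \<open>u (u v)\<^sup>s = 1/h\<^sup>s\<^sup>+\<^sup>1 \<otimes> h\<^sup>s\<close>.
\<close>

private lemma inner_sum_eq:
  "(\<Oplus>\<^bsub>L\<^esub>s\<in>{0..k}. ((-1) ^ s * of_nat (k choose s)) \<odot>\<^bsub>L\<^esub>
      hash X W (inv\<^bsub>B\<^esub> (h [^]\<^bsub>B\<^esub> (s + 1))) (vf_scale (h [^]\<^bsub>B\<^esub> s) \<eta>)) =
    bitensor_vf X W (u \<otimes>\<^bsub>BB\<^esub> z [^]\<^bsub>BB\<^esub> k) \<eta>"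
proof -
  let ?c = "\<lambda>s. (-1) ^ s * of_nat (k choose s) :: 'k"
  let ?p = "\<lambda>s::nat. pure B B (inv\<^bsub>B\<^esub> (h [^]\<^bsub>B\<^esub> (s + 1))) (h [^]\<^bsub>B\<^esub> s)"
  have ih: "inv\<^bsub>B\<^esub> (h [^]\<^bsub>B\<^esub> (s + 1)) = h' \<otimes>\<^bsub>B\<^esub> h' [^]\<^bsub>B\<^esub> s" for s :: nat
    using h_facts inv_pow[of "s + 1"] by (simp add: B.m_comm)
  have p: "?p s \<in> carrier BB" for s
    unfolding ih by (rule pure_BB_closed) (use h_facts in simp_all)
  have up: "u \<otimes>\<^bsub>BB\<^esub> (u \<otimes>\<^bsub>BB\<^esub> v) [^]\<^bsub>BB\<^esub> s = ?p s" for s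
    unfolding uv_facts(6) ih using h_facts by (simp add: pure_pow u_def pure_BB_mult)
  have cp: "?c s \<odot>\<^bsub>BB\<^esub> ?p s \<in> carrier BB" for s
    by (rule vs_closed[OF BB.module p])
  have hash: "bitensor_vf X W (?p s) \<eta> = hash X W (inv\<^bsub>B\<^esub> (h [^]\<^bsub>B\<^esub> (s + 1))) (vf_scale (h [^]\<^bsub>B\<^esub> s) \<eta>)"
    for s
    unfolding ih by (rule bitensor_vf_pure[OF \<eta>]) (use h_facts in simp_all)
  have "u \<otimes>\<^bsub>BB\<^esub> z [^]\<^bsub>BB\<^esub> k = u \<otimes>\<^bsub>BB\<^esub> (\<Oplus>\<^bsub>BB\<^esub>s\<in>{..k}. ?c s \<odot>\<^bsub>BB\<^esub> ((u \<otimes>\<^bsub>BB\<^esub> v) [^]\<^bsub>BB\<^esub> s))"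
    unfolding z_def using uv_facts(1-5) by (subst binomial_one_minus[OF Areg2_algebra]) simp_all
  also have "\<dots> = (\<Oplus>\<^bsub>BB\<^esub>s\<in>{..k}. u \<otimes>\<^bsub>BB\<^esub> (?c s \<odot>\<^bsub>BB\<^esub> ((u \<otimes>\<^bsub>BB\<^esub> v) [^]\<^bsub>BB\<^esub> s)))"
    by (rule linear_map_finsum[OF mult_linear[OF Areg2_algebra uv_facts(1)] BB.module BB.module])
      (use uv_facts(1-5) vs_closed[OF BB.module] in simp_all)
  also have "\<dots> = (\<Oplus>\<^bsub>BB\<^esub>s\<in>{0..k}. ?c s \<odot>\<^bsub>BB\<^esub> ?p s)"
    using uv_facts(1-5) by (simp only: alg_smult_right[OF Areg2_algebra] BB.nat_pow_closed BB.m_closed up atLeast0AtMost)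
  finally have "bitensor_vf X W (u \<otimes>\<^bsub>BB\<^esub> z [^]\<^bsub>BB\<^esub> k) \<eta> =
      (\<Oplus>\<^bsub>L\<^esub>s\<in>{0..k}. bitensor_vf X W (?c s \<odot>\<^bsub>BB\<^esub> ?p s) \<eta>)"
    using linear_map_finsum[OF bitensor_vf_linear[OF \<eta>] BB.module L.module_axioms, of "{0..k}"] cp
    by simp
  also have "\<dots> = (\<Oplus>\<^bsub>L\<^esub>s\<in>{0..k}. ?c s \<odot>\<^bsub>L\<^esub> bitensor_vf X W (?p s) \<eta>)"
    using linear_mapD(3)[OF bitensor_vf_linear[OF \<eta>] p] by simp
  finally show ?thesis by (simp only: hash)
qed

text \<open>
  Both series have the terms \<open>(u z\<^sup>k) \<eta>\<close>, and \<open>x\<close> comes from \<open>v' \<eta>\<close>.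
  The partial sums differ from \<open>x\<close> by the image of \<open>- v' z\<^sup>n\<close>, which lies in \<open>Jker X W k\<close> for \<open>k < n\<close>.
\<close>

lemma inverse_vf_expansion:
  defines "x \<equiv> to_Jhat X W (hash X W \<one>\<^bsub>B\<^esub> (vf_scale (inv\<^bsub>B\<^esub> h) \<eta>))"
  shows "Jhat_sums X W (\<lambda>k::nat. to_Jhat X W (bitensor_vf X W
      (pure B B (inv\<^bsub>B\<^esub> (h [^]\<^bsub>B\<^esub> (k + 1))) \<one>\<^bsub>B\<^esub> \<otimes>\<^bsub>BB\<^esub> (delta X W h [^]\<^bsub>BB\<^esub> k)) \<eta>)) x"
    and "Jhat_sums X W (\<lambda>k. to_Jhat X W (\<Oplus>\<^bsub>L\<^esub>s\<in>{0..k}. ((-1) ^ s * of_nat (k choose s)) \<odot>\<^bsub>L\<^esub>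
      hash X W (inv\<^bsub>B\<^esub> (h [^]\<^bsub>B\<^esub> (s + 1))) (vf_scale (h [^]\<^bsub>B\<^esub> s) \<eta>))) x"
proof -
  let ?\<beta> = "\<lambda>w. bitensor_vf X W w \<eta>"
  note \<beta> = bitensor_vf_linear[OF \<eta>]
  have uz: "u \<otimes>\<^bsub>BB\<^esub> z [^]\<^bsub>BB\<^esub> (k::nat) \<in> carrier BB" "v' \<otimes>\<^bsub>BB\<^esub> z [^]\<^bsub>BB\<^esub> k \<in> carrier BB" for k
    using uv_facts(1-5) by simp_all
  have x: "x = to_Jhat X W (?\<beta> v')"
    using bitensor_vf_pure[OF \<eta> _ h_facts(2), of "\<one>\<^bsub>B\<^esub>"] by (simp add: x_def v'_def h'_def)
  have "Jhat_sums X W (\<lambda>k. to_Jhat X W (?\<beta> (u \<otimes>\<^bsub>BB\<^esub> z [^]\<^bsub>BB\<^esub> (k::nat)))) x"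
    unfolding x
  proof (rule Jhat_sumsI)
    fix k n :: nat assume "k < n"
    have "(\<Oplus>\<^bsub>L\<^esub>i\<in>{..<n}. ?\<beta> (u \<otimes>\<^bsub>BB\<^esub> z [^]\<^bsub>BB\<^esub> i)) = ?\<beta> (\<Oplus>\<^bsub>BB\<^esub>i\<in>{..<n}. u \<otimes>\<^bsub>BB\<^esub> z [^]\<^bsub>BB\<^esub> i)"
      by (rule linear_map_finsum[OF \<beta> BB.module L.module_axioms, symmetric]) (use uz in auto)
    also have "\<dots> = ?\<beta> (v' \<ominus>\<^bsub>BB\<^esub> v' \<otimes>\<^bsub>BB\<^esub> z [^]\<^bsub>BB\<^esub> n)"
      using geometric_sum[OF Areg2_algebra uv_facts(1-4)] by (simp add: z_def)
    finally have "(\<Oplus>\<^bsub>L\<^esub>i\<in>{..<n}. ?\<beta> (u \<otimes>\<^bsub>BB\<^esub> z [^]\<^bsub>BB\<^esub> i)) \<ominus>\<^bsub>L\<^esub> ?\<beta> v' =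
        ?\<beta> ((v' \<ominus>\<^bsub>BB\<^esub> v' \<otimes>\<^bsub>BB\<^esub> z [^]\<^bsub>BB\<^esub> n) \<ominus>\<^bsub>BB\<^esub> v')"
      using linear_map_minus[OF \<beta> BB.module L.module_axioms] uz uv_facts(1-5) by simp
    also have "(v' \<ominus>\<^bsub>BB\<^esub> v' \<otimes>\<^bsub>BB\<^esub> z [^]\<^bsub>BB\<^esub> n) \<ominus>\<^bsub>BB\<^esub> v' = (\<ominus>\<^bsub>BB\<^esub> v') \<otimes>\<^bsub>BB\<^esub> z [^]\<^bsub>BB\<^esub> n"
      using uv_facts(1-5) uz[of n] by (simp add: a_minus_def BB.l_minus BB.a_ac BB.r_neg2)
    finally have eq: "(\<Oplus>\<^bsub>L\<^esub>i\<in>{..<n}. ?\<beta> (u \<otimes>\<^bsub>BB\<^esub> z [^]\<^bsub>BB\<^esub> i)) \<ominus>\<^bsub>L\<^esub> ?\<beta> v' =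
        ?\<beta> ((\<ominus>\<^bsub>BB\<^esub> v') \<otimes>\<^bsub>BB\<^esub> z [^]\<^bsub>BB\<^esub> n)" .
    have "(\<ominus>\<^bsub>BB\<^esub> v') \<otimes>\<^bsub>BB\<^esub> z [^]\<^bsub>BB\<^esub> n \<in> ideal_power BB (Delta X W) (k + 1)"
      using z_power_in_ideal_power[of "\<ominus>\<^bsub>BB\<^esub> v'" n] uv_facts BB.ideal_power_antimono[OF Delta_ideal, of "k + 1" n] \<open>k < n\<close>
      by auto
    then show "(\<Oplus>\<^bsub>L\<^esub>i\<in>{..<n}. ?\<beta> (u \<otimes>\<^bsub>BB\<^esub> z [^]\<^bsub>BB\<^esub> i)) \<ominus>\<^bsub>L\<^esub> ?\<beta> v' \<in> Jker X W k"
      unfolding eq by (rule bitensor_vf_in_Jker[OF _ \<eta>])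
  qed (use linear_mapD(1)[OF \<beta>] uz uv_facts(1-5) in auto)
  then show "Jhat_sums X W (\<lambda>k::nat. to_Jhat X W (?\<beta>
      (pure B B (inv\<^bsub>B\<^esub> (h [^]\<^bsub>B\<^esub> (k + 1))) \<one>\<^bsub>B\<^esub> \<otimes>\<^bsub>BB\<^esub> (delta X W h [^]\<^bsub>BB\<^esub> k)))) x"
    and "Jhat_sums X W (\<lambda>k. to_Jhat X W (\<Oplus>\<^bsub>L\<^esub>s\<in>{0..k}. ((-1) ^ s * of_nat (k choose s)) \<odot>\<^bsub>L\<^esub>
      hash X W (inv\<^bsub>B\<^esub> (h [^]\<^bsub>B\<^esub> (s + 1))) (vf_scale (h [^]\<^bsub>B\<^esub> s) \<eta>))) x"
    unfolding inner_sum_eq delta_term_eq by simp_all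
qed

end

end

theorem proposition27:
  fixes X U :: "('k::{alg_closed_field, field_char_0}, 'n::finite) proj set"
    and g :: "('k, 'n) proj \<Rightarrow> 'k" and \<eta> :: "('k, 'n) vfield"
  assumes "quasi_projective X" and "irreducible_space (zariski_on X)" and "smooth_variety X"
    and "affine_open X U"
    and "g \<in> carrier (Areg X U)" and "g \<noteq> \<zero>\<^bsub>Areg X U\<^esub>"
    and "\<eta> \<in> carrier (Vect X U)"
  shows "let Ug = {P \<in> U. g P \<noteq> 0};
             Ag = Areg X Ug; JV = AhashV X Ug; AA = Areg2 X Ug;
             h = restrict_fun Ug g; \<theta> = restrict_vf Ug \<eta>;
             x = to_Jhat X Ug (hash X Ug \<one>\<^bsub>Ag\<^esub> (vf_scale (inv\<^bsub>Ag\<^esub> h) \<theta>));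
             t1 = (\<lambda>k::nat. to_Jhat X Ug (\<Oplus>\<^bsub>JV\<^esub>s\<in>{0..k}. ((-1) ^ s * of_nat (k choose s)) \<odot>\<^bsub>JV\<^esub>
                    hash X Ug (inv\<^bsub>Ag\<^esub> (h [^]\<^bsub>Ag\<^esub> (s + 1))) (vf_scale (h [^]\<^bsub>Ag\<^esub> s) \<theta>)));
             t2 = (\<lambda>k::nat. to_Jhat X Ug (bitensor_vf X Ug
                    (pure Ag Ag (inv\<^bsub>Ag\<^esub> (h [^]\<^bsub>Ag\<^esub> (k + 1))) \<one>\<^bsub>Ag\<^esub>
                      \<otimes>\<^bsub>AA\<^esub> (delta X Ug h [^]\<^bsub>AA\<^esub> k)) \<theta>))
         in Jhat_sums X Ug t1 x \<and> Jhat_sums X Ug t2 x \<and>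
            to_AVhat X Ug x = to_AVhat X Ug (Jhat_suminf X Ug t1) \<and>
            to_AVhat X Ug x = to_AVhat X Ug (Jhat_suminf X Ug t2)"
proof -
  define Ug where "Ug = {P \<in> U. g P \<noteq> 0}"
  have g: "g \<in> regular_functions X U" using assms(5) by (simp add: Areg_simps)
  have W: "openin (zariski_on X) Ug" unfolding Ug_def by (rule nonvanishing_open[OF g])
  have sub: "Ug \<subseteq> U" by (auto simp: Ug_def)
  have h: "restrict_fun Ug g \<in> Units (Areg X Ug)"
    using nonvanishing_regular_unit[OF W regular_restrict[OF W sub g]] by (simp add: restrict_fun_def Ug_def)
  have \<theta>: "restrict_vf Ug \<eta> \<in> carrier (Vect X Ug)"
    using restrict_vf_vfield[OF sub] assms(7) by (simp add: Vect_simps)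
  note S = inverse_vf_expansion[OF W h \<theta>]
  show ?thesis
    unfolding Let_def Ug_def[symmetric]
    using S Jhat_suminf_eq[OF W S(1)] Jhat_suminf_eq[OF W S(2)] by simp
qed

end
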